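(* The collection $\mathcal A=\bigcup_{k\ge 1}\mathcal A_k$ of coherently alternating elements is closed under compositions in alternating planar diagrams. That is, let $d\ge 1$, let $D$ be a $d$-input type-$\mathcal A$ planar diagram with $2k_i$ arc ends on its $i$-th input disc and $2k$ arc ends on its external boundary, and let $P_i\in\mathcal A_{k_i}$ ($1\le i\le d$) be elements whose boundary patterns match the orientations of $D$ at the $i$-th input disc. Then $D(P_1,\dots,P_d)\in\mathcal A_k$.
   Context: Smoothings. Let $k\ge1$ and fix $2k$ points on the boundary circle of a disc, labelled alternately "in" and "out" around the circle (a boundary pattern). A $k$-strand smoothing (possibly with loops) is a planar isotopy class, rel boundary, of $k$ disjoint open arcs with endpoints the $2k$ points together with finitely many disjoint circles (loops) in the disc, with no crossings, oriented so that each open strand begins at an in-point and ends at an out-point and each region (connected component of the complement in the disc) lies either to the left of all strands on its boundary (positive region; boundary counterclockwise) or to the right of all of them (negative region; boundary clockwise). $\mathcal S_k^{(o)}$ is the set of $k$-strand smoothings without loops, and $\mathcal M_k^{(o)}$ is the free $\mathbb Z[q,q^{-1}]$-module with basis $\mathcal S_k^{(o)}$. Rotation number. For an open strand $\alpha$ of a $k$-strand smoothing, number the boundary points $0,\dots,2k-1$ counterclockwise starting at the in-point of $\alpha$; if $\alpha$ ends at point $i$, put $R(\alpha)=\frac{i-k}{2k}$. For a loop, $R=1$ if counterclockwise and $R=-1$ if clockwise. $R(\sigma)$ is the sum of the rotation numbers of all strands and loops of $\sigma$. A string is minimal if it is a clockwise loop or has rotation number $\frac{1-k}{2k}$, maximal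 if it is a counterclockwise loop or has rotation number $\frac{k-1}{2k}$; a smoothing is minimal (maximal) if all its strings are. Diagrams. A $d$-input planar diagram $D$ is a disc $D_0$ with disjoint closed discs $D_1,\dots,D_d$ in its interior and disjoint embedded arcs (and possibly circles) in the complement of the input discs, arcs ending transversally on the boundaries of the discs $D_0,\dots,D_d$, with a marked point on each disc (used to match boundary points on insertion), up to planar isotopy. It is type-$\mathcal A$ (alternating) if: the number of arcs ending on the external boundary is $>0$; the union of the arcs (strings) and the boundaries of the input discs is connected; the arcs are oriented and incoming and outgoing arcs alternate along every boundary component. Arcs with both ends on the same input disc are curls; arcs joining different input discs are interconnecting arcs; arcs joining an input disc to the external boundary are boundary arcs. Action. Smoothings can be inserted in the input discs when the numbers of boundary points and the orientations match. On elements of $\mathcal M_{k_1}^{(o)},\dots,\mathcal M_{k_d}^{(o)}$, $D$ acts multilinearly: insert basis smoothings, delete each resulting loop at the cost of a factor $q+q^{-1}$, and collect like terms, giving an element of $\mathcal M_k^{(o)}$. A unary basic diagram is a 1-input type-$\mathcal A$ diagram with exactly one curl; its operator is a unary basic operator. Alternating polynomials. A Laurent polynomial is alternating if it is of the form $\sum_{i=0}^n(-1)^{r+i}a_iq^{t+2i}$ with $r,t\in\mathbb Z$ and integers $a_i\ge0$. Two alternating polynomials have the same parity if they can be written in this form with the same $r$ and $t$ (and nonnegative $a_i$, $b_i$). Alternating elements. $P=A_0\sigma_0+\dots+A_m\sigma_m\in\mathcal M_k^{(o)}$ (with $\sigma_0$ the minimal and $\sigma_m$ the maximal smoothing, coefficients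 possibly zero) is alternating if every $A_i$ is an alternating polynomial and there are $c_1,c_2\in\frac12\mathbb Z$ such that each $A_i$ has the same parity as $(-1)^{R(\sigma_i)+c_1}q^{R(\sigma_i)+c_2}$. A partial closure of $P\in\mathcal M_k^{(o)}$ is an element $D_l\circ\cdots\circ D_1(P)$ with $0\le l<k$ and every $D_i$ a unary basic operator. $P$ is coherently alternating if it is alternating and every partial closure of it is alternating; $\mathcal A_k$ is the set of coherently alternating elements of $\mathcal M_k^{(o)}$. *)

theory Defs
  imports Complex_Main "HOL-Library.Poly_Mapping" "HOL-Library.FuncSet"
    "HOL-Combinatorics.Permutations"
begin

section \<open>Smoothings and rotation numbers\<close>

text \<open>
  A boundary pattern with \<open>2 k\<close> points is a pair \<open>(k, b)\<close>: the points are numbered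
  \<open>0, \<dots>, 2 k - 1\<close> counterclockwise from the marked point, and \<open>b\<close> tells whether point \<open>0\<close>
  is an in-point.
\<close>

definition in_point :: "bool \<Rightarrow> nat \<Rightarrow> bool" where
  "in_point b i \<longleftrightarrow> (even i \<longleftrightarrow> b)"

text \<open>
  The planar isotopy class (rel boundary) of a loop-free smoothing is determined by which boundary
  points its strands join, and the pairings that occur are the non-crossing ones;
  \<open>\<sigma> i\<close> is the other end of the strand at \<open>i\<close>. A strand is oriented from its in-point to its
  out-point. The condition on regions then holds automatically: walking around a region, one
  passes from the strand with ends \<open>i\<close> and \<open>\<sigma> i\<close> to the strand at the neighbour \<open>\<sigma> i + 1\<close> of
  \<open>\<sigma> i\<close>, which is an in-point iff \<open>i\<close> is.
\<close>

definition smoothings :: "nat \<Rightarrow> bool \<Rightarrow> (nat \<Rightarrow> nat) set" where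
  "smoothings k b = {\<sigma>. \<sigma> permutes {..<2 * k} \<and>
     (\<forall>i<2 * k. \<sigma> (\<sigma> i) = i \<and> (in_point b (\<sigma> i) \<longleftrightarrow> \<not> in_point b i)) \<and>
     (\<nexists>i j. i < j \<and> j < \<sigma> i \<and> \<sigma> i < \<sigma> j)}"

definition strand_rotation :: "nat \<Rightarrow> nat \<Rightarrow> nat \<Rightarrow> rat" where
  "strand_rotation k i j =
     (of_int ((int j - int i) mod (2 * int k)) - of_nat k) / (2 * of_nat k)"

definition rotation_number :: "nat \<Rightarrow> bool \<Rightarrow> (nat \<Rightarrow> nat) \<Rightarrow> rat" where
  "rotation_number k b \<sigma> = (\<Sum>i | i < 2 * k \<and> in_point b i. strand_rotation k i (\<sigma> i))"


section \<open>Laurent polynomials and the modules of smoothings\<close>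

text \<open>\<open>int \<Rightarrow>\<^sub>0 int\<close> with its convolution product is the ring of Laurent polynomials over the
  integers; the exponents are the keys.\<close>

type_synonym laurent = "int \<Rightarrow>\<^sub>0 int"

definition q :: laurent where "q = Poly_Mapping.single 1 1"

definition q_inverse :: laurent where "q_inverse = Poly_Mapping.single (-1) 1"

type_synonym element = "(nat \<Rightarrow> nat) \<Rightarrow>\<^sub>0 laurent"

definition smoothing_module :: "nat \<Rightarrow> bool \<Rightarrow> element set" where
  "smoothing_module k b = {P. Poly_Mapping.keys P \<subseteq> smoothings k b}"


section \<open>Type-A planar diagrams\<close>

text \<open>
  The discs of a diagram with \<open>d\<close> inputs are numbered \<open>0, \<dots>, d\<close>, disc \<open>0\<close> being the external one.
  The arc ends on the boundary circle of disc \<open>j\<close> are the pairs \<open>(j, i)\<close> with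
  \<open>i < num_ends D j\<close>, numbered counterclockwise along that circle from its marked point.
  \<open>partner D x\<close> is the other end of the arc ending at \<open>x\<close>, and \<open>tail D x\<close> says that this arc
  starts at \<open>x\<close>.

  Closed circles are not represented: a type-A diagram has an arc ending on the external boundary,
  so by connectedness it contains no circle. A connected diagram is determined up to planar isotopy
  by the data below, and the data that occur are those for which the embedded graph, with the
  discs as vertices, lies on a sphere (the external disc being closed off by a disc at infinity).
\<close>

type_synonym arc_end = "nat \<times> nat"

record diagram =
  num_inputs :: nat
  num_ends :: "nat \<Rightarrow> nat"
  partner :: "arc_end \<Rightarrow> arc_end"
  tail :: "arc_end \<Rightarrow> bool"

definition arc_ends :: "diagram \<Rightarrow> arc_end set" where
  "arc_ends D = {(j, i). j \<le> num_inputs D \<and> i < num_ends D j}"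

definition arcs :: "diagram \<Rightarrow> arc_end set set" where
  "arcs D = (\<lambda>x. {x, partner D x}) ` arc_ends D"

definition input_circles :: "diagram \<Rightarrow> arc_end set set" where
  "input_circles D = (\<lambda>j. {j} \<times> {..<num_ends D j}) ` {1..num_inputs D}"

definition well_formed :: "diagram \<Rightarrow> bool" where
  "well_formed D \<longleftrightarrow>
     (\<forall>x\<in>arc_ends D. partner D x \<in> arc_ends D \<and> partner D x \<noteq> x \<and> partner D (partner D x) = x)"

text \<open>
  The faces are the orbits of the walk that keeps the face on the left. Having followed an arc to
  its end on an input disc, the walk goes clockwise along the circle of that disc to the next arc
  end; on the external circle, which is seen from the inside, it goes counterclockwise.
\<close>

fun next_end :: "diagram \<Rightarrow> arc_end \<Rightarrow> arc_end" where
  "next_end D (j, i) =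
     (if j = 0 then (0, (i + 1) mod num_ends D 0)
      else (j, (i + num_ends D j - 1) mod num_ends D j))"

definition faces :: "diagram \<Rightarrow> arc_end set set" where
  "faces D = arc_ends D // {(x, next_end D (partner D x)) | x. x \<in> arc_ends D}\<^sup>*"

text \<open>Euler's formula for a connected graph on the sphere with vertices the \<open>num_inputs D + 1\<close>
  discs.\<close>

definition planar :: "diagram \<Rightarrow> bool" where
  "planar D \<longleftrightarrow> num_inputs D + 1 + card (faces D) = card (arcs D) + 2"

text \<open>An arc and a circle meet iff they have an arc end in common. A circle without arc
  ends is the empty set, which meets no other piece.\<close>

definition connected_pieces :: "arc_end set set \<Rightarrow> bool" where
  "connected_pieces F \<longleftrightarrow>
     (\<forall>A\<in>F. \<forall>B\<in>F. (A, B) \<in> {(X, Y). X \<in> F \<and> Y \<in> F \<and> X \<inter> Y \<noteq> {}}\<^sup>*)"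

definition type_A :: "diagram \<Rightarrow> bool" where
  "type_A D \<longleftrightarrow> well_formed D \<and>
     num_ends D 0 > 0 \<and>
     connected_pieces (arcs D \<union> input_circles D) \<and>
     planar D \<and>
     (\<forall>x\<in>arc_ends D. tail D (partner D x) \<longleftrightarrow> \<not> tail D x) \<and>
     (\<forall>j\<le>num_inputs D. \<forall>i<num_ends D j.
        tail D (j, (i + 1) mod num_ends D j) \<longleftrightarrow> \<not> tail D (j, i))"

text \<open>
  The boundary pattern at disc \<open>j\<close>. A strand of an inserted smoothing begins where an arc of the
  diagram arrives; a strand of the resulting smoothing begins where an arc leaves the external
  boundary.
\<close>

definition pattern :: "diagram \<Rightarrow> nat \<Rightarrow> bool" where
  "pattern D j \<longleftrightarrow> (if j = 0 then tail D (0, 0) else \<not> tail D (j, 0))"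

definition curls :: "diagram \<Rightarrow> arc_end set set" where
  "curls D = {a\<in>arcs D. \<exists>j\<in>{1..num_inputs D}. fst ` a = {j}}"

definition unary_basic :: "diagram \<Rightarrow> bool" where
  "unary_basic D \<longleftrightarrow> type_A D \<and> num_inputs D = 1 \<and> card (curls D) = 1"


section \<open>The action of a diagram\<close>

text \<open>Two arc ends are related iff they lie on the same component of the curve obtained by
  inserting the smoothing \<open>s j\<close> into every input disc \<open>j\<close>.\<close>

definition same_component :: "diagram \<Rightarrow> (nat \<Rightarrow> nat \<Rightarrow> nat) \<Rightarrow> arc_end rel" where
  "same_component D s =
     ({(x, partner D x) | x. x \<in> arc_ends D} \<union>
      {((j, i), (j, s j i)) | j i. j \<in> {1..num_inputs D} \<and> i < num_ends D j})\<^sup>*"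

definition insertion :: "diagram \<Rightarrow> (nat \<Rightarrow> nat \<Rightarrow> nat) \<Rightarrow> nat \<Rightarrow> nat" where
  "insertion D s i =
     (if i < num_ends D 0
      then (THE i'. i' < num_ends D 0 \<and> i' \<noteq> i \<and> ((0, i), (0, i')) \<in> same_component D s)
      else i)"

definition num_loops :: "diagram \<Rightarrow> (nat \<Rightarrow> nat \<Rightarrow> nat) \<Rightarrow> nat" where
  "num_loops D s = card {C \<in> arc_ends D // same_component D s. \<forall>x\<in>C. fst x \<noteq> 0}"

definition action :: "diagram \<Rightarrow> (nat \<Rightarrow> element) \<Rightarrow> element" where
  "action D P =
     (\<Sum>s \<in> (\<Pi>\<^sub>E j\<in>{1..num_inputs D}. smoothings (num_ends D j div 2) (pattern D j)).
        Poly_Mapping.single (insertion D s)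
          ((\<Prod>j\<in>{1..num_inputs D}. Poly_Mapping.lookup (P j) (s j)) * (q + q_inverse) ^ num_loops D s))"


section \<open>Alternating and coherently alternating elements\<close>

definition neg_one_pow :: "int \<Rightarrow> int" where
  "neg_one_pow r = (if even r then 1 else -1)"

definition alternating_form :: "int \<Rightarrow> int \<Rightarrow> laurent \<Rightarrow> bool" where
  "alternating_form r t p \<longleftrightarrow>
     (\<exists>n a. (\<forall>i\<le>n. 0 \<le> a i) \<and>
        p = (\<Sum>i\<le>n. Poly_Mapping.single (t + 2 * int i) (neg_one_pow (r + int i) * a i)))"

definition alternating_poly :: "laurent \<Rightarrow> bool" where
  "alternating_poly p \<longleftrightarrow> (\<exists>r t. alternating_form r t p)"

definition same_parity :: "laurent \<Rightarrow> laurent \<Rightarrow> bool" where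
  "same_parity p p' \<longleftrightarrow> (\<exists>r t. alternating_form r t p \<and> alternating_form r t p')"

text \<open>For \<open>(-1)\<^sup>R\<^sup>+\<^sup>c\<close> and \<open>q\<^sup>R\<^sup>+\<^sup>c\<close> to make sense the exponents must be integers; this is
  part of the condition on the half-integers \<open>c1\<close> and \<open>c2\<close>.\<close>

definition alternating :: "nat \<Rightarrow> bool \<Rightarrow> element \<Rightarrow> bool" where
  "alternating k b P \<longleftrightarrow>
     (\<forall>\<sigma>\<in>smoothings k b. alternating_poly (Poly_Mapping.lookup P \<sigma>)) \<and>
     (\<exists>c1 c2 :: rat. 2 * c1 \<in> \<int> \<and> 2 * c2 \<in> \<int> \<and>
        (\<forall>\<sigma>\<in>smoothings k b. \<exists>r t :: int.
           of_int r = rotation_number k b \<sigma> + c1 \<and>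
           of_int t = rotation_number k b \<sigma> + c2 \<and>
           same_parity (Poly_Mapping.lookup P \<sigma>) (Poly_Mapping.single t (neg_one_pow r))))"

text \<open>\<open>iterated_closure k b P l k' b' Q\<close>: the element \<open>Q\<close> with boundary pattern \<open>(k', b')\<close> is
  obtained from \<open>P\<close>, with boundary pattern \<open>(k, b)\<close>, by \<open>l\<close> unary basic operators.\<close>

inductive iterated_closure ::
    "nat \<Rightarrow> bool \<Rightarrow> element \<Rightarrow> nat \<Rightarrow> nat \<Rightarrow> bool \<Rightarrow> element \<Rightarrow> bool" for k b P where
  start: "iterated_closure k b P 0 k b P"
| step: "\<lbrakk>iterated_closure k b P l k' b' Q; unary_basic D;
          num_ends D 1 = 2 * k'; pattern D 1 = b'; num_ends D 0 = 2 * k''\<rbrakk>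
         \<Longrightarrow> iterated_closure k b P (Suc l) k'' (pattern D 0) (action D (\<lambda>_. Q))"

definition partial_closure ::
    "nat \<Rightarrow> bool \<Rightarrow> element \<Rightarrow> nat \<Rightarrow> bool \<Rightarrow> element \<Rightarrow> bool" where
  "partial_closure k b P k' b' Q \<longleftrightarrow> (\<exists>l<k. iterated_closure k b P l k' b' Q)"

definition coherently_alternating :: "nat \<Rightarrow> bool \<Rightarrow> element set" where
  "coherently_alternating k b =
     {P \<in> smoothing_module k b. k \<ge> 1 \<and> alternating k b P \<and>
        (\<forall>k' b' Q. partial_closure k b P k' b' Q \<longrightarrow> alternating k' b' Q)}"

end

theory Submission
  imports Defs
begin

text \<open>
  Read the ends on the boundary of a disc as a cyclic list. A loop-free smoothing is then built by
  inserting pairs of neighbouring ends, and up to an additive constant its rotation number is the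
  number of in-points listed after the other end of their strand, so that it changes by a known amount
  when two neighbouring ends are closed up. Coherence therefore says that the coefficients stay in
  prescribed cones of Laurent polynomials under all such closures; that the constants in the
  definition of alternating elements are consistent along closures follows because
  \<open>q + q\<^sup>-\<^sup>1\<close> has opposite signs at its two ends.

  The heart is the join of two discs along a band of parallel arcs. As long as the host keeps an end
  outside the band, expand the guest in smoothings: every strand of the guest closes up the host at
  neighbouring ends, prolongs an end of the host, or is a new strand of the result, and no
  loop arises outside the host, so all signs agree. Hence joins of coherent elements are coherent.

  A type-A diagram reduces to joins and closures: contracting an arc between two input discs
  preserves Euler's formula, and when one input disc is left, Euler's formula yields a monogon,
  that is a curl at neighbouring ends, until no curl remains and the diagram is a rotation.
  Conversely every closure of neighbouring ends is realised by an explicit unary basic diagram.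
\<close>

text \<open>Coherence cannot be derived from alternation: closing neighbouring ends adds the
  coefficients of smoothings that lose a loop, multiplied by \<open>q + q_inverse\<close>, to those
  of smoothings that do not, and \<open>q + q_inverse\<close> itself lies in no sign cone. So
  closures have to be assumed alternating, and the definition allows each of them its own constants
  \<open>c1\<close>, \<open>c2\<close>. The offset \<kappa> carried by \<open>alt\<close> and
  \<open>scoh\<close> makes them comparable: the offset of a closure is computed from the offset
  before it. Partial closures stop while a disc still has ends, so \<open>scoh\<close> says nothing
  about closing the last two. This is why a host must keep an end outside the band, and why the two
  discs exchange roles when one of them is swallowed. Gluing a host to a guest only yields signs.
  Coherence comes from the fact that closures of joins are joins again, of closed discs or along a
  wider band; therefore bands of arbitrary width occur although the reduction contracts one arc at a
  time. Ends are elements of an arbitrary type and only their order in a list matters, which avoids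
  renumbering after each closure.\<close>

abbreviation lookup where "lookup \<equiv> Poly_Mapping.lookup"
abbreviation single where "single \<equiv> Poly_Mapping.single"
abbreviation keys where "keys \<equiv> Poly_Mapping.keys"

section \<open>Sign cones of Laurent polynomials\<close>

lemma neg_one_pow_add: "neg_one_pow (a + b) = neg_one_pow a * neg_one_pow b"
  by (auto simp: neg_one_pow_def)

lemma neg_one_pow_cases: "neg_one_pow a = 1 \<or> neg_one_pow a = -1"
  by (auto simp: neg_one_pow_def)

lemma neg_one_pow_Suc: "neg_one_pow (a + 1) = - neg_one_pow a"
  by (auto simp: neg_one_pow_def)

text \<open>Writing I for the imaginary unit, this says that I^m p(I q) has nonnegative real
  coefficients: the factor at exponent \<open>e\<close> is I^(m+e), which is real only for even
  \<open>m + e\<close>. Hence cones are closed under sums, indices add under products, and an index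
  matters only modulo 4. The single index 2r - t replaces the pair (r, t) of an alternating
  form.\<close>

definition cone :: "int \<Rightarrow> laurent \<Rightarrow> bool" where
  "cone m p \<longleftrightarrow> (\<forall>e. lookup p e \<noteq> 0 \<longrightarrow>
     even (m + e) \<and> 0 < neg_one_pow ((m + e) div 2) * lookup p e)"

lemma coneD: "cone m p \<Longrightarrow> lookup p e \<noteq> 0 \<Longrightarrow> even (m + e)"
  "cone m p \<Longrightarrow> lookup p e \<noteq> 0 \<Longrightarrow> 0 < neg_one_pow ((m + e) div 2) * lookup p e"
  by (auto simp: cone_def)

lemma cone_zero [simp]: "cone m 0"
  by (simp add: cone_def)

lemma coneI:
  assumes "\<And>e. lookup p e \<noteq> 0 \<Longrightarrow> even (m + e)"
    and "\<And>e. even (m + e) \<Longrightarrow> 0 \<le> neg_one_pow ((m + e) div 2) * lookup p e"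
  shows "cone m p"
  unfolding cone_def
proof (intro allI impI)
  fix e assume e: "lookup p e \<noteq> 0"
  have "even (m + e)" "0 \<le> neg_one_pow ((m + e) div 2) * lookup p e"
    using assms e by auto
  moreover have "neg_one_pow ((m + e) div 2) * lookup p e \<noteq> 0"
    using e neg_one_pow_cases[of "(m + e) div 2"] by auto
  ultimately show "even (m + e) \<and> 0 < neg_one_pow ((m + e) div 2) * lookup p e" by linarith
qed

lemma cone_nonneg: "cone m p \<Longrightarrow> 0 \<le> neg_one_pow ((m + e) div 2) * lookup p e"
  by (cases "lookup p e = 0") (auto dest: coneD)

lemma cone_add: "cone m p \<Longrightarrow> cone m p' \<Longrightarrow> cone m (p + p')"
proof (rule coneI)
  fix e assume c: "cone m p" "cone m p'"
  { assume "lookup (p + p') e \<noteq> 0"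
    then have "lookup p e \<noteq> 0 \<or> lookup p' e \<noteq> 0" by (auto simp: lookup_add)
    then show "even (m + e)" using c coneD by blast }
  show "0 \<le> neg_one_pow ((m + e) div 2) * lookup (p + p') e"
    using cone_nonneg[OF c(1), of e] cone_nonneg[OF c(2), of e]
    by (simp add: lookup_add algebra_simps)
qed

lemma cone_sum: "(\<And>i. i \<in> I \<Longrightarrow> cone m (f i)) \<Longrightarrow> cone m (sum f I)"
  by (induction I rule: infinite_finite_induct) (auto intro: cone_add)

lemma cone_single: "c = 0 \<or> (even (m + e) \<and> 0 < neg_one_pow ((m + e) div 2) * c) \<Longrightarrow> cone m (single e c)"
  by (auto simp: cone_def lookup_single when_def)

lemma laurent_sum_monomials: "P = (\<Sum>a\<in>keys P. single a (lookup P a))"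
proof (rule poly_mapping_eqI)
  fix k
  have "lookup (\<Sum>a\<in>keys P. single a (lookup P a)) k = (\<Sum>a\<in>keys P. if a = k then lookup P a else 0)"
    by (simp add: lookup_sum lookup_single when_def)
  also have "\<dots> = lookup P k"
    by (simp add: sum.delta in_keys_iff)
  finally show "lookup P k = lookup (\<Sum>a\<in>keys P. single a (lookup P a)) k" ..
qed

lemma cone_mult:
  assumes "cone m p" "cone m' p'"
  shows "cone (m + m') (p * p')"
proof -
  have "p * p' = (\<Sum>a\<in>keys p. \<Sum>b\<in>keys p'. single (a + b) (lookup p a * lookup p' b))"
    by (subst (1) laurent_sum_monomials[of p], subst (1) laurent_sum_monomials[of p'])
      (simp add: sum_product mult_single)
  also have "cone (m + m') \<dots>"
  proof (intro cone_sum cone_single disjI2)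
    fix a b assume ab: "a \<in> keys p" "b \<in> keys p'"
    have a: "even (m + a)" "0 < neg_one_pow ((m + a) div 2) * lookup p a"
      and b: "even (m' + b)" "0 < neg_one_pow ((m' + b) div 2) * lookup p' b"
      using ab assms by (auto simp: in_keys_iff cone_def)
    have "(m + m' + (a + b)) div 2 = (m + a) div 2 + (m' + b) div 2"
      using a(1) b(1) by presburger
    then have "neg_one_pow ((m + m' + (a + b)) div 2) * (lookup p a * lookup p' b)
       = (neg_one_pow ((m + a) div 2) * lookup p a) * (neg_one_pow ((m' + b) div 2) * lookup p' b)"
      by (simp add: neg_one_pow_add mult_ac)
    moreover have "\<dots> > 0" by (rule mult_pos_pos[OF a(2) b(2)])
    moreover have "even (m + m' + (a + b))" using a b by simp
    ultimately show "even (m + m' + (a + b)) \<and>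
        0 < neg_one_pow ((m + m' + (a + b)) div 2) * (lookup p a * lookup p' b)"
      by (simp only:)
  qed
  finally show ?thesis .
qed

abbreviation loop_value :: laurent where "loop_value \<equiv> q + q_inverse"

lemma lookup_mult_single: "lookup (single a c * (p :: laurent)) e = c * lookup p (e - a)"
proof -
  have "single a c * p = (\<Sum>b\<in>keys p. single (a + b) (c * lookup p b))"
    by (subst (1) laurent_sum_monomials[of p]) (simp add: sum_distrib_left mult_single)
  then have "lookup (single a c * p) e = (\<Sum>b\<in>keys p. if a + b = e then c * lookup p b else 0)"
    by (simp add: lookup_sum lookup_single when_def)
  also have "\<dots> = (\<Sum>b\<in>keys p. if b = e - a then c * lookup p b else 0)"
    by (intro sum.cong) auto
  also have "\<dots> = c * lookup p (e - a)"
    by (subst sum.delta) (auto simp: in_keys_iff)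
  finally show ?thesis .
qed

lemma lookup_loop_value_mult: "lookup (loop_value * p) e = lookup p (e - 1) + lookup p (e + 1)"
  by (simp add: distrib_right lookup_add q_def q_inverse_def lookup_mult_single)

text \<open>The two hypotheses together say that 4 divides \<open>m - m'\<close>, and the signs of a
  cone have period 4 in its index.\<close>

lemma cone_even_cong:
  assumes "even (m - m')" "even ((m - m') div 2)"
  shows "cone m p \<longleftrightarrow> cone m' p"
proof -
  obtain c where c: "m = m' + 4 * c"
  proof -
    from assms(1) obtain a where a: "m - m' = 2 * a" by (rule evenE)
    with assms(2) have "even a" by simp
    then obtain c where "a = 2 * c" by (rule evenE)
    with a show ?thesis by (intro that[of c]) simp
  qed
  show ?thesis
  proof -
    have "(m + e) div 2 = (m' + e) div 2 + 2 * c" for e unfolding c by presburger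
    then have "neg_one_pow ((m + e) div 2) = neg_one_pow ((m' + e) div 2)" for e
      by (simp add: neg_one_pow_def)
    moreover have "even (m + e) = even (m' + e)" for e by (simp add: c)
    ultimately show ?thesis by (simp add: cone_def)
  qed
qed

lemma cone_uminus: "cone m (- p) \<longleftrightarrow> cone (m + 2) p"
proof -
  have "(m + 2 + e) div 2 = (m + e) div 2 + 1" for e by presburger
  then have "neg_one_pow ((m + 2 + e) div 2) = - neg_one_pow ((m + e) div 2)" for e
    by (simp add: neg_one_pow_Suc)
  then show ?thesis by (auto simp: cone_def)
qed

text \<open>At its top and at its bottom degree \<open>loop_value * a\<close> has opposite signs.\<close>

lemma cone_loop_value_cancel:
  assumes "cone m y" "cone (m + s) a" "s = 1 \<or> s = -1" "y + loop_value * a = 0"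
  shows "y = 0"
proof (rule ccontr)
  assume "y \<noteq> 0"
  then have a0: "a \<noteq> 0" using assms(4) by auto
  then have ne: "keys a \<noteq> {}" by (metis keys_eq_empty)
  have fin: "finite (keys a)" by simp
  \<comment> \<open>Index \<open>m + s\<close> at exponent \<open>e\<close> prescribes the same sign
    as index \<open>m\<close> at exponent \<open>e + s\<close>. The extreme exponent on the side of
    \<open>s\<close> is taken so that only one term of \<open>loop_value * a\<close> reaches
    \<open>e + s\<close>; cancellation would then make two equal signs opposite.\<close>
  define e where "e = (if s = 1 then Max (keys a) else Min (keys a))"
  have ek: "e \<in> keys a" using ne by (auto simp: e_def)
  have beyond: "lookup a (e + 2 * s) = 0"
  proof (rule ccontr)
    assume "lookup a (e + 2 * s) \<noteq> 0"
    then have "e + 2 * s \<in> keys a" by (simp add: in_keys_iff)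
    with assms(3) show False
      using Max_ge[OF fin, of "e + 2 * s"] Min_le[OF fin, of "e + 2 * s"]
      by (auto simp: e_def simp del: Max_ge Min_le)
  qed
  have "lookup (y + loop_value * a) (e + s) = 0" by (simp add: assms(4))
  then have y: "lookup y (e + s) = - lookup a e"
    using beyond assms(3) unfolding lookup_add lookup_loop_value_mult by (auto simp: algebra_simps)
  have "0 < neg_one_pow ((m + s + e) div 2) * lookup a e"
    using coneD(2)[OF assms(2)] ek by (simp add: in_keys_iff)
  moreover have "0 < neg_one_pow ((m + (e + s)) div 2) * lookup y (e + s)"
    by (rule coneD(2)[OF assms(1)]) (use ek y in \<open>simp add: in_keys_iff\<close>)
  ultimately show False using y by (simp add: algebra_simps)
qed

text \<open>Two members of one cone have the same sign at every exponent, so nothing can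
  cancel.\<close>

lemma cone_pointed: "cone m p \<Longrightarrow> cone m p' \<Longrightarrow> p + p' = 0 \<Longrightarrow> p = 0"
proof (rule poly_mapping_eqI)
  fix e assume "cone m p" "cone m p'" "p + p' = 0"
  have "lookup (p + p') e = 0" using \<open>p + p' = 0\<close> by simp
  then have "lookup p' e = - lookup p e" by (simp add: lookup_add)
  then show "lookup p e = lookup 0 e"
    using coneD(2)[OF \<open>cone m p\<close>, of e] coneD(2)[OF \<open>cone m p'\<close>, of e]
    by (cases "lookup p e = 0") auto
qed

text \<open>If the sum obeys some sign rule at all, it obeys that of \<open>n\<close>. An index of
  the other parity only fits 0. With the opposite signs the negated sum would lie in
  \<open>cone m\<close>, so that together with \<open>n\<close> it would cancel against
  \<open>loop_value * a\<close>; by the preceding two facts the sum is then 0.\<close>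

lemma cone_loop_value_consistent:
  assumes n: "cone m n" and a: "cone (m + s) a" and s: "s = 1 \<or> s = -1"
    and Q: "cone m' (n + loop_value * a)"
  shows "cone m (n + loop_value * a)"
proof (cases "n + loop_value * a = 0")
  case False
  let ?Q = "n + loop_value * a"
  obtain e where e: "lookup ?Q e \<noteq> 0" using False by (metis poly_mapping_eqI lookup_zero)
  then have "lookup n e \<noteq> 0 \<or> lookup a (e - 1) \<noteq> 0 \<or> lookup a (e + 1) \<noteq> 0"
    unfolding lookup_add lookup_loop_value_mult by auto
  then have "even (m + e)"
    using coneD(1)[OF n, of e] coneD(1)[OF a, of "e - 1"] coneD(1)[OF a, of "e + 1"] s by auto
  moreover have "even (m' + e)" using coneD(1)[OF Q e] .
  ultimately have even: "even (m - m')" by presburger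
  show ?thesis
  proof (cases "even ((m - m') div 2)")
    case True
    then show ?thesis using Q cone_even_cong even by blast
  next
    case odd: False
    \<comment> \<open>Here \<open>m - m'\<close> is 2 modulo 4, which means opposite signs.\<close>
    have "cone (m + 2) ?Q" using Q by (subst cone_even_cong[of _ m']) (use even odd in presburger)+
    then have mQ: "cone m (- ?Q)" by (simp only: cone_uminus)
    have "n + - ?Q = 0" 
      by (rule cone_loop_value_cancel[OF cone_add[OF n mQ] a s]) simp
    then have "- ?Q = 0" using cone_pointed[OF mQ n] by (simp add: add.commute)
    then have "?Q = 0" by (simp only: neg_equal_0_iff_equal)
    then show ?thesis using False by contradiction
  qed
qed simp

section \<open>Linear maps between modules of smoothings\<close>

text \<open>Closing, relabelling, adding a strand and scaling all send a basis smoothing to a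
  multiple of one basis smoothing. This common form turns identities between composites into
  pointwise ones, by \<open>push_push\<close> and \<open>push_cong\<close>.\<close>

definition push :: "('a \<Rightarrow> 'b) \<Rightarrow> ('a \<Rightarrow> laurent) \<Rightarrow> ('a \<Rightarrow>\<^sub>0 laurent) \<Rightarrow> ('b \<Rightarrow>\<^sub>0 laurent)" where
  "push h w P = (\<Sum>a\<in>keys P. single (h a) (lookup P a * w a))"

lemma push_superset:
  "finite S \<Longrightarrow> keys P \<subseteq> S \<Longrightarrow> push h w P = (\<Sum>a\<in>S. single (h a) (lookup P a * w a))"
  unfolding push_def by (rule sum.mono_neutral_left) (auto simp: in_keys_iff)

lemma push_zero [simp]: "push h w 0 = 0"
  by (simp add: push_def)

lemma push_add: "push h w (P + Q) = push h w P + push h w Q"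
proof -
  let ?S = "keys P \<union> keys Q"
  have "push h w (P + Q) = (\<Sum>a\<in>?S. single (h a) (lookup (P + Q) a * w a))"
    using keys_add[of P Q] by (intro push_superset) auto
  then show ?thesis
    by (simp add: push_superset[of ?S P] push_superset[of ?S Q] lookup_add distrib_right
        single_add sum.distrib)
qed

lemma push_sum: "push h w (sum f I) = (\<Sum>i\<in>I. push h w (f i))"
  by (induction I rule: infinite_finite_induct) (auto simp: push_add)

lemma push_single [simp]: "push h w (single a c) = single (h a) (c * w a)"
  by (simp add: push_def)

lemma push_cong:
  "(\<And>a. a \<in> keys P \<Longrightarrow> h a = h' a) \<Longrightarrow> (\<And>a. a \<in> keys P \<Longrightarrow> w a = w' a) \<Longrightarrow>
   push h w P = push h' w' P"
  by (simp add: push_def)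

lemma push_push: "push h' w' (push h w P) = push (h' \<circ> h) (\<lambda>a. w a * w' (h a)) P"
  unfolding push_def[of h w P] push_sum push_single by (simp add: push_def mult.assoc)

lemma push_id [simp]: "push id (\<lambda>_. 1) P = P"
  using laurent_sum_monomials[of P] by (simp add: push_def)

lemma push_ident: "(\<And>a. a \<in> keys P \<Longrightarrow> h a = a) \<Longrightarrow> push h (\<lambda>_. 1) P = P"
  using push_cong[of P h id "\<lambda>_. 1" "\<lambda>_. 1"] by simp

lemma lookup_push: "lookup (push h w P) b = (\<Sum>a | a \<in> keys P \<and> h a = b. lookup P a * w a)"
proof -
  have "lookup (push h w P) b = (\<Sum>a\<in>keys P. if h a = b then lookup P a * w a else 0)"
    by (simp add: push_def lookup_sum lookup_single when_def)
  also have "\<dots> = (\<Sum>a | a \<in> keys P \<and> h a = b. lookup P a * w a)"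
    by (simp add: sum.inter_filter)
  finally show ?thesis .
qed

lemma keys_push: "keys (push h w P) \<subseteq> h ` keys P"
proof
  fix b assume "b \<in> keys (push h w P)"
  then have "{a. a \<in> keys P \<and> h a = b} \<noteq> {}"
    unfolding in_keys_iff lookup_push by (metis (no_types, lifting) sum.empty)
  then show "b \<in> h ` keys P" by auto
qed

text \<open>Additivity is enough, without compatibility with scalars, because the two maps are
  compared on the monomials of \<open>P\<close> with the coefficients they have there.\<close>

lemma push_eqI:
  fixes P :: "'a \<Rightarrow>\<^sub>0 laurent" and F G :: "('a \<Rightarrow>\<^sub>0 laurent) \<Rightarrow> ('b \<Rightarrow>\<^sub>0 laurent)"
  assumes "\<And>a. a \<in> keys P \<Longrightarrow> F (single a (lookup P a)) = G (single a (lookup P a))"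
    and "\<And>f (I :: 'a set). F (sum f I) = (\<Sum>i\<in>I. F (f i))"
    and "\<And>f (I :: 'a set). G (sum f I) = (\<Sum>i\<in>I. G (f i))"
  shows "F P = G P"
proof -
  have "F P = F (\<Sum>a\<in>keys P. single a (lookup P a))"
    using laurent_sum_monomials[of P] by simp
  also have "\<dots> = G (\<Sum>a\<in>keys P. single a (lookup P a))" unfolding assms(2,3) by (rule sum.cong) (simp_all add: assms(1))
  also have "\<dots> = G P"
    using laurent_sum_monomials[of P] by simp
  finally show ?thesis .
qed

abbreviation scale :: "laurent \<Rightarrow> ('a \<Rightarrow>\<^sub>0 laurent) \<Rightarrow> ('a \<Rightarrow>\<^sub>0 laurent)" where
  "scale c \<equiv> push id (\<lambda>_. c)"

lemma lookup_scale [simp]: "lookup (scale c P) a = lookup P a * c"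
proof -
  have "{a'. a' \<in> keys P \<and> id a' = a} = (if a \<in> keys P then {a} else {})" by auto
  then show ?thesis by (simp add: lookup_push in_keys_iff)
qed

section \<open>Non-crossing matchings of a cyclic list\<close>

text \<open>Matchings are extended by the identity, as permutations are: a closed end is simply a
  fixed point, and the union of matchings of disjoint sets is their composition.\<close>

definition mts :: "'e set \<Rightarrow> ('e \<Rightarrow> 'e) set" where
  "mts X = {\<sigma>. (\<forall>z\<in>X. \<sigma> z \<in> X \<and> \<sigma> z \<noteq> z \<and> \<sigma> (\<sigma> z) = z) \<and> (\<forall>z. z \<notin> X \<longrightarrow> \<sigma> z = z)}"

lemma mtsD:
  assumes "\<sigma> \<in> mts X"
  shows "z \<in> X \<Longrightarrow> \<sigma> z \<in> X" "z \<in> X \<Longrightarrow> \<sigma> z \<noteq> z" "\<sigma> (\<sigma> z) = z" "z \<notin> X \<Longrightarrow> \<sigma> z = z"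
    "\<sigma> z \<in> X \<longleftrightarrow> z \<in> X" "\<sigma> a = \<sigma> b \<longleftrightarrow> a = b" "\<sigma> a = b \<longleftrightarrow> \<sigma> b = a"
proof -
  show 0: "z \<in> X \<Longrightarrow> \<sigma> z \<in> X" "z \<in> X \<Longrightarrow> \<sigma> z \<noteq> z" "z \<notin> X \<Longrightarrow> \<sigma> z = z" for z
    using assms by (auto simp: mts_def)
  show inv: "\<sigma> (\<sigma> z) = z" for z
    using assms by (cases "z \<in> X") (auto simp: mts_def)
  show "\<sigma> z \<in> X \<longleftrightarrow> z \<in> X"
    using 0(1)[of z] 0(3)[of z] by (cases "z \<in> X") auto
  show "\<sigma> a = \<sigma> b \<longleftrightarrow> a = b" "\<sigma> a = b \<longleftrightarrow> \<sigma> b = a" using inv by metis+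
qed

text \<open>If \<open>x\<close> and \<open>y\<close> are the two ends of one strand, the resulting
  loop leaves no trace here; its factor is supplied by \<open>cl\<close>.\<close>

definition close_matching :: "'e \<Rightarrow> 'e \<Rightarrow> ('e \<Rightarrow> 'e) \<Rightarrow> 'e \<Rightarrow> 'e" where
  "close_matching x y \<sigma> = (\<lambda>z. if z = x \<or> z = y then z
     else if \<sigma> z = x then \<sigma> y else if \<sigma> z = y then \<sigma> x else \<sigma> z)"

lemma close_matching_mts:
  assumes "\<sigma> \<in> mts X" "x \<in> X" "y \<in> X" "x \<noteq> y"
  shows "close_matching x y \<sigma> \<in> mts (X - {x, y})"
proof -
  note [simp] = mtsD(3,5,6)[OF assms(1)] and m = mtsD[OF assms(1)]
  show ?thesis
    using assms(2-4) m(2) m(4) m(7)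
    unfolding mts_def[of "X - {x, y}"] mem_Collect_eq close_matching_def
    by (intro conjI ballI allI impI) (auto split: if_splits)
qed

definition sign_of :: "('e \<Rightarrow> bool) \<Rightarrow> 'e \<Rightarrow> int" where
  "sign_of inp x = (if inp x then 1 else -1)"

text \<open>The weight is an index of the predicate so that every operation on lists can state how
  it changes. That it depends only on the matching and the list, and not on the order of insertions,
  is \<open>ncw_unique\<close>.\<close>

inductive ncw :: "('e \<Rightarrow> bool) \<Rightarrow> 'e list \<Rightarrow> int \<Rightarrow> ('e \<Rightarrow> 'e) \<Rightarrow> bool" for inp where
  Nil: "ncw inp [] 0 id"
| Ins: "ncw inp (us @ vs) n \<sigma> \<Longrightarrow> x \<notin> set (us @ vs) \<Longrightarrow> y \<notin> set (us @ vs) \<Longrightarrow> x \<noteq> y \<Longrightarrow>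
    inp x \<noteq> inp y \<Longrightarrow> ncw inp (us @ x # y # vs) (n + of_bool (inp y)) (\<sigma>(x := y, y := x))"

lemma ncw_mts: "ncw inp xs n \<sigma> \<Longrightarrow> \<sigma> \<in> mts (set xs)"
  by (induction rule: ncw.induct) (auto simp: mts_def)

lemma ncw_distinct: "ncw inp xs n \<sigma> \<Longrightarrow> distinct xs"
  by (induction rule: ncw.induct) auto

lemma ncw_opposite: "ncw inp xs n \<sigma> \<Longrightarrow> z \<in> set xs \<Longrightarrow> inp (\<sigma> z) \<noteq> inp z"
  by (induction rule: ncw.induct) auto

text \<open>A description of the weight that does not refer to a derivation. \<open>S\<close> holds
  the ends read so far; it is an argument so that the count can be split at any place of the
  list.\<close>

fun in_closers :: "('e \<Rightarrow> bool) \<Rightarrow> ('e \<Rightarrow> 'e) \<Rightarrow> 'e set \<Rightarrow> 'e list \<Rightarrow> int" where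
  "in_closers inp \<sigma> S [] = 0"
| "in_closers inp \<sigma> S (x # xs) = of_bool (inp x \<and> \<sigma> x \<in> S) + in_closers inp \<sigma> (insert x S) xs"

lemma in_closers_append:
  "in_closers inp \<sigma> S (us @ vs) = in_closers inp \<sigma> S us + in_closers inp \<sigma> (S \<union> set us) vs"
  by (induction us arbitrary: S) auto

lemma in_closers_cong:
  "(\<And>z. z \<in> set us \<Longrightarrow> \<sigma> z \<in> S \<union> set us \<longleftrightarrow> \<tau> z \<in> T \<union> set us) \<Longrightarrow>
   (\<And>z. z \<in> set us \<Longrightarrow> \<sigma> z = \<tau> z) \<Longrightarrow> S \<inter> \<tau> ` set us = T \<inter> \<tau> ` set us \<Longrightarrow>
   in_closers inp \<sigma> S us = in_closers inp \<tau> T us"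
proof (induction us arbitrary: S T)
  case (Cons u us)
  have "in_closers inp \<sigma> (insert u S) us = in_closers inp \<tau> (insert u T) us"
  proof (rule Cons.IH)
    show "insert u S \<inter> \<tau> ` set us = insert u T \<inter> \<tau> ` set us"
      using Cons.prems(3) by auto
  qed (use Cons.prems in auto)
  moreover have "\<sigma> u \<in> S \<longleftrightarrow> \<tau> u \<in> T"
    using Cons.prems(2)[of u] Cons.prems(3) by (auto simp: set_eq_iff)
  ultimately show ?case by simp
qed simp

lemma ncw_weight: "ncw inp xs n \<sigma> \<Longrightarrow> n = in_closers inp \<sigma> {} xs"
proof (induction rule: ncw.induct)
  case (Ins us vs n \<sigma> x y)
  define \<sigma>' where "\<sigma>' = \<sigma>(x := y, y := x)"
  have s: "\<sigma> z \<noteq> x" "\<sigma> z \<noteq> y" "z \<noteq> x" "z \<noteq> y" if "z \<in> set us \<union> set vs" for z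
    using mtsD(5)[OF ncw_mts[OF Ins.hyps(1)], of z] that Ins.hyps(2,3) by auto
  have "in_closers inp \<sigma>' {} us = in_closers inp \<sigma> {} us"
    by (rule in_closers_cong) (use s in \<open>auto simp: \<sigma>'_def\<close>)
  moreover have "in_closers inp \<sigma>' (insert y (insert x (set us))) vs = in_closers inp \<sigma> (set us) vs"
    by (rule in_closers_cong) (use s in \<open>auto simp: image_iff \<sigma>'_def\<close>)
  moreover have "\<sigma>' x = y" "\<sigma>' y = x" using Ins.hyps by (auto simp: \<sigma>'_def)
  ultimately show ?case
    using Ins.IH Ins.hyps unfolding \<sigma>'_def[symmetric] by (simp add: in_closers_append)
qed simp

lemma ncw_unique: "ncw inp xs n \<sigma> \<Longrightarrow> ncw inp xs m \<sigma> \<Longrightarrow> n = m"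
  using ncw_weight by metis

lemma ncw_relabel:
  assumes "ncw inp xs n \<sigma>" "inj_on f (set xs)" "\<And>x. x \<in> set xs \<Longrightarrow> inp' (f x) = inp x"
    "\<And>x. x \<in> set xs \<Longrightarrow> \<sigma>' (f x) = f (\<sigma> x)" "\<And>z. z \<notin> f ` set xs \<Longrightarrow> \<sigma>' z = z"
  shows "ncw inp' (map f xs) n \<sigma>'"
  using assms
proof (induction arbitrary: \<sigma>' rule: ncw.induct)
  case Nil
  then have "\<sigma>' = id" by auto
  then show ?case by (simp only: list.map ncw.Nil)
next
  case (Ins us vs n \<sigma> x y)
  note m = mtsD[OF ncw_mts[OF Ins.hyps(1)]]
  define \<tau> where "\<tau> = \<sigma>'(f x := f x, f y := f y)"
  have f: "f z = f w \<longleftrightarrow> z = w" if "z \<in> insert x (insert y (set (us @ vs)))"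
      "w \<in> insert x (insert y (set (us @ vs)))" for z w
    using Ins.prems(1) that by (auto simp: inj_on_def)
  have "ncw inp' (map f (us @ vs)) n \<tau>"
  proof (rule Ins.IH)
    show "inj_on f (set (us @ vs))"
      using Ins.prems(1) by (rule inj_on_subset) auto
    show "\<tau> (f z) = f (\<sigma> z)" if "z \<in> set (us @ vs)" for z
    proof -
      have "z \<noteq> x" "z \<noteq> y" using that Ins.hyps by auto
      then show ?thesis using that Ins.prems(3)[of z] f[of z x] f[of z y] by (auto simp: \<tau>_def)
    qed
    show "\<tau> z = z" if "z \<notin> f ` set (us @ vs)" for z
      using that Ins.prems(4)[of z] by (auto simp: \<tau>_def)
  qed (use Ins.prems in auto)
  then have "ncw inp' (map f us @ f x # f y # map f vs) (n + of_bool (inp' (f y)))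
      (\<tau>(f x := f y, f y := f x))"
    using Ins.hyps(2-5) f[of x] f[of y] Ins.prems(2)
    by (intro ncw.Ins) auto
  moreover have "\<tau>(f x := f y, f y := f x) = \<sigma>'"
    using Ins.prems(3)[of x] Ins.prems(3)[of y] Ins.hyps(4) by (auto simp: \<tau>_def)
  ultimately show ?case using Ins.prems(2) by simp
qed

lemma ncw_rename:
  assumes "ncw inp (us @ a # vs) n \<sigma>" "b \<notin> set (us @ vs)" "inp a = inp b"
    "\<And>z. z \<in> set (us @ vs) \<Longrightarrow> \<sigma>' z = (if \<sigma> z = a then b else \<sigma> z)" "\<sigma>' b = \<sigma> a"
    "\<And>z. z \<notin> insert b (set (us @ vs)) \<Longrightarrow> \<sigma>' z = z"
  shows "ncw inp (us @ b # vs) n \<sigma>'"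
proof -
  have d: "a \<notin> set (us @ vs)" using ncw_distinct[OF assms(1)] by auto
  let ?f = "id(a := b)"
  have "ncw inp (map ?f (us @ a # vs)) n \<sigma>'"
    by (rule ncw_relabel[OF assms(1)])
      (use assms(2-) d mtsD(2)[OF ncw_mts[OF assms(1)], of a] in \<open>auto simp: inj_on_def image_iff\<close>)
  moreover have "map ?f (us @ a # vs) = us @ b # vs"
    using d by (auto intro!: map_idI)
  ultimately show ?thesis by simp
qed

lemma adjacent_pairs_cases:
  assumes "us' @ x' # y' # vs' = us @ x # y # vs"
  obtains "us' = us" "x' = x" "y' = y" "vs' = vs"
  | "us' = us @ [x]" "x' = y" "vs = y' # vs'"
  | "us = us' @ [x']" "x = y'" "vs' = y # vs"
  | w where "us' = us @ x # y # w" "vs = w @ x' # y' # vs'"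
  | w where "us = us' @ x' # y' # w" "vs' = w @ x # y # vs"
proof -
  consider w where "us' = us @ w" "w @ x' # y' # vs' = x # y # vs"
    | w where "us = us' @ w" "w @ x # y # vs = x' # y' # vs'"
    using assms unfolding append_eq_append_conv2 by metis
  then show thesis
  proof cases
    case (1 w)
    then consider "w = []" | a where "w = [a]" | a b w' where "w = a # b # w'"
      by (metis neq_Nil_conv)
    then show thesis by cases (use 1 that in auto)
  next
    case (2 w)
    then consider "w = []" | a where "w = [a]" | a b w' where "w = a # b # w'"
      by (metis neq_Nil_conv)
    then show thesis by cases (use 2 that in auto)
  qed
qed

text \<open>The closed pair is compared with the pair inserted last. If they are equal, the
  insertion is undone; if they share one end, the inserted strand is pulled straight and one end
  takes the place of another; if they are disjoint, the two operations commute. When two strands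
  merge, the surviving end of the zigzag has the type of the end that it replaces, which accounts
  for the different correction of the weight.\<close>

lemma ncw_close:
  assumes "ncw inp xs n \<sigma>" "xs = us @ x # y # vs" "inp x \<noteq> inp y"
  shows "ncw inp (us @ vs) (n - of_bool (inp (if \<sigma> x = y then y else x))) (close_matching x y \<sigma>)"
  using assms
proof (induction arbitrary: us vs rule: ncw.induct)
  case (Ins us' vs' n \<sigma> x' y')
  note m = mtsD[OF ncw_mts[OF Ins.hyps(1)]]
  note hyps = Ins.hyps
  from Ins.prems(1) show ?case
  proof (cases rule: adjacent_pairs_cases)
    case 1
    have "\<sigma> x = x" "\<sigma> y = y" using m(4) hyps(2,3) 1 by auto
    then have "\<sigma> z \<noteq> x" "\<sigma> z \<noteq> y" if "z \<noteq> x" "z \<noteq> y" for z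
      using m(6) that by metis+
    then have e: "close_matching x y (\<sigma>(x' := y', y' := x')) = \<sigma>"
      using 1 hyps m(4)[of x] m(4)[of y] by (auto simp: close_matching_def)
    have e': "(\<sigma>(x' := y', y' := x')) x = y" using 1 hyps(4) by simp
    have "n + of_bool (inp y') - of_bool (inp y) = n" unfolding 1(3) by simp
    then show ?thesis unfolding e e' using 1(1,4) hyps(1) by (simp only: if_P refl)
  next
    \<comment> \<open>The strand inserted last runs from \<open>y\<close> to \<open>y'\<close>, a
      zigzag next to \<open>x\<close>. Joining \<open>x\<close> to \<open>y\<close> straightens it,
      so \<open>y'\<close> takes over the role of \<open>x\<close>.\<close>
    case 2
    have "\<sigma> y = y" "\<sigma> y' = y'" using m(4) hyps 2 by auto
    then have s: "\<sigma> z = y \<longleftrightarrow> z = y" "\<sigma> z = y' \<longleftrightarrow> z = y'" for z using m(6) by metis+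
    have s': "\<sigma> z = x \<longleftrightarrow> z = \<sigma> x" for z using m(3,6) by metis
    have s'': "\<sigma> x \<noteq> x" "\<sigma> x \<noteq> y" "\<sigma> x \<noteq> y'" "\<sigma> x \<in> set us \<or> \<sigma> x \<in> set vs'"
      using m(1)[of x] m(2)[of x] hyps(2-5) 2 by auto
    have d: "x \<notin> set us" "x \<notin> set vs'" using ncw_distinct[OF hyps(1)] 2 by auto
    have "ncw inp (us @ y' # vs') n (close_matching x y (\<sigma>(x' := y', y' := x')))"
      by (rule ncw_rename[of _ us x vs' _ \<sigma>])
        (use 2 hyps Ins.prems(2) s s' s'' d m(4) in \<open>auto simp: close_matching_def\<close>)
    moreover have "(\<sigma>(x' := y', y' := x')) x \<noteq> y" using 2 hyps(2-5) s'' by auto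
    ultimately show ?thesis using 2 hyps(5) Ins.prems(2) by (simp del: fun_upd_apply)
  next
    case 3
    have "\<sigma> x = x" "\<sigma> x' = x'" using m(4) hyps 3 by auto
    then have s: "\<sigma> z = x \<longleftrightarrow> z = x" "\<sigma> z = x' \<longleftrightarrow> z = x'" for z using m(6) by metis+
    have s': "\<sigma> z = y \<longleftrightarrow> z = \<sigma> y" for z using m(3,6) by metis
    have s'': "\<sigma> y \<noteq> y" "\<sigma> y \<noteq> x" "\<sigma> y \<noteq> x'" "\<sigma> y \<in> set us' \<or> \<sigma> y \<in> set vs"
      using m(1)[of y] m(2)[of y] hyps(2-5) 3 by auto
    have d: "y \<notin> set us'" "y \<notin> set vs" using ncw_distinct[OF hyps(1)] 3 by auto
    have "ncw inp (us' @ x' # vs) n (close_matching x y (\<sigma>(x' := y', y' := x')))"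
      by (rule ncw_rename[of _ us' y vs _ \<sigma>])
        (use 3 hyps Ins.prems(2) s s' s'' d m(4) in \<open>auto simp: close_matching_def\<close>)
    moreover have "(\<sigma>(x' := y', y' := x')) x \<noteq> y" using 3 hyps(2-5) s'' by auto
    ultimately show ?thesis using 3 hyps(5) Ins.prems(2) by (simp del: fun_upd_apply)
  next
    case (4 w)
    have "ncw inp (us @ (w @ vs')) (n - of_bool (inp (if \<sigma> x = y then y else x))) (close_matching x y \<sigma>)"
      using Ins.IH[of us "w @ vs'"] 4 Ins.prems(2) by simp
    then have "ncw inp ((us @ w) @ x' # y' # vs')
       (n - of_bool (inp (if \<sigma> x = y then y else x)) + of_bool (inp y'))
       ((close_matching x y \<sigma>)(x' := y', y' := x'))"
      using hyps 4 by (intro ncw.Ins) auto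
    moreover have "(close_matching x y \<sigma>)(x' := y', y' := x') = close_matching x y (\<sigma>(x' := y', y' := x'))"
      using hyps 4 by (auto simp: close_matching_def)
    moreover have "(\<sigma>(x' := y', y' := x')) x = \<sigma> x" using hyps 4 by auto
    moreover have "n - of_bool (inp (if \<sigma> x = y then y else x)) + of_bool (inp y')
        = n + of_bool (inp y') - of_bool (inp (if \<sigma> x = y then y else x))" by (simp only: diff_add_eq)
    ultimately show ?thesis using 4(2) by (simp only: append_assoc append.simps)
  next
    case (5 w)
    have "ncw inp ((us' @ w) @ vs) (n - of_bool (inp (if \<sigma> x = y then y else x))) (close_matching x y \<sigma>)"
      using Ins.IH[of "us' @ w" vs] 5 Ins.prems(2) by simp
    then have "ncw inp (us' @ x' # y' # (w @ vs))
       (n - of_bool (inp (if \<sigma> x = y then y else x)) + of_bool (inp y'))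
       ((close_matching x y \<sigma>)(x' := y', y' := x'))"
      using hyps 5 by (intro ncw.Ins) auto
    moreover have "(close_matching x y \<sigma>)(x' := y', y' := x') = close_matching x y (\<sigma>(x' := y', y' := x'))"
      using hyps 5 by (auto simp: close_matching_def)
    moreover have "(\<sigma>(x' := y', y' := x')) x = \<sigma> x" using hyps 5 by auto
    moreover have "n - of_bool (inp (if \<sigma> x = y then y else x)) + of_bool (inp y')
        = n + of_bool (inp y') - of_bool (inp (if \<sigma> x = y then y else x))" by (simp only: diff_add_eq)
    ultimately show ?thesis using 5(1) by (simp only: append_assoc append.simps)
  qed
qed simp

text \<open>A strand around all others cannot be inserted last. It is inserted first, into the empty
  list, and all other insertions are repeated inside it.\<close>

lemma ncw_wrap_pair:
  assumes "ncw inp xs n \<sigma>" "a \<notin> set xs" "b \<notin> set xs" "a \<noteq> b" "inp a \<noteq> inp b"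
  shows "ncw inp (a # xs @ [b]) (n + of_bool (inp b)) (\<sigma>(a := b, b := a))"
  using assms
proof (induction rule: ncw.induct)
  case Nil
  have "ncw inp ([] @ a # b # []) (0 + of_bool (inp b)) (id(a := b, b := a))"
    by (rule ncw.Ins) (use Nil in \<open>auto simp only: append.simps ncw.Nil list.set empty_iff\<close>)
  then show ?case by (simp only: append.simps)
next
  case (Ins us vs n \<sigma> x y)
  have "ncw inp (a # (us @ vs) @ [b]) (n + of_bool (inp b)) (\<sigma>(a := b, b := a))"
    by (rule Ins.IH) (use Ins.prems in auto)
  then have "ncw inp ((a # us) @ (vs @ [b])) (n + of_bool (inp b)) (\<sigma>(a := b, b := a))"
    by (simp only: append.simps append_assoc)
  then have "ncw inp ((a # us) @ x # y # (vs @ [b])) (n + of_bool (inp b) + of_bool (inp y))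
      ((\<sigma>(a := b, b := a))(x := y, y := x))"
    by (rule ncw.Ins) (use Ins in auto)
  moreover have "(\<sigma>(a := b, b := a))(x := y, y := x) = (\<sigma>(x := y, y := x))(a := b, b := a)"
    using Ins.hyps Ins.prems by auto
  moreover have "n + of_bool (inp b) + of_bool (inp y) = n + of_bool (inp y) + of_bool (inp b)" by simp
  ultimately show ?case by (simp only: append.simps append_assoc)
qed

text \<open>An in-point that moves behind its partner starts to be counted; when an out-point moves,
  the in-point at the other end of its strand ceases to be counted.\<close>

lemma ncw_rotate:
  assumes "ncw inp (a # xs) n \<sigma>"
  shows "ncw inp (xs @ [a]) (n + sign_of inp a) \<sigma>"
  using assms
proof (induction "a # xs" n \<sigma> arbitrary: xs rule: ncw.induct)
  case (Ins us vs n \<sigma> x y)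
  show ?case
  proof (cases us)
    case Nil
    then have xs: "a = x" "xs = y # vs" using Ins.hyps by auto
    have "ncw inp (y # vs @ [x]) (n + of_bool (inp x)) (\<sigma>(y := x, x := y))"
      by (rule ncw_wrap_pair) (use Ins.hyps Nil in auto)
    moreover have "\<sigma>(y := x, x := y) = \<sigma>(x := y, y := x)" using Ins.hyps by auto
    ultimately show ?thesis using xs Ins.hyps by (auto simp: sign_of_def)
  next
    case (Cons a' us')
    then have xs: "a' = a" "xs = us' @ x # y # vs" using Ins.hyps by auto
    have "ncw inp (us' @ (vs @ [a])) (n + sign_of inp a) \<sigma>"
      using Ins.hyps(2)[of "us' @ vs"] xs Cons by simp
    then have "ncw inp (us' @ x # y # (vs @ [a])) (n + sign_of inp a + of_bool (inp y)) (\<sigma>(x := y, y := x))"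
      by (rule ncw.Ins) (use Ins.hyps Cons xs in auto)
    then show ?thesis using xs by (simp add: algebra_simps)
  qed
qed

lemma ncw_balanced: "ncw inp xs n \<sigma> \<Longrightarrow> (\<Sum>x\<leftarrow>xs. sign_of inp x) = 0"
  by (induction rule: ncw.induct) (auto simp: sign_of_def)

lemma ncw_rotates: "ncw inp (us @ vs) n \<sigma> \<Longrightarrow> ncw inp (vs @ us) (n + (\<Sum>x\<leftarrow>us. sign_of inp x)) \<sigma>"
proof (induction us arbitrary: vs n)
  case (Cons a us)
  then have "ncw inp (us @ (vs @ [a])) (n + sign_of inp a) \<sigma>" using ncw_rotate[of inp a "us @ vs"] by simp
  from Cons.IH[OF this] show ?case by (simp add: algebra_simps)
qed simp

lemma ncw_rotate':
  assumes "ncw inp (xs @ [a]) n \<sigma>"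
  shows "ncw inp (a # xs) (n - sign_of inp a) \<sigma>"
proof -
  have "(\<Sum>x\<leftarrow>xs. sign_of inp x) = - sign_of inp a"
    using ncw_balanced[OF assms] by simp
  then show ?thesis using ncw_rotates[OF assms] by simp
qed

section \<open>Closures and coherence on cyclic lists\<close>

type_synonym 'e elem = "('e \<Rightarrow> 'e) \<Rightarrow>\<^sub>0 laurent"

text \<open>The difference between cone index and weight is the same for all smoothings. This
  integer \<kappa> replaces the half-integers \<open>c1\<close> and \<open>c2\<close>: signs depend
  on them only through \<open>2 * c1 - c2\<close>.\<close>

definition alt :: "('e \<Rightarrow> bool) \<Rightarrow> 'e list \<Rightarrow> int \<Rightarrow> 'e elem \<Rightarrow> bool" where
  "alt inp xs \<kappa> P \<longleftrightarrow> (\<forall>\<sigma>\<in>keys P. \<exists>n. ncw inp xs n \<sigma> \<and> cone (\<kappa> + n) (lookup P \<sigma>))"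

lemma alt_cone: "alt inp xs \<kappa> P \<Longrightarrow> ncw inp xs n \<sigma> \<Longrightarrow> cone (\<kappa> + n) (lookup P \<sigma>)"
  unfolding alt_def by (metis cone_zero in_keys_iff ncw_unique)

lemma alt_keys: "alt inp xs \<kappa> P \<Longrightarrow> keys P \<subseteq> mts (set xs)"
  unfolding alt_def using ncw_mts by fast

lemma altE:
  assumes "alt inp xs \<kappa> P" "\<sigma> \<in> keys P"
  obtains n where "ncw inp xs n \<sigma>" "cone (\<kappa> + n) (lookup P \<sigma>)"
  using assms unfolding alt_def by blast

lemma alt_zero [simp]: "alt inp xs \<kappa> 0"
  by (simp add: alt_def)

lemma alt_add:
  assumes "alt inp xs \<kappa> P" "alt inp xs \<kappa> Q"
  shows "alt inp xs \<kappa> (P + Q)"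
  unfolding alt_def
proof
  fix \<sigma> assume "\<sigma> \<in> keys (P + Q)"
  then have "\<sigma> \<in> keys P \<or> \<sigma> \<in> keys Q" using keys_add[of P Q] by auto
  then obtain n where n: "ncw inp xs n \<sigma>" using assms by (meson altE)
  then show "\<exists>n. ncw inp xs n \<sigma> \<and> cone (\<kappa> + n) (lookup (P + Q) \<sigma>)"
    using alt_cone[OF assms(1) n] alt_cone[OF assms(2) n] cone_add by (auto simp: lookup_add)
qed

lemma alt_scale:
  assumes "alt inp xs \<kappa> P" "cone m c"
  shows "alt inp xs (\<kappa> + m) (scale c P)"
  unfolding alt_def
proof
  fix \<sigma> assume "\<sigma> \<in> keys (scale c P)"
  then have "\<sigma> \<in> keys P" using keys_push[of id "\<lambda>_. c" P] by auto
  then obtain n where n: "ncw inp xs n \<sigma>" "cone (\<kappa> + n) (lookup P \<sigma>)" using assms(1) by (auto elim: altE)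
  then have "cone ((\<kappa> + n) + m) (lookup P \<sigma> * c)" using assms(2) by (intro cone_mult)
  then show "\<exists>n. ncw inp xs n \<sigma> \<and> cone (\<kappa> + m + n) (lookup (scale c P) \<sigma>)"
    using n(1) by (auto simp: algebra_simps)
qed

lemma alt_push:
  assumes "alt inp xs \<kappa> P"
    and h: "\<And>\<sigma> n. \<sigma> \<in> keys P \<Longrightarrow> ncw inp xs n \<sigma> \<Longrightarrow> ncw inp' ys (n + c) (h \<sigma>)"
  shows "alt inp' ys (\<kappa> - c) (push h (\<lambda>_. 1) P)"
  unfolding alt_def
proof
  fix \<rho> assume "\<rho> \<in> keys (push h (\<lambda>_. 1) P)"
  then obtain \<sigma> where s: "\<sigma> \<in> keys P" "\<rho> = h \<sigma>" using keys_push[of h] by blast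
  then obtain n where n: "ncw inp xs n \<sigma>" using assms(1) by (meson altE)
  have r: "ncw inp' ys (n + c) \<rho>" using h[OF s(1) n] s(2) by simp
  have "cone (\<kappa> + n) (lookup (push h (\<lambda>_. 1) P) \<rho>)"
    unfolding lookup_push mult_1_right
  proof (rule cone_sum)
    fix \<tau> assume t: "\<tau> \<in> {\<tau>. \<tau> \<in> keys P \<and> h \<tau> = \<rho>}"
    obtain m where m: "ncw inp xs m \<tau>" "cone (\<kappa> + m) (lookup P \<tau>)" using assms(1) t by (auto elim: altE)
    then have "m = n" using h[of \<tau> m] t ncw_unique[OF r, of "m + c"] by auto
    then show "cone (\<kappa> + n) (lookup P \<tau>)" using m by simp
  qed
  then show "\<exists>n. ncw inp' ys n \<rho> \<and> cone (\<kappa> - c + n) (lookup (push h (\<lambda>_. 1) P) \<rho>)"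
    using r by (intro exI[of _ "n + c"]) simp
qed

lemma alt_rotate: "alt inp (a # xs) \<kappa> P \<Longrightarrow> alt inp (xs @ [a]) (\<kappa> - sign_of inp a) P"
  using alt_push[of inp "a # xs" \<kappa> P inp "xs @ [a]" "sign_of inp a" id] ncw_rotate[of inp a xs] by simp

lemma alt_rotate': "alt inp (xs @ [a]) \<kappa> P \<Longrightarrow> alt inp (a # xs) (\<kappa> + sign_of inp a) P"
  using alt_push[of inp "xs @ [a]" \<kappa> P inp "a # xs" "- sign_of inp a" id] ncw_rotate'[of inp xs a] by simp

lemma alt_rotates: "alt inp (us @ vs) \<kappa> P \<Longrightarrow> alt inp (vs @ us) (\<kappa> - (\<Sum>x\<leftarrow>us. sign_of inp x)) P"
  using alt_push[of inp "us @ vs" \<kappa> P inp "vs @ us" "\<Sum>x\<leftarrow>us. sign_of inp x" id] ncw_rotates[of inp us vs] by simp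

definition cl :: "'e \<Rightarrow> 'e \<Rightarrow> 'e elem \<Rightarrow> 'e elem" where
  "cl x y = push (close_matching x y) (\<lambda>\<sigma>. if \<sigma> x = y then loop_value else 1)"

lemma cl_add: "cl x y (P + Q) = cl x y P + cl x y Q"
  by (simp add: cl_def push_add)

lemma cl_zero [simp]: "cl x y 0 = 0"
  by (simp add: cl_def)

lemma cl_sum: "cl x y (sum f I) = (\<Sum>i\<in>I. cl x y (f i))"
  by (simp add: cl_def push_sum)

lemma cl_single: "cl x y (single \<sigma> c) =
    single (close_matching x y \<sigma>) (c * (if \<sigma> x = y then loop_value else 1))"
  by (simp add: cl_def)

lemma cl_scale: "cl x y (scale c P) = scale c (cl x y P)"
  by (simp add: cl_def push_push o_def mult.commute)

lemma keys_cl: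
  assumes "keys P \<subseteq> mts X" "x \<in> X" "y \<in> X" "x \<noteq> y"
  shows "keys (cl x y P) \<subseteq> mts (X - {x, y})"
  using keys_push[of "close_matching x y" _ P] close_matching_mts[of _ X x y] assms
  unfolding cl_def by blast

text \<open>Over a fixed result the preimages split into those with and those without a loop. Their
  weights exceed that of the result by \<open>of_bool (inp y)\<close> and
  \<open>of_bool (inp x)\<close>, which differ by one, so the two partial sums are in the situation
  of \<open>cone_loop_value_consistent\<close>. About \<kappa>' nothing is assumed; the hypothesis
  only says that some offset works.\<close>

lemma alt_cl_consistent:
  assumes P: "alt inp (us @ x # y # vs) \<kappa> P" and xy: "inp x \<noteq> inp y"
    and Q: "alt inp (us @ vs) \<kappa>' (cl x y P)"
  shows "alt inp (us @ vs) (\<kappa> + of_bool (inp x)) (cl x y P)"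
  unfolding alt_def
proof
  fix \<rho> assume "\<rho> \<in> keys (cl x y P)"
  with Q obtain m where m: "ncw inp (us @ vs) m \<rho>" "cone (\<kappa>' + m) (lookup (cl x y P) \<rho>)"
    by (rule altE)
  let ?F = "{\<sigma>. \<sigma> \<in> keys P \<and> close_matching x y \<sigma> = \<rho>}"
  define A where "A = (\<Sum>\<sigma> | \<sigma> \<in> ?F \<and> \<sigma> x \<noteq> y. lookup P \<sigma>)"
  define B where "B = (\<Sum>\<sigma> | \<sigma> \<in> ?F \<and> \<sigma> x = y. lookup P \<sigma>)"
  have fin: "finite ?F" by simp
  have "lookup (cl x y P) \<rho> = (\<Sum>\<sigma>\<in>?F. lookup P \<sigma> * (if \<sigma> x = y then loop_value else 1))"
    by (simp add: cl_def lookup_push)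
  also have "\<dots> = (\<Sum>\<sigma> | \<sigma> \<in> ?F \<and> \<sigma> x \<noteq> y. lookup P \<sigma> * (if \<sigma> x = y then loop_value else 1))
      + (\<Sum>\<sigma> | \<sigma> \<in> ?F \<and> \<sigma> x = y. lookup P \<sigma> * (if \<sigma> x = y then loop_value else 1))"
    by (subst sum.union_disjoint[symmetric]) (auto intro!: sum.cong simp: finite_subset[OF _ fin])
  also have "\<dots> = A + loop_value * B"
    by (simp add: A_def B_def sum_distrib_left mult.commute)
  finally have AB: "lookup (cl x y P) \<rho> = A + loop_value * B" .
  have each: "m = n - of_bool (inp (if \<sigma> x = y then y else x))"
    if "\<sigma> \<in> ?F" "ncw inp (us @ x # y # vs) n \<sigma>" for \<sigma> n
    using ncw_close[OF that(2) refl xy] that(1) ncw_unique[OF m(1)] by auto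
  let ?s = "of_bool (inp y) - of_bool (inp x) :: int"
  have s: "?s = 1 \<or> ?s = -1" using xy by auto
  have A: "cone (\<kappa> + of_bool (inp x) + m) A"
    unfolding A_def
  proof (rule cone_sum)
    fix \<sigma> assume s: "\<sigma> \<in> {\<sigma>. \<sigma> \<in> ?F \<and> \<sigma> x \<noteq> y}"
    then obtain n where n: "ncw inp (us @ x # y # vs) n \<sigma>" "cone (\<kappa> + n) (lookup P \<sigma>)"
      using P by (auto elim: altE)
    then have "m = n - of_bool (inp x)" using each[of \<sigma> n] s by simp
    then have "\<kappa> + n = \<kappa> + of_bool (inp x) + m" by simp
    with n(2) show "cone (\<kappa> + of_bool (inp x) + m) (lookup P \<sigma>)" by (simp only:)
  qed
  have B: "cone (\<kappa> + of_bool (inp x) + m + ?s) B"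
    unfolding B_def
  proof (rule cone_sum)
    fix \<sigma> assume s: "\<sigma> \<in> {\<sigma>. \<sigma> \<in> ?F \<and> \<sigma> x = y}"
    then obtain n where n: "ncw inp (us @ x # y # vs) n \<sigma>" "cone (\<kappa> + n) (lookup P \<sigma>)"
      using P by (auto elim: altE)
    then have "m = n - of_bool (inp y)" using each[of \<sigma> n] s by simp
    then have "\<kappa> + n = \<kappa> + of_bool (inp x) + m + ?s" by simp
    with n(2) show "cone (\<kappa> + of_bool (inp x) + m + ?s) (lookup P \<sigma>)" by (simp only:)
  qed
  have "cone (\<kappa> + of_bool (inp x) + m) (A + loop_value * B)"
    by (rule cone_loop_value_consistent[OF A B s]) (use m(2) AB in simp)
  then show "\<exists>n. ncw inp (us @ vs) n \<rho> \<and> cone (\<kappa> + of_bool (inp x) + n) (lookup (cl x y P) \<rho>)"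
    using m(1) AB by auto
qed

lemma alt_cl_consistent_wrap:
  assumes "alt inp (y # us @ [x]) \<kappa> P" "inp x \<noteq> inp y" "alt inp us \<kappa>' (cl x y P)"
  shows "alt inp us (\<kappa> + sign_of inp x + of_bool (inp x)) (cl x y P)"
proof -
  have "alt inp (us @ x # y # []) (\<kappa> - sign_of inp y) P"
    using alt_rotate[OF assms(1)] by simp
  then have "alt inp (us @ []) (\<kappa> - sign_of inp y + of_bool (inp x)) (cl x y P)"
    by (rule alt_cl_consistent) (use assms in auto)
  moreover have "sign_of inp x = - sign_of inp y" using assms(2) by (auto simp: sign_of_def)
  ultimately show ?thesis by simp
qed

text \<open>The third premise closes up the last and the first end of the cyclic list.\<close>

inductive scoh :: "('e \<Rightarrow> bool) \<Rightarrow> 'e list \<Rightarrow> int \<Rightarrow> 'e elem \<Rightarrow> bool" for inp where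
  scohI: "alt inp xs \<kappa> P \<Longrightarrow>
    (\<And>us x y vs. xs = us @ x # y # vs \<Longrightarrow> us @ vs \<noteq> [] \<Longrightarrow> inp x \<noteq> inp y \<Longrightarrow>
       scoh inp (us @ vs) (\<kappa> + of_bool (inp x)) (cl x y P)) \<Longrightarrow>
    (\<And>us x y. xs = y # us @ [x] \<Longrightarrow> us \<noteq> [] \<Longrightarrow> inp x \<noteq> inp y \<Longrightarrow>
       scoh inp us (\<kappa> + sign_of inp x + of_bool (inp x)) (cl x y P)) \<Longrightarrow>
    scoh inp xs \<kappa> P"

lemma scoh_alt: "scoh inp xs \<kappa> P \<Longrightarrow> alt inp xs \<kappa> P"
  by (erule scoh.cases) simp

lemma scoh_keys: "scoh inp xs \<kappa> P \<Longrightarrow> keys P \<subseteq> mts (set xs)"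
  using scoh_alt alt_keys by metis

lemma scoh_close:
  "scoh inp xs \<kappa> P \<Longrightarrow> xs = us @ x # y # vs \<Longrightarrow> us @ vs \<noteq> [] \<Longrightarrow> inp x \<noteq> inp y \<Longrightarrow>
   scoh inp (us @ vs) (\<kappa> + of_bool (inp x)) (cl x y P)"
  by (erule scoh.cases) simp

lemma scoh_wrap:
  "scoh inp xs \<kappa> P \<Longrightarrow> xs = y # us @ [x] \<Longrightarrow> us \<noteq> [] \<Longrightarrow> inp x \<noteq> inp y \<Longrightarrow>
   scoh inp us (\<kappa> + sign_of inp x + of_bool (inp x)) (cl x y P)"
  by (erule scoh.cases) simp

lemma scoh_zero: "scoh inp xs \<kappa> 0"
proof (induction "length xs" arbitrary: xs \<kappa> rule: less_induct)
  case less
  show ?case by (rule scohI) (auto intro!: less)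
qed

lemma scoh_add: "scoh inp xs \<kappa> P \<Longrightarrow> scoh inp xs \<kappa> Q \<Longrightarrow> scoh inp xs \<kappa> (P + Q)"
proof (induction arbitrary: Q rule: scoh.induct)
  case (scohI xs \<kappa> P)
  show ?case
  proof (rule scoh.scohI)
    show "alt inp xs \<kappa> (P + Q)" by (rule alt_add[OF scohI.hyps(1) scoh_alt[OF scohI.prems]])
  next
    fix us x y vs assume *: "xs = us @ x # y # vs" "us @ vs \<noteq> []" "inp x \<noteq> inp y"
    show "scoh inp (us @ vs) (\<kappa> + of_bool (inp x)) (cl x y (P + Q))"
      unfolding cl_add by (rule scohI.IH(1)[OF *], rule scoh_close[OF scohI.prems *])
  next
    fix us x y assume *: "xs = y # us @ [x]" "us \<noteq> []" "inp x \<noteq> inp y"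
    show "scoh inp us (\<kappa> + sign_of inp x + of_bool (inp x)) (cl x y (P + Q))"
      unfolding cl_add by (rule scohI.IH(2)[OF *], rule scoh_wrap[OF scohI.prems *])
  qed
qed

lemma scoh_sum: "(\<And>i. i \<in> I \<Longrightarrow> scoh inp xs \<kappa> (f i)) \<Longrightarrow> scoh inp xs \<kappa> (sum f I)"
  by (induction I rule: infinite_finite_induct) (auto intro: scoh_add scoh_zero)

lemma scoh_scale: "scoh inp xs \<kappa> P \<Longrightarrow> cone m c \<Longrightarrow> scoh inp xs (\<kappa> + m) (scale c P)"
proof (induction rule: scoh.induct)
  case (scohI xs \<kappa> P)
  show ?case
  proof (rule scoh.scohI)
    show "alt inp xs (\<kappa> + m) (scale c P)" by (rule alt_scale[OF scohI.hyps(1) scohI.prems])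
  next
    fix us x y vs assume "xs = us @ x # y # vs" "us @ vs \<noteq> []" "inp x \<noteq> inp y"
    from scohI.IH(1)[OF this scohI.prems]
    show "scoh inp (us @ vs) (\<kappa> + m + of_bool (inp x)) (cl x y (scale c P))"
      by (simp only: cl_scale add.assoc add.commute[of m])
  next
    fix us x y assume "xs = y # us @ [x]" "us \<noteq> []" "inp x \<noteq> inp y"
    from scohI.IH(2)[OF this scohI.prems]
    show "scoh inp us (\<kappa> + m + sign_of inp x + of_bool (inp x)) (cl x y (scale c P))"
      by (simp only: cl_scale add.assoc add.commute[of m])
  qed
qed

text \<open>The offsets of the closures carry no information of their own: as soon as all closures
  alternate somehow, the offset at the top determines the others through
  \<open>alt_cl_consistent\<close>.\<close>

lemma scoh_change: "scoh inp xs \<kappa> P \<Longrightarrow> alt inp xs \<kappa>' P \<Longrightarrow> scoh inp xs \<kappa>' P"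
proof (induction arbitrary: \<kappa>' rule: scoh.induct)
  case (scohI xs \<kappa> P)
  show ?case
  proof (rule scoh.scohI)
    show "alt inp xs \<kappa>' P" by fact
  next
    fix us x y vs assume *: "xs = us @ x # y # vs" "us @ vs \<noteq> []" "inp x \<noteq> inp y"
    show "scoh inp (us @ vs) (\<kappa>' + of_bool (inp x)) (cl x y P)"
      by (rule scohI.IH(1)[OF *], rule alt_cl_consistent)
        (use * scohI.prems scohI.hyps(2)[OF *] scoh_alt in auto)
  next
    fix us x y assume *: "xs = y # us @ [x]" "us \<noteq> []" "inp x \<noteq> inp y"
    show "scoh inp us (\<kappa>' + sign_of inp x + of_bool (inp x)) (cl x y P)"
      by (rule scohI.IH(2)[OF *], rule alt_cl_consistent_wrap)
        (use * scohI.prems scohI.hyps(3)[OF *] scoh_alt in auto)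
  qed
qed

text \<open>Rotation permutes the admissible closures. The wrap-around pair of one list is a pair of
  list neighbours in the other, and a closure away from the moved end is again a rotation, of a
  shorter list.\<close>

lemma scoh_rotate: "scoh inp (a # xs) \<kappa> P \<Longrightarrow> scoh inp (xs @ [a]) (\<kappa> - sign_of inp a) P"
proof (induction "a # xs" \<kappa> P arbitrary: xs rule: scoh.induct)
  case (scohI \<kappa> P)
  show ?case
  proof (rule scoh.scohI)
    show "alt inp (xs @ [a]) (\<kappa> - sign_of inp a) P" by (rule alt_rotate[OF scohI.hyps(1)])
  next
    fix us x y vs assume *: "xs @ [a] = us @ x # y # vs" "us @ vs \<noteq> []" "inp x \<noteq> inp y"
    show "scoh inp (us @ vs) (\<kappa> - sign_of inp a + of_bool (inp x)) (cl x y P)"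
    proof (cases vs rule: rev_cases)
      case Nil
      then have "xs = us @ [x]" "a = y" using * by auto
      then have "scoh inp us (\<kappa> + sign_of inp x + of_bool (inp x)) (cl x y P)"
        using scohI.hyps(4)[of y us x] * Nil by auto
      moreover have "sign_of inp x = - sign_of inp a" using \<open>a = y\<close> * by (auto simp: sign_of_def)
      ultimately show ?thesis using Nil by simp
    next
      case (snoc vs' b)
      then have b: "b = a" "xs = us @ x # y # vs'" using * by auto
      then have "scoh inp ((us @ vs') @ [a]) (\<kappa> + of_bool (inp x) - sign_of inp a) (cl x y P)"
        by (intro scohI.hyps(3)[of "a # us"]) (use * in auto)
      then show ?thesis using b snoc by (simp add: algebra_simps)
    qed
  next
    fix us x y assume *: "xs @ [a] = y # us @ [x]" "us \<noteq> []" "inp x \<noteq> inp y"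
    then have a: "a = x" "xs = y # us" by (cases xs; auto)+
    then have "scoh inp us (\<kappa> + of_bool (inp x)) (cl x y P)"
      using scohI.hyps(2)[of "[]" x y us] * by auto
    then show "scoh inp us (\<kappa> - sign_of inp a + sign_of inp x + of_bool (inp x)) (cl x y P)"
      using a by simp
  qed
qed

lemma scoh_rotates: "scoh inp (us @ vs) \<kappa> P \<Longrightarrow> scoh inp (vs @ us) (\<kappa> - (\<Sum>x\<leftarrow>us. sign_of inp x)) P"
proof (induction us arbitrary: vs \<kappa>)
  case (Cons a us)
  then have "scoh inp (us @ (vs @ [a])) (\<kappa> - sign_of inp a) P"
    using scoh_rotate[of inp a "us @ vs"] by simp
  from Cons.IH[OF this] show ?case by (simp add: algebra_simps)
qed simp

text \<open>Rotating by all the other ends has the effect of a backward rotation;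
  \<open>scoh_change\<close> then installs the offset that this one step should have.\<close>

lemma scoh_rotate':
  assumes "scoh inp (xs @ [a]) \<kappa> P"
  shows "scoh inp (a # xs) (\<kappa> + sign_of inp a) P"
proof -
  have "scoh inp (a # xs) (\<kappa> - (\<Sum>x\<leftarrow>xs. sign_of inp x)) P"
    using scoh_rotates[OF assms] by simp
  then show ?thesis using scoh_change alt_rotate' scoh_alt assms by metis
qed

subsection \<open>Relabelling\<close>

text \<open>\<open>X\<close> is the set on which \<open>f\<close> is known to be injective and may
  be larger than the set of current ends. So it can stay the same while ends are closed up.\<close>

definition relabel_matching :: "'a set \<Rightarrow> ('a \<Rightarrow> 'b) \<Rightarrow> ('a \<Rightarrow> 'a) \<Rightarrow> 'b \<Rightarrow> 'b" where
  "relabel_matching X f \<sigma> = (\<lambda>z. if z \<in> f ` X then f (\<sigma> (inv_into X f z)) else z)"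

definition relabel :: "'a set \<Rightarrow> ('a \<Rightarrow> 'b) \<Rightarrow> 'a elem \<Rightarrow> 'b elem" where
  "relabel X f = push (relabel_matching X f) (\<lambda>_. 1)"

lemma relabel_matching_image [simp]:
  "inj_on f X \<Longrightarrow> z \<in> X \<Longrightarrow> relabel_matching X f \<sigma> (f z) = f (\<sigma> z)"
  by (simp add: relabel_matching_def)

lemma relabel_matching_outside [simp]: "z \<notin> f ` X \<Longrightarrow> relabel_matching X f \<sigma> z = z"
  by (simp add: relabel_matching_def)

lemma relabel_matching_mts:
  assumes "\<sigma> \<in> mts Y" "Y \<subseteq> X" "inj_on f X"
  shows "relabel_matching X f \<sigma> \<in> mts (f ` Y)"
  unfolding mts_def mem_Collect_eq
proof (intro conjI ballI allI impI)
  note m = mtsD[OF assms(1)]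
  fix z assume "z \<in> f ` Y"
  then obtain y where y: "y \<in> Y" "z = f y" by auto
  then have "y \<in> X" "\<sigma> y \<in> Y" "\<sigma> y \<in> X" "\<sigma> y \<noteq> y" using m assms by auto
  then show "relabel_matching X f \<sigma> z \<in> f ` Y" "relabel_matching X f \<sigma> z \<noteq> z"
    "relabel_matching X f \<sigma> (relabel_matching X f \<sigma> z) = z"
    using y assms(3) m(3) by (auto dest: inj_onD)
next
  note m = mtsD[OF assms(1)]
  fix z assume z: "z \<notin> f ` Y"
  show "relabel_matching X f \<sigma> z = z"
  proof (cases "z \<in> f ` X")
    case True
    then obtain x where "x \<in> X" "z = f x" by auto
    moreover have "x \<notin> Y" using z \<open>z = f x\<close> by auto
    ultimately show ?thesis using m(4)[of x] assms(3) by auto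
  qed simp
qed

lemma relabel_matching_close:
  assumes "\<sigma> \<in> mts Y" "Y \<subseteq> X" "inj_on f X" "x \<in> Y" "y \<in> Y" "x \<noteq> y"
  shows "close_matching (f x) (f y) (relabel_matching X f \<sigma>) = relabel_matching X f (close_matching x y \<sigma>)"
proof
  fix z
  show "close_matching (f x) (f y) (relabel_matching X f \<sigma>) z = relabel_matching X f (close_matching x y \<sigma>) z"
  proof (cases "z \<in> f ` X")
    case True
    then obtain w where w: "w \<in> X" "z = f w" by auto
    have "\<sigma> w \<in> X" using mtsD(1,4)[OF assms(1), of w] w assms(2) by (cases "w \<in> Y") auto
    moreover have "x \<in> X" "y \<in> X" using assms by auto
    ultimately show ?thesis using w assms(3)
      by (auto simp: close_matching_def inj_on_eq_iff)
  next
    case False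
    then show ?thesis using assms by (auto simp: close_matching_def)
  qed
qed

lemma cl_relabel:
  assumes "keys P \<subseteq> mts Y" "Y \<subseteq> X" "inj_on f X" "x \<in> Y" "y \<in> Y" "x \<noteq> y"
  shows "cl (f x) (f y) (relabel X f P) = relabel X f (cl x y P)"
  unfolding cl_def relabel_def push_push
proof (rule push_cong)
  fix \<sigma> assume "\<sigma> \<in> keys P"
  then have s: "\<sigma> \<in> mts Y" using assms by auto
  show "(close_matching (f x) (f y) \<circ> relabel_matching X f) \<sigma> = (relabel_matching X f \<circ> close_matching x y) \<sigma>"
    using relabel_matching_close[OF s assms(2-6)] by simp
  have "relabel_matching X f \<sigma> (f x) = f y \<longleftrightarrow> \<sigma> x = y"
    using assms mtsD(1)[OF s, of x] by (auto simp: inj_on_eq_iff subset_iff)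
  then show "1 * (if relabel_matching X f \<sigma> (f x) = f y then loop_value else 1) =
      (if \<sigma> x = y then loop_value else 1) * 1" by simp
qed

lemma ncw_relabel_matching:
  assumes "ncw inp xs n \<sigma>" "set xs \<subseteq> X" "inj_on f X" "\<And>x. x \<in> X \<Longrightarrow> inp' (f x) = inp x"
  shows "ncw inp' (map f xs) n (relabel_matching X f \<sigma>)"
proof (rule ncw_relabel[OF assms(1)])
  show "inj_on f (set xs)" using assms(2,3) inj_on_subset by blast
  show "relabel_matching X f \<sigma> z = z" if "z \<notin> f ` set xs" for z
    using that mtsD(4)[OF relabel_matching_mts[OF ncw_mts[OF assms(1)] assms(2,3)]] by blast
qed (use assms in auto)

lemma alt_relabel:
  assumes "alt inp xs \<kappa> P" "set xs \<subseteq> X" "inj_on f X" "\<And>x. x \<in> X \<Longrightarrow> inp' (f x) = inp x"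
  shows "alt inp' (map f xs) \<kappa> (relabel X f P)"
proof -
  have "alt inp' (map f xs) (\<kappa> - 0) (push (relabel_matching X f) (\<lambda>_. 1) P)"
    by (rule alt_push[OF assms(1)]) (simp add: ncw_relabel_matching assms(2-4))
  then show ?thesis by (simp add: relabel_def)
qed

lemma scoh_relabel:
  assumes "scoh inp xs \<kappa> P" "set xs \<subseteq> X" "inj_on f X" "\<And>x. x \<in> X \<Longrightarrow> inp' (f x) = inp x"
  shows "scoh inp' (map f xs) \<kappa> (relabel X f P)"
  using assms
proof (induction rule: scoh.induct)
  case (scohI xs \<kappa> P)
  note prems = scohI.prems
  note keys = alt_keys[OF scohI.hyps(1)]
  show ?case
  proof (rule scoh.scohI)
    show "alt inp' (map f xs) \<kappa> (relabel X f P)" using alt_relabel[OF scohI.hyps(1) prems] .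
  next
    fix us' x' y' vs' assume *: "map f xs = us' @ x' # y' # vs'" "us' @ vs' \<noteq> []" "inp' x' \<noteq> inp' y'"
    then obtain us x y vs where xs: "xs = us @ x # y # vs" "us' = map f us" "x' = f x" "y' = f y" "vs' = map f vs"
      by (auto simp: map_eq_append_conv map_eq_Cons_conv)
    then have 1: "x \<in> X" "y \<in> X" "x \<noteq> y" "inp x \<noteq> inp y" "inp' x' = inp x"
      using prems *(3) by auto
    have "scoh inp' (map f (us @ vs)) (\<kappa> + of_bool (inp x)) (relabel X f (cl x y P))"
      by (rule scohI.IH(1)) (use xs * prems 1 in auto)
    moreover have "cl x' y' (relabel X f P) = relabel X f (cl x y P)"
      unfolding xs by (rule cl_relabel[OF keys prems(1,2)]) (use 1 xs in auto)
    ultimately show "scoh inp' (us' @ vs') (\<kappa> + of_bool (inp' x')) (cl x' y' (relabel X f P))"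
      using xs 1(5) by simp
  next
    fix us' x' y' assume *: "map f xs = y' # us' @ [x']" "us' \<noteq> []" "inp' x' \<noteq> inp' y'"
    then obtain us x y where xs: "xs = y # us @ [x]" "us' = map f us" "x' = f x" "y' = f y"
      by (auto simp: map_eq_append_conv map_eq_Cons_conv)
    then have 1: "x \<in> X" "y \<in> X" "x \<noteq> y" "inp x \<noteq> inp y" "inp' x' = inp x"
      using prems *(3) by auto
    have "scoh inp' (map f us) (\<kappa> + sign_of inp x + of_bool (inp x)) (relabel X f (cl x y P))"
      by (rule scohI.IH(2)) (use xs * prems 1 in auto)
    moreover have "cl x' y' (relabel X f P) = relabel X f (cl x y P)"
      unfolding xs by (rule cl_relabel[OF keys prems(1,2)]) (use 1 xs in auto)
    ultimately show "scoh inp' us' (\<kappa> + sign_of inp' x' + of_bool (inp' x')) (cl x' y' (relabel X f P))"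
      using xs 1(5) by (simp add: sign_of_def)
  qed
qed

section \<open>Joining two coherent elements\<close>

definition join_matching :: "('e \<Rightarrow> 'e) \<Rightarrow> 'e elem \<Rightarrow> 'e elem" where
  "join_matching \<tau> = push (\<lambda>\<sigma>. \<sigma> \<circ> \<tau>) (\<lambda>_. 1)"

text \<open>The contents of two disjoint discs side by side. The sum is organised by the second
  factor because gluing treats the guest one smoothing at a time, while the host enters as a whole
  element.\<close>

definition tensor :: "'e elem \<Rightarrow> 'e elem \<Rightarrow> 'e elem" where
  "tensor P Q = (\<Sum>\<tau>\<in>keys Q. scale (lookup Q \<tau>) (join_matching \<tau> P))"

lemma tensor_single_single: "tensor (single \<sigma> c) (single \<tau> c') = single (\<sigma> \<circ> \<tau>) (c * c')"
  by (cases "c' = 0") (simp_all add: tensor_def join_matching_def)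

lemma scale_zero [simp]: "scale 0 P = 0"
  by (rule poly_mapping_eqI) simp

lemma tensor_superset:
  "finite S \<Longrightarrow> keys Q \<subseteq> S \<Longrightarrow> tensor P Q = (\<Sum>\<tau>\<in>S. scale (lookup Q \<tau>) (join_matching \<tau> P))"
  unfolding tensor_def by (rule sum.mono_neutral_left) (auto simp: in_keys_iff)

lemma scale_add: "scale (c + c') P = scale c P + scale c' P"
  by (rule poly_mapping_eqI) (simp add: lookup_add distrib_left)

lemma tensor_add_right: "tensor P (Q + Q') = tensor P Q + tensor P Q'"
proof -
  let ?S = "keys Q \<union> keys Q'"
  have "tensor P (Q + Q') = (\<Sum>\<tau>\<in>?S. scale (lookup (Q + Q') \<tau>) (join_matching \<tau> P))"
    using keys_add[of Q Q'] by (intro tensor_superset) auto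
  then show ?thesis
    by (simp add: tensor_superset[of ?S Q] tensor_superset[of ?S Q'] lookup_add scale_add sum.distrib)
qed

lemma tensor_sum_right: "tensor P (sum f I) = (\<Sum>i\<in>I. tensor P (f i))"
  by (induction I rule: infinite_finite_induct) (auto simp: tensor_add_right, simp_all add: tensor_def)

lemma tensor_sum_left: "tensor (sum f I) Q = (\<Sum>i\<in>I. tensor (f i) Q)"
  unfolding tensor_def join_matching_def push_sum by (rule sum.swap)

lemma tensor_monomials:
  "tensor P Q = (\<Sum>\<sigma>\<in>keys P. \<Sum>\<tau>\<in>keys Q. single (\<sigma> \<circ> \<tau>) (lookup P \<sigma> * lookup Q \<tau>))"
proof -
  have "tensor P Q = tensor (\<Sum>\<sigma>\<in>keys P. single \<sigma> (lookup P \<sigma>)) (\<Sum>\<tau>\<in>keys Q. single \<tau> (lookup Q \<tau>))"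
    using laurent_sum_monomials[of P] laurent_sum_monomials[of Q] by simp
  then show ?thesis
    by (simp only: tensor_sum_left tensor_sum_right tensor_single_single) (rule sum.swap)
qed

lemma mts_comp:
  assumes "\<sigma> \<in> mts X" "\<tau> \<in> mts Y" "X \<inter> Y = {}"
  shows "\<sigma> \<circ> \<tau> \<in> mts (X \<union> Y)" "\<sigma> \<circ> \<tau> = \<tau> \<circ> \<sigma>"
    "z \<in> X \<Longrightarrow> (\<sigma> \<circ> \<tau>) z = \<sigma> z" "z \<in> Y \<Longrightarrow> (\<sigma> \<circ> \<tau>) z = \<tau> z"
proof -
  note s = mtsD[OF assms(1)] and t = mtsD[OF assms(2)]
  show x: "z \<in> X \<Longrightarrow> (\<sigma> \<circ> \<tau>) z = \<sigma> z" for z using t(4) assms(3) by fastforce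
  show y: "z \<in> Y \<Longrightarrow> (\<sigma> \<circ> \<tau>) z = \<tau> z" for z using s(4) t(1) assms(3) by fastforce
  have n: "z \<notin> X \<union> Y \<Longrightarrow> (\<sigma> \<circ> \<tau>) z = z" for z using s(4) t(4) by simp
  show "\<sigma> \<circ> \<tau> \<in> mts (X \<union> Y)"
    unfolding mts_def mem_Collect_eq using x y n s(1-3) t(1-3) by (metis Un_iff)
  show "\<sigma> \<circ> \<tau> = \<tau> \<circ> \<sigma>"
  proof
    fix z
    consider "z \<in> X" | "z \<in> Y" | "z \<notin> X \<union> Y" by auto
    then show "(\<sigma> \<circ> \<tau>) z = (\<tau> \<circ> \<sigma>) z"
    proof cases
      case 1
      then have "\<sigma> z \<notin> Y" using s(1) assms(3) by auto
      then show ?thesis using x[OF 1] t(4) by simp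
    next
      case 2
      then have "\<sigma> z = z" using s(4) assms(3) by auto
      then show ?thesis using y[OF 2] by simp
    next
      case 3
      then show ?thesis using s(4) t(4) by simp
    qed
  qed
qed

lemma keys_tensor:
  assumes "keys P \<subseteq> mts X" "keys Q \<subseteq> mts Y" "X \<inter> Y = {}"
  shows "keys (tensor P Q) \<subseteq> mts (X \<union> Y)"
proof
  fix \<rho> assume "\<rho> \<in> keys (tensor P Q)"
  then have "(\<Sum>\<sigma>\<in>keys P. \<Sum>\<tau>\<in>keys Q. lookup (single (\<sigma> \<circ> \<tau>) (lookup P \<sigma> * lookup Q \<tau>)) \<rho>) \<noteq> 0"
    by (simp add: tensor_monomials lookup_sum in_keys_iff)
  then obtain \<sigma> where s: "\<sigma> \<in> keys P" "(\<Sum>\<tau>\<in>keys Q. lookup (single (\<sigma> \<circ> \<tau>) (lookup P \<sigma> * lookup Q \<tau>)) \<rho>) \<noteq> 0"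
    by (rule sum.not_neutral_contains_not_neutral)
  from s(2) obtain \<tau> where "\<tau> \<in> keys Q" "lookup (single (\<sigma> \<circ> \<tau>) (lookup P \<sigma> * lookup Q \<tau>)) \<rho> \<noteq> 0"
    by (rule sum.not_neutral_contains_not_neutral)
  then have "\<tau> \<in> keys Q" "\<rho> = \<sigma> \<circ> \<tau>" by (auto simp: lookup_single when_def split: if_splits)
  then show "\<rho> \<in> mts (X \<union> Y)" using mts_comp(1) s assms by blast
qed

lemma tensor_commute:
  assumes "keys P \<subseteq> mts X" "keys Q \<subseteq> mts Y" "X \<inter> Y = {}"
  shows "tensor P Q = tensor Q P"
proof -
  have "tensor P Q = (\<Sum>\<sigma>\<in>keys P. \<Sum>\<tau>\<in>keys Q. single (\<tau> \<circ> \<sigma>) (lookup Q \<tau> * lookup P \<sigma>))"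
    unfolding tensor_monomials
  proof (intro sum.cong refl)
    fix \<sigma> \<tau> assume "\<sigma> \<in> keys P" "\<tau> \<in> keys Q"
    then have "\<sigma> \<circ> \<tau> = \<tau> \<circ> \<sigma>" using mts_comp(2)[OF _ _ assms(3)] assms by blast
    then show "single (\<sigma> \<circ> \<tau>) (lookup P \<sigma> * lookup Q \<tau>) = single (\<tau> \<circ> \<sigma>) (lookup Q \<tau> * lookup P \<sigma>)"
      by (simp add: mult.commute)
  qed
  also have "\<dots> = tensor Q P" unfolding tensor_monomials by (rule sum.swap)
  finally show ?thesis .
qed

lemma keys_join_matching:
  assumes "keys P \<subseteq> mts X" "\<tau> \<in> mts Y" "X \<inter> Y = {}"
  shows "keys (join_matching \<tau> P) \<subseteq> mts (X \<union> Y)"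
  using keys_push[of _ _ P] mts_comp(1)[OF _ assms(2,3)] assms(1) unfolding join_matching_def by fast

lemma cl_join_matching:
  assumes "keys P \<subseteq> mts X" "\<tau> \<in> mts Y" "X \<inter> Y = {}" "x \<in> X" "y \<in> X" "x \<noteq> y"
  shows "cl x y (join_matching \<tau> P) = join_matching \<tau> (cl x y P)"
  unfolding cl_def join_matching_def push_push
proof (rule push_cong)
  fix \<sigma> assume "\<sigma> \<in> keys P"
  then have s: "\<sigma> \<in> mts X" using assms by auto
  have t: "\<tau> z = z" if "z \<notin> Y" for z using that mtsD(4)[OF assms(2)] by auto
  have xy: "x \<notin> Y" "y \<notin> Y" using assms by auto
  have "\<tau> z = x \<longleftrightarrow> z = x" "\<tau> z = y \<longleftrightarrow> z = y" for z
    using xy t mtsD(6)[OF assms(2)] by metis+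
  then show "(close_matching x y \<circ> (\<lambda>\<sigma>. \<sigma> \<circ> \<tau>)) \<sigma> = ((\<lambda>\<sigma>. \<sigma> \<circ> \<tau>) \<circ> close_matching x y) \<sigma>"
    using t xy by (auto simp: close_matching_def fun_eq_iff)
  show "1 * (if (\<sigma> \<circ> \<tau>) x = y then loop_value else 1) = (if \<sigma> x = y then loop_value else 1) * 1"
    using t xy by simp
qed

lemma cl_tensor_left:
  assumes "keys P \<subseteq> mts X" "keys Q \<subseteq> mts Y" "X \<inter> Y = {}" "x \<in> X" "y \<in> X" "x \<noteq> y"
  shows "cl x y (tensor P Q) = tensor (cl x y P) Q"
  unfolding tensor_def cl_sum cl_scale
  by (intro sum.cong refl) (use assms cl_join_matching[OF assms(1) _ assms(3-6)] in auto)

lemma cl_tensor_right: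
  assumes "keys P \<subseteq> mts X" "keys Q \<subseteq> mts Y" "X \<inter> Y = {}" "x \<in> Y" "y \<in> Y" "x \<noteq> y"
  shows "cl x y (tensor P Q) = tensor P (cl x y Q)"
proof -
  have "cl x y (tensor P Q) = cl x y (tensor Q P)" by (simp add: tensor_commute[OF assms(1-3)])
  also have "\<dots> = tensor (cl x y Q) P" using assms by (intro cl_tensor_left) auto
  also have "\<dots> = tensor P (cl x y Q)"
    using assms(3) by (intro tensor_commute[OF keys_cl[OF assms(2,4-6)] assms(1)]) auto
  finally show ?thesis .
qed

text \<open>The order may decide which of the two closures produces the loop, but not how many loops
  arise; hence the second claim compares only the products of the factors.\<close>

lemma close_matching_commute:
  assumes "\<sigma> \<in> mts X" "distinct [x, y, z, w]"
  shows "close_matching x y (close_matching z w \<sigma>) = close_matching z w (close_matching x y \<sigma>)"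
    "(if \<sigma> z = w then c else 1) * (if close_matching z w \<sigma> x = y then c else 1) =
     (if \<sigma> x = y then c else 1) * (if close_matching x y \<sigma> z = w then c else (1 :: laurent))"
proof -
  note m = mtsD(3,6)[OF assms(1)]
  have inv: "\<sigma> u = x \<longleftrightarrow> u = \<sigma> x" "\<sigma> u = y \<longleftrightarrow> u = \<sigma> y" "\<sigma> u = z \<longleftrightarrow> u = \<sigma> z" "\<sigma> u = w \<longleftrightarrow> u = \<sigma> w" for u
    using m by metis+
  have ne: "\<sigma> x \<noteq> \<sigma> y" "\<sigma> x \<noteq> \<sigma> z" "\<sigma> x \<noteq> \<sigma> w" "\<sigma> y \<noteq> \<sigma> z" "\<sigma> y \<noteq> \<sigma> w" "\<sigma> z \<noteq> \<sigma> w"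
    "x \<noteq> y" "x \<noteq> z" "x \<noteq> w" "y \<noteq> z" "y \<noteq> w" "z \<noteq> w"
    using assms(2) m(2) by auto
  \<comment> \<open>Once the four partners are mere names, a finite case distinction on equalities
    remains.\<close>
  define x' y' z' w' where d: "x' = \<sigma> x" "y' = \<sigma> y" "z' = \<sigma> z" "w' = \<sigma> w"
  note inv' = inv[folded d] and ne' = ne[folded d]
  have sw: "x' = y \<longleftrightarrow> y' = x" "x' = z \<longleftrightarrow> z' = x" "x' = w \<longleftrightarrow> w' = x" "y' = z \<longleftrightarrow> z' = y"
    "y' = w \<longleftrightarrow> w' = y" "z' = w \<longleftrightarrow> w' = z"
    using inv unfolding d by metis+
  show "(if \<sigma> z = w then c else 1) * (if close_matching z w \<sigma> x = y then c else 1) =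
     (if \<sigma> x = y then c else 1) * (if close_matching x y \<sigma> z = w then c else (1 :: laurent))"
    unfolding close_matching_def d[symmetric] using ne' sw by (smt (verit) mult.commute)
  show "close_matching x y (close_matching z w \<sigma>) = close_matching z w (close_matching x y \<sigma>)"
  proof
    fix u
    show "close_matching x y (close_matching z w \<sigma>) u = close_matching z w (close_matching x y \<sigma>) u"
      unfolding close_matching_def d[symmetric] using ne' sw inv'[of u] by (smt (verit))
  qed
qed

lemma cl_commute:
  assumes "keys P \<subseteq> mts X" "distinct [x, y, z, w]"
  shows "cl x y (cl z w P) = cl z w (cl x y P)"
  unfolding cl_def push_push
proof (rule push_cong)
  fix \<sigma> assume "\<sigma> \<in> keys P"
  then have s: "\<sigma> \<in> mts X" using assms(1) by auto
  show "(close_matching x y \<circ> close_matching z w) \<sigma> = (close_matching z w \<circ> close_matching x y) \<sigma>"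
    using close_matching_commute(1)[OF s assms(2)] by simp
  show "(if \<sigma> z = w then loop_value else 1) * (if close_matching z w \<sigma> x = y then loop_value else 1) =
     (if \<sigma> x = y then loop_value else 1) * (if close_matching x y \<sigma> z = w then loop_value else 1)"
    by (rule close_matching_commute(2)[OF s assms(2)])
qed

lemma cl_sym:
  assumes "keys P \<subseteq> mts X"
  shows "cl x y P = cl y x P"
  unfolding cl_def
proof (rule push_cong)
  fix \<sigma> assume "\<sigma> \<in> keys P"
  then have s: "\<sigma> \<in> mts X" using assms by auto
  have inv: "\<sigma> a = b \<longleftrightarrow> \<sigma> b = a" for a b using mtsD(7)[OF s] .
  show "(if \<sigma> x = y then loop_value else 1) = (if \<sigma> y = x then loop_value else 1)"
    using inv[of x y] by simp
  show "close_matching x y \<sigma> = close_matching y x \<sigma>"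
    using mtsD(6)[OF s, of _ _] by (auto simp: close_matching_def fun_eq_iff)
qed

fun cls :: "('e \<times> 'e) list \<Rightarrow> 'e elem \<Rightarrow> 'e elem" where
  "cls [] P = P"
| "cls ((x, y) # M) P = cls M (cl x y P)"

fun pair_ends :: "('e \<times> 'e) list \<Rightarrow> 'e list" where
  "pair_ends [] = []"
| "pair_ends ((x, y) # M) = x # y # pair_ends M"

lemma cls_append: "cls (M @ N) P = cls N (cls M P)"
  by (induction M P rule: cls.induct) auto

lemma cls_sum: "cls M (sum f I) = (\<Sum>i\<in>I. cls M (f i))"
  by (induction M arbitrary: f) (auto simp: cl_sum)

lemma cls_scale: "cls M (scale c P) = scale c (cls M P)"
  by (induction M P rule: cls.induct) (simp_all only: cls.simps cl_scale)

lemma cls_zero [simp]: "cls M 0 = 0"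
  by (induction M) auto

lemma pair_ends_append [simp]: "pair_ends (M @ N) = pair_ends M @ pair_ends N"
  by (induction M rule: pair_ends.induct) auto

lemma set_pair_ends: "set (pair_ends M) = fst ` set M \<union> snd ` set M"
  by (induction M rule: pair_ends.induct) auto

lemma keys_cls:
  assumes "keys P \<subseteq> mts X" "set (pair_ends M) \<subseteq> X" "distinct (pair_ends M)"
  shows "keys (cls M P) \<subseteq> mts (X - set (pair_ends M))"
  using assms
proof (induction M P arbitrary: X rule: cls.induct)
  case (2 x y M P)
  have "keys (cls M (cl x y P)) \<subseteq> mts ((X - {x, y}) - set (pair_ends M))"
    by (rule "2.IH"[OF keys_cl[OF "2.prems"(1)]]) (use "2.prems" in auto)
  moreover have "(X - {x, y}) - set (pair_ends M) = X - set (pair_ends ((x, y) # M))" by auto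
  ultimately show ?case by simp
qed simp

lemma cl_cls_commute:
  assumes "keys P \<subseteq> mts X" "set (pair_ends M) \<subseteq> X" "distinct (x # y # pair_ends M)"
  shows "cl x y (cls M P) = cls M (cl x y P)"
  using assms
proof (induction M P arbitrary: X rule: cls.induct)
  case (2 a b M P)
  have "cl x y (cls M (cl a b P)) = cls M (cl x y (cl a b P))"
    by (rule "2.IH"[OF keys_cl[OF "2.prems"(1)]]) (use "2.prems" in auto)
  also have "cl x y (cl a b P) = cl a b (cl x y P)"
    by (rule cl_commute[OF "2.prems"(1)]) (use "2.prems" in auto)
  finally show ?case by simp
qed simp

lemma cls_front:
  assumes "keys P \<subseteq> mts X" "set (pair_ends M) \<subseteq> X" "distinct (x # y # pair_ends M)"
  shows "cls (M @ (x, y) # N) P = cls (M @ N) (cl x y P)"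
  using cl_cls_commute[OF assms] by (simp add: cls_append)

lemma cls_perm:
  assumes "mset M = mset N" "keys P \<subseteq> mts X" "set (pair_ends M) \<subseteq> X" "distinct (pair_ends M)" "distinct (pair_ends N)"
  shows "cls M P = cls N P"
  using assms
proof (induction M P arbitrary: X N rule: cls.induct)
  case (2 x y M P)
  then have "(x, y) \<in> set N" by (metis list.set_intros(1) set_mset_mset)
  then obtain N1 N2 where N: "N = N1 @ (x, y) # N2" by (auto dest: split_list)
  have m: "mset M = mset (N1 @ N2)" using "2.prems"(1) N by simp
  have sub: "set (pair_ends N) \<subseteq> X"
    using "2.prems"(3) unfolding set_pair_ends mset_eq_setD[OF "2.prems"(1)] .
  have "cls N P = cls (N1 @ N2) (cl x y P)"
    unfolding N by (rule cls_front[OF "2.prems"(2)]) (use sub "2.prems"(5) N in auto)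
  also have "\<dots> = cls M (cl x y P)"
    by (rule "2.IH"[OF m keys_cl[OF "2.prems"(2)], symmetric]) (use "2.prems" N in auto)
  finally show ?case by simp
qed simp

lemma cls_swap_pairs:
  assumes "keys P \<subseteq> mts X" "set (pair_ends M) \<subseteq> X" "distinct (pair_ends M)"
  shows "cls (map prod.swap M) P = cls M P"
  using assms
proof (induction M P arbitrary: X rule: cls.induct)
  case (2 x y M P)
  have "cls (map prod.swap M) (cl x y P) = cls M (cl x y P)"
    by (rule "2.IH"[OF keys_cl[OF "2.prems"(1)]]) (use "2.prems" in auto)
  then show ?case using cl_sym[OF "2.prems"(1), of x y] by simp
qed simp

subsection \<open>Adding a strand\<close>

definition add_strand :: "'e \<Rightarrow> 'e \<Rightarrow> 'e elem \<Rightarrow> 'e elem" where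
  "add_strand x y = push (\<lambda>\<sigma>. \<sigma>(x := y, y := x)) (\<lambda>_. 1)"

lemma alt_add_strand:
  assumes "alt inp (us @ vs) \<kappa> P" "x \<notin> set (us @ vs)" "y \<notin> set (us @ vs)" "x \<noteq> y" "inp x \<noteq> inp y"
  shows "alt inp (us @ x # y # vs) (\<kappa> - of_bool (inp y)) (add_strand x y P)"
  unfolding add_strand_def by (rule alt_push[OF assms(1)], rule ncw.Ins) (use assms in auto)

lemma cl_add_strand:
  assumes "keys P \<subseteq> mts X" "x \<notin> X" "y \<notin> X" "a \<in> X" "b \<in> X"
  shows "cl a b (add_strand x y P) = add_strand x y (cl a b P)"
  unfolding cl_def add_strand_def push_push
proof (rule push_cong)
  fix \<sigma> assume "\<sigma> \<in> keys P"
  then have s: "\<sigma> \<in> mts X" using assms by auto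
  have "\<sigma> a \<noteq> x" "\<sigma> a \<noteq> y" "\<sigma> b \<noteq> x" "\<sigma> b \<noteq> y" using mtsD(1)[OF s] assms by metis+
  then show "(close_matching a b \<circ> (\<lambda>\<sigma>. \<sigma>(x := y, y := x))) \<sigma> = ((\<lambda>\<sigma>. \<sigma>(x := y, y := x)) \<circ> close_matching a b) \<sigma>"
    using assms by (auto simp: close_matching_def fun_eq_iff)
  show "1 * (if (\<sigma>(x := y, y := x)) a = b then loop_value else 1) = (if \<sigma> a = b then loop_value else 1) * 1"
    using assms by auto
qed

lemma cls_add_strand:
  assumes "keys P \<subseteq> mts X" "x \<notin> X" "y \<notin> X" "set (pair_ends M) \<subseteq> X" "distinct (pair_ends M)"
  shows "cls M (add_strand x y P) = add_strand x y (cls M P)"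
  using assms
proof (induction M P arbitrary: X rule: cls.induct)
  case (2 a b M P)
  have "cl a b (add_strand x y P) = add_strand x y (cl a b P)"
    by (rule cl_add_strand[OF "2.prems"(1-3)]) (use "2.prems" in auto)
  moreover have "cls M (add_strand x y (cl a b P)) = add_strand x y (cls M (cl a b P))"
    by (rule "2.IH"[OF keys_cl[OF "2.prems"(1)]]) (use "2.prems" in auto)
  ultimately show ?case by simp
qed simp

lemma join_add_strand:
  assumes "keys P \<subseteq> mts X" "x \<notin> X" "y \<notin> X"
  shows "join_matching (\<sigma>(x := y, y := x)) P = add_strand x y (join_matching \<sigma> P)"
  unfolding add_strand_def join_matching_def push_push
proof (rule push_cong)
  fix \<tau> assume "\<tau> \<in> keys P"
  then have "\<tau> x = x" "\<tau> y = y" using assms mtsD(4) by fast+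
  then show "\<tau> \<circ> (\<sigma>(x := y, y := x)) = ((\<lambda>\<sigma>. \<sigma>(x := y, y := x)) \<circ> (\<lambda>\<sigma>'. \<sigma>' \<circ> \<sigma>)) \<tau>"
    by (auto simp: fun_eq_iff)
qed simp

text \<open>A strand of the guest whose ends are glued to \<open>b\<close> and \<open>b'\<close> closes up the host.\<close>

lemma close_through_strand:
  assumes "keys P \<subseteq> mts X" "\<sigma> \<in> mts Y" "X \<inter> Y = {}" "x \<notin> X \<union> Y" "y \<notin> X \<union> Y" "x \<noteq> y"
    "b \<in> X" "b' \<in> X" "b \<noteq> b'"
  shows "cl b' x (cl b y (join_matching (\<sigma>(x := y, y := x)) P)) = join_matching \<sigma> (cl b b' P)"
  unfolding cl_def join_matching_def push_push
proof (rule push_cong)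
  fix \<tau> assume "\<tau> \<in> keys P"
  then have t: "\<tau> \<in> mts X" using assms by auto
  note ts = mtsD[OF t] and ss = mtsD[OF assms(2)]
  have 1: "\<tau> x = x" "\<tau> y = y" "\<sigma> x = x" "\<sigma> y = y" "\<sigma> b = b" "\<sigma> b' = b'"
    using ts(4) ss(4) assms by auto
  have 2: "\<tau> z = x \<longleftrightarrow> z = x" "\<tau> z = y \<longleftrightarrow> z = y" "\<sigma> z = x \<longleftrightarrow> z = x" "\<sigma> z = y \<longleftrightarrow> z = y"
    "\<sigma> z = b \<longleftrightarrow> z = b" "\<sigma> z = b' \<longleftrightarrow> z = b'" "\<tau> z = b \<longleftrightarrow> z = \<tau> b" "\<tau> z = b' \<longleftrightarrow> z = \<tau> b'" for z
    using 1 ts(3,6) ss(6) by metis+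
  have 3: "b \<noteq> x" "b \<noteq> y" "b' \<noteq> x" "b' \<noteq> y" "\<tau> b \<noteq> x" "\<tau> b \<noteq> y" "\<tau> b' \<noteq> x" "\<tau> b' \<noteq> y" "\<tau> b \<noteq> b" "\<tau> b' \<noteq> b'"
    using assms(4-9) 2(1,2) ts(2)[OF assms(7)] ts(2)[OF assms(8)] by auto
  have 4: "\<sigma> (\<tau> b) = \<tau> b" "\<sigma> (\<tau> b') = \<tau> b'" using ss(4) ts(1) assms by blast+
  have 5: "\<sigma> z = \<tau> b \<longleftrightarrow> z = \<tau> b" "\<sigma> z = \<tau> b' \<longleftrightarrow> z = \<tau> b'" for z using 4 ss(6) by metis+
  define p p' where p: "p = \<tau> b" "p' = \<tau> b'"
  define w where w_def: "w = \<tau> \<circ> (\<sigma>(x := y, y := x))"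
  have w: "w b = p" "w b' = p'" "w x = y" "w y = x" "x \<noteq> y" and w_else: "w z = (if z = x then y else if z = y then x else \<tau> (\<sigma> z))" for z
    using 1 3 assms(6) by (auto simp: w_def p)
  note w = w w_else
  have w2: "\<sigma> z = b \<longleftrightarrow> z = b" "\<sigma> z = b' \<longleftrightarrow> z = b'" "\<tau> (\<sigma> z) = b \<longleftrightarrow> z = p" "\<tau> (\<sigma> z) = b' \<longleftrightarrow> z = p'" for z
    using 2(5-8) 5 by (auto simp: p)
  have w3: "\<tau> (\<sigma> z) = x \<longleftrightarrow> z = x" "\<tau> (\<sigma> z) = y \<longleftrightarrow> z = y" for z using 2(1-4) by auto
  note w2 = w2 w3
  have pp: "p = b' \<longleftrightarrow> p' = b" "p \<noteq> p'" "p \<noteq> b" "p' \<noteq> b'" "p \<noteq> x" "p \<noteq> y" "p' \<noteq> x" "p' \<noteq> y"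
    using 3 ts(3,6) assms(9) unfolding p by metis+
  have ne: "b \<noteq> b'" "b \<noteq> x" "b \<noteq> y" "b' \<noteq> x" "b' \<noteq> y" using 3 assms(9) by auto
  show "(close_matching b' x \<circ> (close_matching b y \<circ> (\<lambda>\<sigma>'. \<sigma>' \<circ> \<sigma>(x := y, y := x)))) \<tau>
      = ((\<lambda>\<sigma>'. \<sigma>' \<circ> \<sigma>) \<circ> close_matching b b') \<tau>"
  proof
    fix z
    define v where "v = close_matching b y w"
    define t where t_def: "t = \<tau> (\<sigma> z)"
    have t: "t = b \<longleftrightarrow> z = p" "t = b' \<longleftrightarrow> z = p'" "t = x \<longleftrightarrow> z = x" "t = y \<longleftrightarrow> z = y"
      using w2[of z] unfolding t_def by auto
    have v1: "v b' = (if p' = b then x else p')"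
      unfolding v_def close_matching_def using w(1-5) pp ne by (smt (verit))
    have v2: "v x = p"
      unfolding v_def close_matching_def using w(1-5) pp ne by (smt (verit))
    have v3: "v z = (if z = b \<or> z = y then z else if z = x then p else if z = p then x else t)"
      unfolding v_def close_matching_def using w(1-5) w(6)[of z] pp ne t unfolding t_def by (smt (verit))
    note v = v1 v2 v3
    have L: "(close_matching b' x \<circ> (close_matching b y \<circ> (\<lambda>\<sigma>'. \<sigma>' \<circ> \<sigma>(x := y, y := x)))) \<tau> z =
        (if z = b' \<or> z = x then z else if v z = b' then v x else if v z = x then v b' else v z)"
      by (simp add: v_def w_def close_matching_def)
    have R: "((\<lambda>\<sigma>'. \<sigma>' \<circ> \<sigma>) \<circ> close_matching b b') \<tau> z =
        (if z = b \<or> z = b' then z else if z = p then p' else if z = p' then p else t)"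
      using w2[of z] by (auto simp: close_matching_def p t_def)
    show "(close_matching b' x \<circ> (close_matching b y \<circ> (\<lambda>\<sigma>'. \<sigma>' \<circ> \<sigma>(x := y, y := x)))) \<tau> z
      = ((\<lambda>\<sigma>'. \<sigma>' \<circ> \<sigma>) \<circ> close_matching b b') \<tau> z"
      unfolding L R v t_def[symmetric] using pp ne t w(5) by (smt (verit))
  qed
  show "1 * (if (\<tau> \<circ> \<sigma>(x := y, y := x)) b = y then loop_value else 1) *
      (if (close_matching b y \<circ> (\<lambda>\<sigma>'. \<sigma>' \<circ> \<sigma>(x := y, y := x))) \<tau> b' = x then loop_value else 1)
      = (if \<tau> b = b' then loop_value else 1) * 1"
  proof -
    have "w b = y \<longleftrightarrow> False" using w(1) pp by simp
    moreover have "close_matching b y w b' = x \<longleftrightarrow> \<tau> b = b'"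
      unfolding close_matching_def using w(1-5) pp ne p(1) by (smt (verit))
    ultimately show ?thesis unfolding w_def by simp
  qed
qed

text \<open>Only \<open>x\<close> is glued, so the strand carries the end \<open>b\<close> of the
  host on to \<open>y\<close>. As \<open>y\<close> stays free, no loop can arise.\<close>

lemma rename_through_strand:
  assumes "keys P \<subseteq> mts X" "\<sigma> \<in> mts Y" "X \<inter> Y = {}" "x \<notin> X \<union> Y" "y \<notin> X \<union> Y" "x \<noteq> y" "b \<in> X"
  shows "cl b x (join_matching (\<sigma>(x := y, y := x)) P) = join_matching \<sigma> (relabel X (id(b := y)) P)"
  unfolding cl_def join_matching_def relabel_def push_push
proof (rule push_cong)
  fix \<tau> assume "\<tau> \<in> keys P"
  then have t: "\<tau> \<in> mts X" using assms by auto
  note ts = mtsD[OF t] and ss = mtsD[OF assms(2)]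
  let ?f = "id(b := y)"
  have inj: "inj_on ?f X" using assms by (auto simp: inj_on_def)
  have 1: "\<tau> x = x" "\<tau> y = y" "\<sigma> x = x" "\<sigma> y = y" "\<sigma> b = b" using ts(4) ss(4) assms by auto
  have 2: "\<tau> z = x \<longleftrightarrow> z = x" "\<tau> z = y \<longleftrightarrow> z = y" "\<sigma> z = x \<longleftrightarrow> z = x" "\<sigma> z = y \<longleftrightarrow> z = y"
    "\<sigma> z = b \<longleftrightarrow> z = b" "\<tau> z = b \<longleftrightarrow> z = \<tau> b" for z
    using 1 ts(3,6) ss(6) by metis+
  have 3: "b \<noteq> x" "b \<noteq> y" "\<tau> b \<noteq> x" "\<tau> b \<noteq> y" "\<tau> b \<noteq> b"
    using assms(4-7) 2(1,2) ts(2)[OF assms(7)] by auto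
  have 4: "\<sigma> (\<tau> b) = \<tau> b" using ss(4) ts(1) assms by blast
  have 5: "\<sigma> z = \<tau> b \<longleftrightarrow> z = \<tau> b" for z using 4 ss(6) by metis
  have r: "relabel_matching X ?f \<tau> z =
      (if z = b then b else if z = y then \<tau> b else if \<tau> z = b then y else \<tau> z)" for z
  proof (cases "z \<in> ?f ` X")
    case True
    then obtain w where w: "w \<in> X" "z = ?f w" by auto
    then have "relabel_matching X ?f \<tau> z = ?f (\<tau> w)" using inj by (simp only: relabel_matching_image)
    then show ?thesis using w assms(5) 3 1 by auto
  next
    case False
    then have "relabel_matching X ?f \<tau> z = z" "z \<noteq> y" "z = b \<or> z \<notin> X" using assms(7) by (auto simp: image_iff)
    then show ?thesis using ts(4)[of z] assms(7) by auto
  qed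
  show "(close_matching b x \<circ> (\<lambda>\<sigma>'. \<sigma>' \<circ> \<sigma>(x := y, y := x))) \<tau>
      = ((\<lambda>\<sigma>'. \<sigma>' \<circ> \<sigma>) \<circ> relabel_matching X ?f) \<tau>"
  proof
    fix z
    define p t where d: "p = \<tau> b" "t = \<tau> (\<sigma> z)"
    have t: "t = b \<longleftrightarrow> z = p" "t = x \<longleftrightarrow> z = x" "t = y \<longleftrightarrow> z = y" "\<sigma> z = b \<longleftrightarrow> z = b" "\<sigma> z = y \<longleftrightarrow> z = y"
      using 2[of z] 2[of "\<sigma> z"] 5[of z] unfolding d by auto
    define w where w_def: "w = \<tau> \<circ> (\<sigma>(x := y, y := x))"
    have w: "w b = p" "w x = y" "w z = (if z = x then y else if z = y then x else t)"
      using 1 3 assms(6) by (auto simp: w_def d)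
    have L: "(close_matching b x \<circ> (\<lambda>\<sigma>'. \<sigma>' \<circ> \<sigma>(x := y, y := x))) \<tau> z =
        (if z = b \<or> z = x then z else if w z = b then w x else if w z = x then w b else w z)"
      by (simp add: w_def close_matching_def)
    have R: "((\<lambda>\<sigma>'. \<sigma>' \<circ> \<sigma>) \<circ> relabel_matching X ?f) \<tau> z =
        (if z = b then b else if z = y then p else if t = b then y else t)"
      using t(4,5) by (simp add: r d)
    show "(close_matching b x \<circ> (\<lambda>\<sigma>'. \<sigma>' \<circ> \<sigma>(x := y, y := x))) \<tau> z
      = ((\<lambda>\<sigma>'. \<sigma>' \<circ> \<sigma>) \<circ> relabel_matching X ?f) \<tau> z"
      unfolding L R w using t 3(1-4) assms(6) d(1) by (smt (verit))
  qed
  show "1 * (if (\<tau> \<circ> \<sigma>(x := y, y := x)) b = x then loop_value else 1) = 1 * 1"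
    using 1 2 3 by auto
qed

section \<open>Gluing two discs along a band\<close>

definition outs :: "('e \<Rightarrow> bool) \<Rightarrow> 'e list \<Rightarrow> int" where
  "outs inp xs = (\<Sum>x\<leftarrow>xs. of_bool (\<not> inp x))"

lemma outs_simps [simp]: "outs inp [] = 0" "outs inp (x # xs) = of_bool (\<not> inp x) + outs inp xs"
  "outs inp (xs @ ys) = outs inp xs + outs inp ys"
  by (simp_all add: outs_def)

text \<open>The discs are glued along \<open>bs\<close>: counterclockwise, the host reads \<open>map fst bs @ Y1\<close>
  and the guest \<open>rev (map snd bs) @ Y2\<close>, so that the result reads \<open>Y1 @ Y2\<close>.\<close>

lemma glue_matching:
  assumes "ncw inp L n \<tau>" "L = rev (map snd bs) @ Y2" "scoh inp (map fst bs @ Y1) \<kappa> P"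
    "Y1 \<noteq> []" "distinct (map fst bs @ Y1 @ L)" "\<And>b b'. (b, b') \<in> set bs \<Longrightarrow> inp b \<noteq> inp b'"
  shows "alt inp (Y1 @ Y2) (\<kappa> - n + outs inp (map fst bs)) (cls bs (join_matching \<tau> P)) \<and>
    (Y2 = [] \<longrightarrow> scoh inp Y1 (\<kappa> - n + outs inp (map fst bs)) (cls bs (join_matching \<tau> P)))"
  using assms
proof (induction arbitrary: bs Y1 Y2 \<kappa> P rule: ncw.induct)
  case Nil
  then have "bs = []" "Y2 = []" by auto
  moreover have "join_matching id P = P" by (simp add: join_matching_def push_ident)
  ultimately show ?case using Nil.prems(2) scoh_alt[OF Nil.prems(2)] by (simp del: id_apply)
next
  case (Ins us vs n \<sigma> x y)
  note keys = scoh_keys[OF Ins.prems(2)]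
  note sY = ncw_mts[OF Ins.hyps(1)]
  let ?X = "set (map fst bs @ Y1)"
  have disj: "?X \<inter> set (us @ vs) = {}" and xX: "x \<notin> ?X" and yX: "y \<notin> ?X"
    using Ins.prems(4) by auto
  \<comment> \<open>The strand inserted last has neighbouring ends. So a strand with exactly one
    glued end must sit where the band ends and \<open>Y2\<close> begins.\<close>
  consider (bridge) w where "rev (map snd bs) = us @ x # y # w" "vs = w @ Y2"
    | (junction) "rev (map snd bs) = us @ [x]" "Y2 = y # vs"
    | (free) w where "us = rev (map snd bs) @ w" "Y2 = w @ x # y # vs"
  proof -
    from Ins.prems(1) consider w where "us = rev (map snd bs) @ w" "w @ x # y # vs = Y2"
      | w where "rev (map snd bs) = us @ w" "x # y # vs = w @ Y2"
      unfolding append_eq_append_conv2 by metis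
    then show thesis
    proof cases
      case (2 w)
      then consider "w = []" | a where "w = [a]" | a b w' where "w = a # b # w'"
        by (metis neq_Nil_conv)
      then show thesis by cases (use 2 that in auto)
    qed (use that in auto)
  qed
  then show ?case
  proof cases
    case (bridge w)
    then have "map snd bs = rev w @ y # x # rev us"
      by (metis append.assoc append_Cons append_Nil rev.simps(2) rev_append rev_swap)
    then obtain B1 B2 b b' where bs: "bs = B1 @ (b, y) # (b', x) # B2"
      "map snd B1 = rev w" "map snd B2 = rev us"
      by (auto simp: map_eq_append_conv map_eq_Cons_conv)
    have opp: "inp b \<noteq> inp y" "inp b' \<noteq> inp x" using Ins.prems(5) bs by auto
    have X: "b \<in> ?X" "b' \<in> ?X" "b \<noteq> b'" using Ins.prems(4) bs(1) by auto
    let ?P = "cl b b' P" and ?B = "B1 @ B2"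
    \<comment> \<open>The ends \<open>Y1\<close> outside the band guarantee that something is left,
      so this closure of the host is among those that \<open>scoh\<close> controls.\<close>
    have sc: "scoh inp (map fst ?B @ Y1) (\<kappa> + of_bool (inp b)) ?P"
      using scoh_close[OF Ins.prems(2), of "map fst B1" b b' "map fst B2 @ Y1"]
        bs(1) Ins.prems(3) opp Ins.hyps(5) by auto
    have IH: "alt inp (Y1 @ Y2) (\<kappa> + of_bool (inp b) - n + outs inp (map fst ?B)) (cls ?B (join_matching \<sigma> ?P)) \<and>
      (Y2 = [] \<longrightarrow> scoh inp Y1 (\<kappa> + of_bool (inp b) - n + outs inp (map fst ?B)) (cls ?B (join_matching \<sigma> ?P)))"
    proof (rule Ins.IH[OF _ sc Ins.prems(3)])
      show "us @ vs = rev (map snd ?B) @ Y2" using bs bridge by simp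
      show "distinct (map fst ?B @ Y1 @ us @ vs)" using Ins.prems(4) bs by auto
    qed (use Ins.prems(5) bs in auto)
    define E where "E = join_matching (\<sigma>(x := y, y := x)) P"
    define W where "W = ?X \<union> insert x (insert y (set (us @ vs)))"
    have "\<sigma>(x := y, y := x) \<in> mts (set (us @ x # y # vs))"
      by (rule ncw_mts[OF ncw.Ins[OF Ins.hyps(1-5)]])
    then have Ek: "keys E \<subseteq> mts W"
      using keys_join_matching[OF keys, of _ "set (us @ x # y # vs)"] disj xX yX by (simp add: E_def W_def Un_commute insert_commute)
    have subs: "set (pair_ends B1) \<subseteq> W - {b, y, b', x}"
    proof -
      have "set (pair_ends B1) = set (map fst B1) \<union> set (map snd B1)" by (simp add: set_pair_ends)
      then show ?thesis unfolding bs(2) using Ins.prems(4) bs(1) bridge(2) by (auto simp: W_def)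
    qed
    have distB: "distinct (pair_ends B1)"
    proof -
      have "distinct (map fst B1)" "distinct (map snd B1)" "set (map fst B1) \<inter> set (map snd B1) = {}"
        using Ins.prems(4) bs bridge(2) by auto
      then show ?thesis
        by (induction B1 rule: pair_ends.induct) (auto simp: set_pair_ends)
    qed
    have "cls bs E = cls B2 (cl b' x (cl b y (cls B1 E)))" by (simp add: bs(1) cls_append)
    also have "cl b y (cls B1 E) = cls B1 (cl b y E)"
      by (rule cl_cls_commute[OF Ek]) (use subs distB Ins.prems(4) bs(1) in auto)
    also have "cl b' x (cls B1 (cl b y E)) = cls B1 (cl b' x (cl b y E))"
      by (rule cl_cls_commute[OF keys_cl[OF Ek]])
        (use subs distB Ins.prems(4) Ins.hyps bs(1) X in \<open>auto simp: W_def\<close>)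
    also have "cl b' x (cl b y E) = join_matching \<sigma> ?P"
      unfolding E_def by (rule close_through_strand[OF keys sY disj])
        (use Ins.hyps xX yX X in auto)
    finally have eq: "cls bs E = cls ?B (join_matching \<sigma> ?P)" by (simp add: cls_append)
    \<comment> \<open>The closure of the host adds \<open>of_bool (inp b)\<close> and the guest
      strand subtracts \<open>of_bool (inp y)\<close>. Since \<open>b\<close> and \<open>y\<close>
      have opposite types, these differ by 1, which is what \<open>b\<close> and \<open>b'\<close>
      contribute to \<open>outs\<close>: exactly one of them is an out-point.\<close>
    have k: "\<kappa> + of_bool (inp b) - n + outs inp (map fst ?B) = \<kappa> - (n + of_bool (inp y)) + outs inp (map fst bs)"
      using bs(1) opp Ins.hyps(5) by auto
    show ?thesis using IH unfolding eq[unfolded E_def] k .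
  next
    case junction
    then have "map snd bs = x # rev us" by (metis rev.simps(2) rev_rev_ident rev_swap append_Nil rev_append)
    then obtain b B where bs: "bs = (b, x) # B" "map snd B = rev us" by auto
    have opp: "inp b \<noteq> inp x" using Ins.prems(5) bs by auto
    then have by_eq: "inp b = inp y" using Ins.hyps(5) by auto
    let ?f = "id(b := y)"
    let ?P = "relabel ?X ?f P"
    have map_id: "map ?f zs = zs" if "b \<notin> set zs" for zs
      using that by (induction zs) auto
    have "scoh inp (map ?f (map fst bs @ Y1)) \<kappa> ?P"
      by (rule scoh_relabel[OF Ins.prems(2)]) (use yX by_eq in \<open>auto simp: inj_on_def\<close>)
    moreover have "map ?f (map fst bs @ Y1) = y # map fst B @ Y1"
      using map_id[of "map fst B @ Y1"] Ins.prems(4) bs(1) by auto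
    ultimately have "scoh inp (y # map fst B @ Y1) \<kappa> ?P" by simp
    \<comment> \<open>The prolonged end no longer belongs to the band. Rotation moves it behind
      \<open>Y1\<close>, where it precedes the rest of \<open>Y2\<close>.\<close>
    then have sc: "scoh inp (map fst B @ (Y1 @ [y])) (\<kappa> - sign_of inp y) ?P"
      using scoh_rotate by fastforce
    have IH: "alt inp ((Y1 @ [y]) @ vs) (\<kappa> - sign_of inp y - n + outs inp (map fst B)) (cls B (join_matching \<sigma> ?P))"
      by (rule conjunct1[OF Ins.IH[OF _ sc]])
        (use bs junction Ins.prems(4,5) Ins.hyps in auto)
    have "cl b x (join_matching (\<sigma>(x := y, y := x)) P) = join_matching \<sigma> ?P"
      by (rule rename_through_strand[OF keys sY disj]) (use Ins.hyps xX yX bs in auto)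
    then have eq: "cls bs (join_matching (\<sigma>(x := y, y := x)) P) = cls B (join_matching \<sigma> ?P)"
      by (simp add: bs(1) del: fun_upd_apply)
    have k: "\<kappa> - sign_of inp y - n + outs inp (map fst B) = \<kappa> - (n + of_bool (inp y)) + outs inp (map fst bs)"
      using bs(1) by_eq by (auto simp: sign_of_def)
    show ?thesis using IH junction unfolding eq k by simp
  next
    case (free w)
    \<comment> \<open>As \<open>Y2\<close> is nonempty here, only signs are claimed. For a single
      guest matching more would be false in general: closing the new strand multiplies by
      \<open>loop_value\<close>, which lies in no cone.\<close>
    have IH: "alt inp (Y1 @ w @ vs) (\<kappa> - n + outs inp (map fst bs)) (cls bs (join_matching \<sigma> P))"
      by (rule conjunct1[OF Ins.IH[OF _ Ins.prems(2,3)]]) (use free Ins.prems(4,5) in auto)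
    have "alt inp ((Y1 @ w) @ x # y # vs) (\<kappa> - n + outs inp (map fst bs) - of_bool (inp y))
        (add_strand x y (cls bs (join_matching \<sigma> P)))"
      by (rule alt_add_strand) (use IH xX yX Ins.hyps free in auto)
    moreover have "cls bs (join_matching (\<sigma>(x := y, y := x)) P) = add_strand x y (cls bs (join_matching \<sigma> P))"
      unfolding join_add_strand[OF keys xX yX]
    proof (rule cls_add_strand[OF keys_join_matching[OF keys sY disj]])
      show "set (pair_ends bs) \<subseteq> ?X \<union> set (us @ vs)"
        using free(1) by (auto simp: set_pair_ends)
      have "distinct (map fst bs)" "distinct (map snd bs)" "set (map fst bs) \<inter> set (map snd bs) = {}"
        using Ins.prems(4) free(1) by auto
      then show "distinct (pair_ends bs)"
        by (induction bs rule: pair_ends.induct) (auto simp: set_pair_ends)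
    qed (use Ins.hyps xX yX in auto)
    moreover have "\<kappa> - n + outs inp (map fst bs) - of_bool (inp y) = \<kappa> - (n + of_bool (inp y)) + outs inp (map fst bs)"
      by simp
    ultimately show ?thesis using free by (simp del: fun_upd_apply)
  qed
qed

lemma alt_sum: "(\<And>i. i \<in> I \<Longrightarrow> alt inp xs \<kappa> (f i)) \<Longrightarrow> alt inp xs \<kappa> (sum f I)"
  by (induction I rule: infinite_finite_induct) (auto intro: alt_add)

lemma distinct_pair_ends:
  "distinct (map fst M @ map snd M) \<Longrightarrow> distinct (pair_ends M)"
  by (induction M rule: pair_ends.induct) (auto simp: set_pair_ends)

text \<open>A guest smoothing of weight n lowers the offset of the glued host by n, and its
  coefficient lies in the cone of index \<mu> + n. The weights cancel, so all terms share one offset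
  and may be added.\<close>

lemma glue_host:
  assumes P: "scoh inp (map fst bs @ Y1) \<kappa> P" and Q: "alt inp (rev (map snd bs) @ Y2) \<mu> Q"
    and Y1: "Y1 \<noteq> []" and dist: "distinct (map fst bs @ Y1 @ rev (map snd bs) @ Y2)"
    and opp: "\<And>b b'. (b, b') \<in> set bs \<Longrightarrow> inp b \<noteq> inp b'"
  shows "alt inp (Y1 @ Y2) (\<kappa> + \<mu> + outs inp (map fst bs)) (cls bs (tensor P Q)) \<and>
    (Y2 = [] \<longrightarrow> scoh inp Y1 (\<kappa> + \<mu> + outs inp (map fst bs)) (cls bs (tensor P Q)))"
proof -
  have "alt inp (Y1 @ Y2) (\<kappa> + \<mu> + outs inp (map fst bs)) (scale (lookup Q \<tau>) (cls bs (join_matching \<tau> P))) \<and>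
    (Y2 = [] \<longrightarrow> scoh inp Y1 (\<kappa> + \<mu> + outs inp (map fst bs)) (scale (lookup Q \<tau>) (cls bs (join_matching \<tau> P))))"
    if "\<tau> \<in> keys Q" for \<tau>
  proof -
    obtain n where n: "ncw inp (rev (map snd bs) @ Y2) n \<tau>" "cone (\<mu> + n) (lookup Q \<tau>)"
      using altE[OF Q \<open>\<tau> \<in> keys Q\<close>] by blast
    have g: "alt inp (Y1 @ Y2) (\<kappa> - n + outs inp (map fst bs)) (cls bs (join_matching \<tau> P)) \<and>
      (Y2 = [] \<longrightarrow> scoh inp Y1 (\<kappa> - n + outs inp (map fst bs)) (cls bs (join_matching \<tau> P)))"
      by (rule glue_matching[OF n(1) refl P Y1 dist opp])
    have k: "\<kappa> - n + outs inp (map fst bs) + (\<mu> + n) = \<kappa> + \<mu> + outs inp (map fst bs)" by simp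
    show ?thesis
      using g alt_scale[OF _ n(2), of inp "Y1 @ Y2" "\<kappa> - n + outs inp (map fst bs)"]
        scoh_scale[OF _ n(2), of inp "Y1" "\<kappa> - n + outs inp (map fst bs)"]
      unfolding k by blast
  qed
  then show ?thesis
    unfolding tensor_def cls_sum cls_scale
    by (intro conjI impI scoh_sum alt_sum) auto
qed

text \<open>Closures of a join are joins. Two ends of the same disc can be closed in that disc
  beforehand, and two ends on either side of a junction form a further pair of the band, at its
  front or at its back. So the induction runs over all band widths at once. A nonempty band ensures
  that a disc closed beforehand still has an end.\<close>

lemma scoh_join:
  assumes "scoh inp (map fst bs @ Y1) \<kappa> P" "scoh inp (rev (map snd bs) @ Y2) \<mu> Q"
    and "bs \<noteq> []" "Y1 @ Y2 \<noteq> []" "distinct (map fst bs @ Y1 @ rev (map snd bs) @ Y2)"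
    and "\<And>b b'. (b, b') \<in> set bs \<Longrightarrow> inp b \<noteq> inp b'"
  shows "scoh inp (Y1 @ Y2) (\<kappa> + \<mu> + outs inp (map fst bs)) (cls bs (tensor P Q))"
  using assms
proof (induction "length (Y1 @ Y2)" arbitrary: bs Y1 Y2 \<kappa> \<mu> P Q rule: less_induct)
  case less
  note P = less.prems(1) and Q = less.prems(2) and ne = less.prems(3,4) and dist = less.prems(5) and opp = less.prems(6)
  let ?X = "set (map fst bs @ Y1)" and ?Y = "set (rev (map snd bs) @ Y2)"
  let ?k = "\<kappa> + \<mu> + outs inp (map fst bs)"
  note kP = scoh_keys[OF P] and kQ = scoh_keys[OF Q]
  have disj: "?X \<inter> ?Y = {}" using dist by auto
  have dE: "distinct (pair_ends bs)" by (rule distinct_pair_ends) (use dist in auto)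
  have sE: "set (pair_ends bs) \<subseteq> ?X \<union> ?Y" by (auto simp: set_pair_ends)
  note kT = keys_tensor[OF kP kQ disj]
  let ?Z = "cls bs (tensor P Q)"

  \<comment> \<open>The same curve with host and guest exchanged: seen from the other disc, the band
    is traversed backwards and every pair is reversed.\<close>
  have swapped: "alt inp (Y2 @ Y1) (\<mu> + \<kappa> + outs inp (map snd bs)) ?Z \<and>
      (Y1 = [] \<longrightarrow> scoh inp Y2 (\<mu> + \<kappa> + outs inp (map snd bs)) ?Z)" if "Y2 \<noteq> []"
  proof -
    let ?bs = "rev (map prod.swap bs)"
    have m: "map fst ?bs = rev (map snd bs)" "rev (map snd ?bs) = map fst bs"
      by (simp_all add: rev_map o_def)
    have "alt inp (Y2 @ Y1) (\<mu> + \<kappa> + outs inp (map fst ?bs)) (cls ?bs (tensor Q P)) \<and>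
      (Y1 = [] \<longrightarrow> scoh inp Y2 (\<mu> + \<kappa> + outs inp (map fst ?bs)) (cls ?bs (tensor Q P)))"
      by (rule glue_host) (use m Q scoh_alt[OF P] that dist opp in auto)
    moreover have "outs inp (map fst ?bs) = outs inp (map snd bs)"
      unfolding m by (simp add: outs_def rev_map[symmetric])
    moreover have "cls ?bs (tensor Q P) = ?Z"
    proof -
      have s: "set (pair_ends (map prod.swap bs)) = set (pair_ends bs)"
        by (simp add: set_pair_ends image_image Un_commute)
      have d: "distinct (pair_ends (map prod.swap bs))" "distinct (pair_ends ?bs)"
        by (rule distinct_pair_ends; use dist in \<open>auto simp: rev_map[symmetric] comp_def\<close>)+
      have "cls ?bs (tensor P Q) = cls (map prod.swap bs) (tensor P Q)"
        by (rule cls_perm[OF _ kT, symmetric]) (use s sE d in auto)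
      also have "\<dots> = ?Z" by (rule cls_swap_pairs[OF kT sE dE])
      finally show ?thesis using tensor_commute[OF kP kQ disj] by simp
    qed
    ultimately show ?thesis by simp
  qed

  have alt: "alt inp (Y1 @ Y2) ?k ?Z"
  proof (cases "Y1 = []")
    case False
    then show ?thesis using glue_host[OF P scoh_alt[OF Q] _ dist opp] by blast
  next
    case True
    then have "Y2 \<noteq> []" using ne by auto
    show ?thesis
    \<comment> \<open>The two offsets agree only because the signs of the ends of the guest add up
      to 0. This needs one smoothing of these ends, which a nonzero \<open>Q\<close>
      provides.\<close>
    proof (cases "Q = 0")
      case True
      then show ?thesis by (simp add: tensor_def)
    next
      case False
      then obtain \<tau> n where "ncw inp (rev (map snd bs) @ Y2) n \<tau>"
        using scoh_alt[OF Q] altE by (metis all_not_in_conv keys_eq_empty)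
      from ncw_balanced[OF this]
      have "(\<Sum>x\<leftarrow>Y2. sign_of inp x) = - (\<Sum>x\<leftarrow>map snd bs. sign_of inp x)" by (simp add: rev_map[symmetric])
      moreover have "outs inp (map snd bs) + (\<Sum>x\<leftarrow>map snd bs. sign_of inp x) = outs inp (map fst bs)"
        using opp
      proof (induction bs)
        case (Cons p bs)
        obtain b b' where p: "p = (b, b')" by (cases p)
        have "inp b \<noteq> inp b'" using Cons.prems[of b b'] p by simp
        then show ?case using Cons p by (auto simp: sign_of_def)
      qed simp
      ultimately have k: "\<mu> + \<kappa> + outs inp (map snd bs) - (\<Sum>x\<leftarrow>Y2. sign_of inp x) = ?k" by simp
      show ?thesis using alt_rotates[OF conjunct1[OF swapped[OF \<open>Y2 \<noteq> []\<close>]]] unfolding k .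
    qed
  qed

  \<comment> \<open>If one disc has no end outside the band, it is absorbed entirely, and the
    coherence of the other disc gives that of the result. Only if both sides are nonempty are
    closures treated recursively.\<close>
  consider "Y2 = []" | "Y1 = []" "Y2 \<noteq> []" | "Y1 \<noteq> []" "Y2 \<noteq> []" using ne by auto
  then show ?case
  proof cases
    case 1
    then show ?thesis using glue_host[OF P scoh_alt[OF Q] _ dist opp] ne by auto
  next
    case 2
    then have "scoh inp Y2 (\<mu> + \<kappa> + outs inp (map snd bs)) ?Z" using swapped by blast
    then show ?thesis using scoh_change alt 2 by (metis append_Nil)
  next
    case 3
    show ?thesis
    proof (rule scohI[OF alt])
      fix us x y vs assume *: "Y1 @ Y2 = us @ x # y # vs" "us @ vs \<noteq> []" "inp x \<noteq> inp y"
      have len: "length (us @ vs) < length (Y1 @ Y2)" using *(1) by simp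
      have xy: "x \<in> ?X \<union> ?Y" "y \<in> ?X \<union> ?Y" "distinct (x # y # pair_ends bs)"
      proof -
        have "x \<in> set (Y1 @ Y2)" "y \<in> set (Y1 @ Y2)" unfolding *(1) by auto
        then have "x \<in> set Y1 \<union> set Y2" "y \<in> set Y1 \<union> set Y2" by auto
        moreover have "distinct (us @ x # y # vs)" using dist unfolding *(1)[symmetric] by auto
        ultimately show "x \<in> ?X \<union> ?Y" "y \<in> ?X \<union> ?Y" "distinct (x # y # pair_ends bs)"
          using dE dist by (auto simp: set_pair_ends)
      qed
      have comm: "cl x y ?Z = cls bs (cl x y (tensor P Q))"
        by (rule cl_cls_commute[OF kT sE xy(3)])
      consider (left) w where "Y1 = us @ x # y # w" "vs = w @ Y2"
        | (mid) "Y1 = us @ [x]" "Y2 = y # vs"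
        | (right) w where "us = Y1 @ w" "Y2 = w @ x # y # vs"
      proof -
        from *(1) consider w where "us = Y1 @ w" "w @ x # y # vs = Y2"
          | w where "Y1 = us @ w" "x # y # vs = w @ Y2"
          unfolding append_eq_append_conv2 by metis
        then show thesis
        proof cases
          case (2 w)
          then consider "w = []" | a where "w = [a]" | a b w' where "w = a # b # w'"
            by (metis neq_Nil_conv)
          then show thesis by cases (use 2 that in auto)
        qed (use that in auto)
      qed
      then show "scoh inp (us @ vs) (?k + of_bool (inp x)) (cl x y ?Z)"
      proof cases
        case (left w)
        have "scoh inp ((map fst bs @ us) @ w) (\<kappa> + of_bool (inp x)) (cl x y P)"
          by (rule scoh_close[OF P]) (use left ne * in auto)
        then have sc: "scoh inp (map fst bs @ (us @ w)) (\<kappa> + of_bool (inp x)) (cl x y P)" by simp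
        have "scoh inp ((us @ w) @ Y2) (\<kappa> + of_bool (inp x) + \<mu> + outs inp (map fst bs)) (cls bs (tensor (cl x y P) Q))"
          by (rule less.hyps[OF _ sc Q]) (use left ne dist opp * in auto)
        moreover have "cl x y (tensor P Q) = tensor (cl x y P) Q"
          by (rule cl_tensor_left[OF kP kQ disj]) (use left xy in auto)
        moreover have "\<kappa> + of_bool (inp x) + \<mu> + outs inp (map fst bs) = ?k + of_bool (inp x)" by simp
        ultimately show ?thesis unfolding comm using left by (simp only: append_assoc)
      next
        case (right w)
        have "scoh inp ((rev (map snd bs) @ w) @ vs) (\<mu> + of_bool (inp x)) (cl x y Q)"
          by (rule scoh_close[OF Q]) (use right ne * in auto)
        then have sc: "scoh inp (rev (map snd bs) @ (w @ vs)) (\<mu> + of_bool (inp x)) (cl x y Q)" by simp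
        have "scoh inp (Y1 @ (w @ vs)) (\<kappa> + (\<mu> + of_bool (inp x)) + outs inp (map fst bs)) (cls bs (tensor P (cl x y Q)))"
          by (rule less.hyps[OF _ P sc]) (use right ne dist opp * in auto)
        moreover have "cl x y (tensor P Q) = tensor P (cl x y Q)"
          by (rule cl_tensor_right[OF kP kQ disj]) (use right xy in auto)
        moreover have "\<kappa> + (\<mu> + of_bool (inp x)) + outs inp (map fst bs) = ?k + of_bool (inp x)" by simp
        ultimately show ?thesis unfolding comm using right by (simp only: append_assoc)
      next
        case mid
        \<comment> \<open>The ends \<open>x\<close> and \<open>y\<close> face each other across the
          junction behind \<open>Y1\<close>. They become the first pair of the band, for which
          \<open>x\<close> is rotated to the front of the host.\<close>
        have sP: "scoh inp (map fst ((x, y) # bs) @ us) (\<kappa> + sign_of inp x) P"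
          using scoh_rotate'[of inp "map fst bs @ us" x \<kappa> P] P mid by simp
        have sQ: "scoh inp (rev (map snd ((x, y) # bs)) @ vs) \<mu> Q" using Q mid by simp
        have "scoh inp (us @ vs) (\<kappa> + sign_of inp x + \<mu> + outs inp (map fst ((x, y) # bs))) (cls ((x, y) # bs) (tensor P Q))"
          by (rule less.hyps[OF _ sP sQ]) (use mid ne dist opp * in auto)
        moreover have "\<kappa> + sign_of inp x + \<mu> + outs inp (map fst ((x, y) # bs)) = ?k + of_bool (inp x)"
          by (auto simp: sign_of_def)
        ultimately show ?thesis unfolding comm by (simp only: cls.simps)
      qed
    next
      fix us x y assume *: "Y1 @ Y2 = y # us @ [x]" "us \<noteq> []" "inp x \<noteq> inp y"
      obtain U where U: "Y1 = y # U" using 3 * by (cases Y1) auto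
      obtain V where V: "Y2 = V @ [x]" using 3 * U by (cases Y2 rule: rev_cases) auto
      have us: "us = U @ V" using * U V by simp
      have xy: "distinct (y # x # pair_ends bs)"
        using dE dist U V by (auto simp: set_pair_ends)
      \<comment> \<open>At the other junction the wrap-around pair extends the band at its far end;
        now \<open>y\<close> is on the host, which explains the exchange of \<open>x\<close> and
        \<open>y\<close>.\<close>
      have "cl x y ?Z = cl y x ?Z"
        by (rule cl_sym[OF keys_cls[OF kT sE dE]])
      also have "\<dots> = cls bs (cl y x (tensor P Q))"
        by (rule cl_cls_commute[OF kT sE xy])
      also have "\<dots> = cls (bs @ [(y, x)]) (tensor P Q)"
        using cl_cls_commute[OF kT sE xy] by (simp add: cls_append)
      finally have comm: "cl x y ?Z = cls (bs @ [(y, x)]) (tensor P Q)" .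
      have sP: "scoh inp (map fst (bs @ [(y, x)]) @ U) \<kappa> P" using P U by simp
      have sQ: "scoh inp (rev (map snd (bs @ [(y, x)])) @ V) (\<mu> + sign_of inp x) Q"
        using scoh_rotate'[of inp "rev (map snd bs) @ V" x \<mu> Q] Q V by simp
      have "scoh inp (U @ V) (\<kappa> + (\<mu> + sign_of inp x) + outs inp (map fst (bs @ [(y, x)]))) (cls (bs @ [(y, x)]) (tensor P Q))"
        by (rule less.hyps[OF _ sP sQ]) (use U V us ne dist opp * in auto)
      moreover have "\<kappa> + (\<mu> + sign_of inp x) + outs inp (map fst (bs @ [(y, x)])) = ?k + sign_of inp x + of_bool (inp x)"
        using *(3) by auto
      ultimately show "scoh inp us (?k + sign_of inp x + of_bool (inp x)) (cl x y ?Z)"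
        unfolding comm us by (simp only:)
    qed
  qed
qed

section \<open>Counting orbits\<close>

definition graph_of :: "'a set \<Rightarrow> ('a \<Rightarrow> 'a) \<Rightarrow> 'a rel" where
  "graph_of A \<phi> = {(x, \<phi> x) | x. x \<in> A}"

lemma rtrancl_stays: "(x, y) \<in> r\<^sup>* \<Longrightarrow> x \<in> A \<Longrightarrow> r \<subseteq> A \<times> A \<Longrightarrow> y \<in> A"
  by (induction rule: rtrancl_induct) auto

lemma quotient_class:
  assumes "equiv A R" "C \<in> A // R" "a \<in> C"
  shows "C = R `` {a}"
proof -
  from assms(2) obtain x where x: "C = R `` {x}" by (rule quotientE)
  then have "(x, a) \<in> R" using assms(3) by simp
  then show ?thesis using equiv_class_eq[OF assms(1)] x by simp
qed

text \<open>A class that meets \<open>B\<close> is recovered from its trace on \<open>B\<close>.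
  With \<open>Y\<close> empty this compares orbits; with \<open>Y\<close> the boundary ends it
  counts the components that avoid the boundary, that is, the loops.\<close>

lemma card_quotient_restrict:
  assumes A: "equiv A R" and fin: "finite A" and B: "B \<subseteq> A" and Y: "Y \<subseteq> B"
  shows "card {C \<in> B // (R \<inter> B \<times> B). C \<inter> Y = {}} = card {C \<in> A // R. C \<inter> B \<noteq> {} \<and> C \<inter> Y = {}}"
proof -
  let ?R = "R \<inter> B \<times> B"
  have cls: "?R `` {x} = R `` {x} \<inter> B" if "x \<in> B" for x
    using that by auto
  have "bij_betw (\<lambda>C. C \<inter> B) {C \<in> A // R. C \<inter> B \<noteq> {} \<and> C \<inter> Y = {}} {C \<in> B // ?R. C \<inter> Y = {}}"
    unfolding bij_betw_def
  proof (rule conjI, rule inj_onI, rule_tac [2] equalityI, rule_tac [2] subsetI, rule_tac [3] subsetI)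
    fix C C' assume *: "C \<in> {C \<in> A // R. C \<inter> B \<noteq> {} \<and> C \<inter> Y = {}}"
      "C' \<in> {C \<in> A // R. C \<inter> B \<noteq> {} \<and> C \<inter> Y = {}}" "C \<inter> B = C' \<inter> B"
    then have "C \<inter> C' \<noteq> {}" by auto
    then show "C = C'" using quotient_disj[OF A, of C C'] * by auto
  next
    fix D assume "D \<in> (\<lambda>C. C \<inter> B) ` {C \<in> A // R. C \<inter> B \<noteq> {} \<and> C \<inter> Y = {}}"
    then obtain C where C: "D = C \<inter> B" "C \<in> A // R" "C \<inter> B \<noteq> {}" "C \<inter> Y = {}" by auto
    then obtain x where x: "x \<in> C" "x \<in> B" by auto
    have "C = R `` {x}" by (rule quotient_class[OF A C(2) x(1)])
    then have "D = ?R `` {x}" using C(1) cls[OF x(2)] by simp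
    then show "D \<in> {C \<in> B // ?R. C \<inter> Y = {}}" using C(4) C(1) x(2) by (auto intro: quotientI)
  next
    fix D assume "D \<in> {C \<in> B // ?R. C \<inter> Y = {}}"
    then obtain x where x: "x \<in> B" "D = ?R `` {x}" "D \<inter> Y = {}" by (auto elim: quotientE)
    then have D: "D = R `` {x} \<inter> B" using cls by simp
    have "x \<in> R `` {x}" using x(1) B A by (auto simp: equiv_def refl_on_def)
    then have "R `` {x} \<in> {C \<in> A // R. C \<inter> B \<noteq> {} \<and> C \<inter> Y = {}}"
      using x B D Y by (auto intro: quotientI)
    then show "D \<in> (\<lambda>C. C \<inter> B) ` {C \<in> A // R. C \<inter> B \<noteq> {} \<and> C \<inter> Y = {}}" using D by blast
  qed
  then show ?thesis by (rule bij_betw_same_card[symmetric])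
qed

definition orbits :: "'a set \<Rightarrow> ('a \<Rightarrow> 'a) \<Rightarrow> 'a set set" where
  "orbits A \<phi> = A // (graph_of A \<phi>)\<^sup>*"

lemma graph_of_sub: "bij_betw \<phi> A A \<Longrightarrow> graph_of A \<phi> \<subseteq> A \<times> A"
  by (auto simp: graph_of_def bij_betw_def)

text \<open>The forward orbit of \<phi> x is finite and mapped injectively into itself, hence onto
  itself; so it contains the only preimage of \<phi> x, which is x. This is why forward reachability
  is already symmetric.\<close>

lemma orbit_back:
  assumes "bij_betw \<phi> A A" "finite A" "x \<in> A"
  shows "(\<phi> x, x) \<in> (graph_of A \<phi>)\<^sup>*"
proof -
  define T where "T = (graph_of A \<phi>)\<^sup>* `` {\<phi> x}"
  have px: "\<phi> x \<in> A" using assms by (auto simp: bij_betw_def)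
  have TA: "T \<subseteq> A" unfolding T_def using rtrancl_stays[OF _ px graph_of_sub[OF assms(1)]] by auto
  have "\<phi> ` T \<subseteq> T"
  proof
    fix y assume "y \<in> \<phi> ` T"
    then obtain t where t: "t \<in> T" "y = \<phi> t" by auto
    then have "(t, y) \<in> graph_of A \<phi>" using TA by (auto simp: graph_of_def)
    then show "y \<in> T" using t unfolding T_def by (auto intro: rtrancl_into_rtrancl)
  qed
  moreover have "inj_on \<phi> T" using assms(1) TA by (auto simp: bij_betw_def intro: inj_on_subset)
  moreover have "finite T" using TA assms(2) finite_subset by auto
  ultimately have "\<phi> ` T = T" by (metis endo_inj_surj)
  moreover have "\<phi> x \<in> T" by (auto simp: T_def)
  ultimately have "\<phi> x \<in> \<phi> ` T" by simp
  then obtain y where "y \<in> T" "\<phi> y = \<phi> x" by (metis imageE)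
  then have "y = x" using assms TA by (auto simp: bij_betw_def inj_on_def)
  then show ?thesis using \<open>y \<in> T\<close> by (auto simp: T_def)
qed

lemma orbits_equiv:
  assumes "bij_betw \<phi> A A" "finite A"
  shows "equiv A ((graph_of A \<phi>)\<^sup>* \<inter> A \<times> A)" "orbits A \<phi> = A // ((graph_of A \<phi>)\<^sup>* \<inter> A \<times> A)"
proof -
  let ?r = "graph_of A \<phi>"
  have "(y, x) \<in> ?r\<^sup>*" if "(x, y) \<in> ?r\<^sup>*" for x y
    using that
  proof (induction rule: rtrancl_induct)
    case (step y z)
    then have "(z, y) \<in> ?r\<^sup>*" using orbit_back[OF assms] by (auto simp: graph_of_def)
    then show ?case using step by auto
  qed auto
  then show "equiv A (?r\<^sup>* \<inter> A \<times> A)"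
    by (intro equivI) (auto simp: refl_on_def sym_def intro!: transI)
  have "?r\<^sup>* `` {x} = (?r\<^sup>* \<inter> A \<times> A) `` {x}" if "x \<in> A" for x
    using that rtrancl_stays[OF _ that graph_of_sub[OF assms(1)]] by auto
  then show "orbits A \<phi> = A // (?r\<^sup>* \<inter> A \<times> A)"
    unfolding orbits_def quotient_def by auto
qed

text \<open>The first-return map to the complement of \<open>x\<close>, that is, the permutation
  whose cycles arise by deleting \<open>x\<close>.\<close>

definition skip :: "'a \<Rightarrow> ('a \<Rightarrow> 'a) \<Rightarrow> 'a \<Rightarrow> 'a" where
  "skip x \<phi> = (\<lambda>u. if \<phi> u = x then \<phi> x else \<phi> u)"

lemma skip_bij:
  assumes "bij_betw \<phi> A A" "x \<in> A"
  shows "bij_betw (skip x \<phi>) (A - {x}) (A - {x})"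
proof (cases "\<phi> x = x")
  case True
  then have "\<phi> u \<noteq> x" if "u \<in> A - {x}" for u
    using assms that by (auto simp: bij_betw_def inj_on_def)
  then have "bij_betw (skip x \<phi>) (A - {x}) (A - {x}) \<longleftrightarrow> bij_betw \<phi> (A - {x}) (A - {x})"
    by (intro bij_betw_cong) (auto simp: skip_def)
  then show ?thesis using bij_betw_DiffI[OF assms(1), of "{x}" "{x}"] True assms(2) by auto
next
  case False
  have inj: "\<phi> a = \<phi> b \<longleftrightarrow> a = b" if "a \<in> A" "b \<in> A" for a b
    using assms(1) that by (auto simp: bij_betw_def inj_on_def)
  have im: "\<phi> a \<in> A" if "a \<in> A" for a using assms(1) that by (auto simp: bij_betw_def)
  show ?thesis
    unfolding bij_betw_def
  proof (intro conjI inj_onI equalityI subsetI)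
    fix a b assume "a \<in> A - {x}" "b \<in> A - {x}" "skip x \<phi> a = skip x \<phi> b"
    then show "a = b" using inj assms(2) unfolding skip_def by (auto split: if_splits)
  next
    fix b assume "b \<in> skip x \<phi> ` (A - {x})"
    then show "b \<in> A - {x}" using im assms(2) False by (auto simp: skip_def)
  next
    fix b assume b: "b \<in> A - {x}"
    then have "b \<in> \<phi> ` A" using bij_betw_imp_surj_on[OF assms(1)] by simp
    then obtain a where a: "a \<in> A" "\<phi> a = b" by auto
    show "b \<in> skip x \<phi> ` (A - {x})"
    proof (cases "a = x")
      case True
      have "x \<in> \<phi> ` A" using bij_betw_imp_surj_on[OF assms(1)] assms(2) by simp
      then obtain c where c: "c \<in> A" "\<phi> c = x" by auto
      then have "c \<noteq> x" "skip x \<phi> c = b" using True a False by (auto simp: skip_def)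
      then show ?thesis using c by blast
    next
      case False
      then have "skip x \<phi> a = b" using a b by (auto simp: skip_def)
      then show ?thesis using a False by blast
    qed
  qed
qed

lemma skip_rtrancl:
  assumes "bij_betw \<phi> A A" "x \<in> A"
  shows "(graph_of (A - {x}) (skip x \<phi>))\<^sup>* \<inter> (A - {x}) \<times> (A - {x})
    = (graph_of A \<phi>)\<^sup>* \<inter> (A - {x}) \<times> (A - {x})"
proof -
  let ?r = "graph_of A \<phi>" and ?r' = "graph_of (A - {x}) (skip x \<phi>)"
  have im: "\<phi> a \<in> A" if "a \<in> A" for a using assms(1) that by (auto simp: bij_betw_def)
  have "?r' \<subseteq> ?r\<^sup>*"
  proof clarify
    fix a b assume "(a, b) \<in> ?r'"
    then have a: "a \<in> A - {x}" "b = (if \<phi> a = x then \<phi> x else \<phi> a)" by (auto simp: graph_of_def skip_def)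
    have "(a, \<phi> a) \<in> ?r" "(x, \<phi> x) \<in> ?r" using a assms(2) by (auto simp: graph_of_def)
    then show "(a, b) \<in> ?r\<^sup>*" using a by (auto intro: rtrancl_trans)
  qed
  then have 1: "?r'\<^sup>* \<subseteq> ?r\<^sup>*" by (rule rtrancl_subset_rtrancl)
  \<comment> \<open>The smaller graph cannot record a visit to \<open>x\<close>. What is kept
    instead is that the successor of \<open>x\<close> can be reached.\<close>
  have 2: "(v \<noteq> x \<longrightarrow> (u, v) \<in> ?r'\<^sup>*) \<and> (v = x \<longrightarrow> \<phi> x = x \<or> (u, \<phi> x) \<in> ?r'\<^sup>*)"
    if "(u, v) \<in> ?r\<^sup>*" "u \<in> A - {x}" for u v
    using that
  proof (induction rule: rtrancl_induct)
    case (step v w)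
    then have v: "v \<in> A" "w = \<phi> v" by (auto simp: graph_of_def)
    show ?case
    proof (cases "v = x")
      case True
      then show ?thesis using step v by auto
    next
      case False
      then have r: "(v, skip x \<phi> v) \<in> ?r'" "(u, v) \<in> ?r'\<^sup>*" using v step by (auto simp: graph_of_def)
      then have "(u, skip x \<phi> v) \<in> ?r'\<^sup>*" by (rule rtrancl_into_rtrancl[rotated])
      then show ?thesis using v by (auto simp: skip_def)
    qed
  qed auto
  show ?thesis using 1 2 by blast
qed

text \<open>Deleting a point from its cycle destroys the cycle only if it consists of that point
  alone. In the planar application the fixed points are the monogons.\<close>

lemma orbits_skip:
  assumes "bij_betw \<phi> A A" "finite A" "x \<in> A"
  shows "card (orbits A \<phi>) = card (orbits (A - {x}) (skip x \<phi>)) + (if \<phi> x = x then 1 else 0)"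
proof -
  let ?R = "(graph_of A \<phi>)\<^sup>* \<inter> A \<times> A" and ?B = "A - {x}"
  note E = orbits_equiv[OF assms(1,2)] and E' = orbits_equiv[OF skip_bij[OF assms(1,3)]]
  have "?R \<inter> ?B \<times> ?B = (graph_of ?B (skip x \<phi>))\<^sup>* \<inter> ?B \<times> ?B"
    using skip_rtrancl[OF assms(1,3)] by auto
  then have "orbits ?B (skip x \<phi>) = ?B // (?R \<inter> ?B \<times> ?B)"
    using E'(2) assms(2) by simp
  then have c: "card (orbits ?B (skip x \<phi>)) = card {C \<in> A // ?R. C \<inter> ?B \<noteq> {}}"
    using card_quotient_restrict[OF E(1) assms(2), of ?B "{}"] by simp
  have xR: "?R `` {x} \<in> A // ?R" using assms(3) by (rule quotientI)
  have xx: "x \<in> ?R `` {x}" using assms(3) by auto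
  have sub: "C \<subseteq> A" "C \<noteq> {}" if "C \<in> A // ?R" for C
    using in_quotient_imp_subset[OF E(1) that] in_quotient_imp_non_empty[OF E(1) that] .
  show ?thesis
  proof (cases "\<phi> x = x")
    case True
    have "(x, y) \<in> (graph_of A \<phi>)\<^sup>* \<Longrightarrow> y = x" for y
      by (induction rule: rtrancl_induct) (use True in \<open>auto simp: graph_of_def\<close>)
    then have "?R `` {x} = {x}" using xx by auto
    then have x1: "{x} \<in> A // ?R" using xR by simp
    have "{C \<in> A // ?R. C \<inter> ?B \<noteq> {}} = A // ?R - {{x}}" using sub by blast
    moreover have "finite (A // ?R)" using assms(2) by (simp add: finite_quotient)
    ultimately show ?thesis using c True E(2) card_Suc_Diff1[of "A // ?R" "{x}"] x1 by simp
  next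
    case False
    have px: "\<phi> x \<in> ?B" using False assms by (auto simp: bij_betw_def)
    have "(x, \<phi> x) \<in> ?R" using px assms(3) by (auto simp: graph_of_def)
    have "C \<inter> ?B \<noteq> {}" if C: "C \<in> A // ?R" for C
    proof (cases "x \<in> C")
      case True
      then have "C = ?R `` {x}" by (rule quotient_class[OF E(1) C])
      then show ?thesis using \<open>(x, \<phi> x) \<in> ?R\<close> px by auto
    qed (use sub[OF C] in auto)
    then have "{C \<in> A // ?R. C \<inter> ?B \<noteq> {}} = A // ?R" by auto
    then show ?thesis using c False E(2) by simp
  qed
qed

text \<open>Every orbit has at least two elements and the average is at most two, so each has
  exactly two.\<close>

lemma orbits_bigons:
  assumes "bij_betw \<phi> A A" "finite A" "card A \<le> 2 * card (orbits A \<phi>)" "\<And>x. x \<in> A \<Longrightarrow> \<phi> x \<noteq> x" "x \<in> A"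
  shows "\<phi> (\<phi> x) = x"
proof -
  let ?R = "(graph_of A \<phi>)\<^sup>* \<inter> A \<times> A"
  note E = orbits_equiv[OF assms(1,2)]
  have im: "\<phi> a \<in> A" if "a \<in> A" for a using assms(1) that by (auto simp: bij_betw_def)
  have fo: "finite (orbits A \<phi>)" unfolding E(2) using assms(2) by (simp add: finite_quotient)
  have sub: "C \<subseteq> A" "C \<noteq> {}" "finite C" if "C \<in> orbits A \<phi>" for C
  proof -
    have C: "C \<in> A // ?R" using that unfolding E(2) .
    show "C \<subseteq> A" "C \<noteq> {}" using in_quotient_imp_subset[OF E(1) C] in_quotient_imp_non_empty[OF E(1) C] .
    then show "finite C" using assms(2) finite_subset by auto
  qed
  have closed: "\<phi> a \<in> C" if "C \<in> orbits A \<phi>" "a \<in> C" for C a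
  proof -
    have a: "a \<in> A" using sub that by auto
    then have "(a, \<phi> a) \<in> ?R" using im by (auto simp: graph_of_def)
    moreover have "C = ?R `` {a}" by (rule quotient_class[OF E(1)]) (use that E(2) in auto)
    ultimately show ?thesis by auto
  qed
  have ge2: "2 \<le> card C" if "C \<in> orbits A \<phi>" for C
  proof -
    obtain a where a: "a \<in> C" using sub(2)[OF \<open>C \<in> orbits A \<phi>\<close>] by blast
    have "card {a, \<phi> a} \<le> card C" by (rule card_mono) (use sub[OF that] a closed[OF that] in auto)
    moreover have "a \<noteq> \<phi> a" using assms(4)[of a] a sub[OF that] by auto
    ultimately show ?thesis by simp
  qed
  have "card A = (\<Sum>C\<in>orbits A \<phi>. card C)"
  proof -
    have "pairwise disjnt (orbits A \<phi>)"
      unfolding pairwise_def disjnt_def E(2) using quotient_disj[OF E(1)] by blast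
    moreover have "\<Union> (orbits A \<phi>) = A" unfolding E(2) by (rule Union_quotient[OF E(1)])
    ultimately show ?thesis using card_Union_disjoint[of "orbits A \<phi>"] sub(3) by auto
  qed
  then have "(\<Sum>C\<in>orbits A \<phi>. card C) \<le> (\<Sum>C\<in>orbits A \<phi>. 2)" using assms(3) by simp
  moreover have "(\<Sum>C\<in>orbits A \<phi>. 2) \<le> (\<Sum>C\<in>orbits A \<phi>. card C)" by (rule sum_mono) (use ge2 in auto)
  ultimately have s: "(\<Sum>C\<in>orbits A \<phi>. card C) = (\<Sum>C\<in>orbits A \<phi>. 2)" by simp
  have two: "card C = 2" if "C \<in> orbits A \<phi>" for C
  proof (rule ccontr)
    assume "card C \<noteq> 2"
    then have "2 < card C" using ge2[OF that] by simp
    then have "(\<Sum>C\<in>orbits A \<phi>. 2) < (\<Sum>C\<in>orbits A \<phi>. card C)"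
      by (intro sum_strict_mono_ex1[OF fo]) (use ge2 that in auto)
    then show False using s by simp
  qed
  define C where "C = ?R `` {x}"
  have C: "C \<in> orbits A \<phi>" unfolding E(2) C_def using assms(5) by (rule quotientI)
  have xC: "x \<in> C" using assms(5) by (auto simp: C_def)
  note c1 = closed[OF C xC]
  note c2 = closed[OF C c1]
  have n: "\<phi> x \<noteq> x" "\<phi> (\<phi> x) \<noteq> \<phi> x" using assms(4)[of x] assms(4)[of "\<phi> x"] assms(5) im by auto
  show ?thesis
  proof (rule ccontr)
    assume "\<phi> (\<phi> x) \<noteq> x"
    then have "card {x, \<phi> x, \<phi> (\<phi> x)} = 3" using n by auto
    moreover have "card {x, \<phi> x, \<phi> (\<phi> x)} \<le> card C"
      by (rule card_mono) (use sub[OF C] xC c1 c2 in auto)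
    ultimately show False using two[OF C] by simp
  qed
qed

section \<open>Circles as lists\<close>

text \<open>\<open>n\<close> is the cyclic predecessor on \<open>L\<close>. The walk around a face
  goes clockwise along an input circle, against its numbering, and counterclockwise along the
  external circle; with the external list reversed the same predicate fits both.\<close>

definition backward :: "('a \<Rightarrow> 'a) \<Rightarrow> 'a list \<Rightarrow> bool" where
  "backward n L \<longleftrightarrow> (\<forall>us a b vs. L = us @ a # b # vs \<longrightarrow> n b = a) \<and> (L \<noteq> [] \<longrightarrow> n (hd L) = last L)"

lemma backwardD: "backward n L \<Longrightarrow> L = us @ a # b # vs \<Longrightarrow> n b = a"
  "backward n L \<Longrightarrow> L \<noteq> [] \<Longrightarrow> n (hd L) = last L"
  by (auto simp: backward_def)

lemma backward_cong:
  assumes "\<And>x. x \<in> set L \<Longrightarrow> n x = n' x" "backward n L"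
  shows "backward n' L"
  unfolding backward_def
proof (intro conjI allI impI)
  fix us a b vs assume L: "L = us @ a # b # vs"
  then have "n' b = n b" using assms(1)[of b] by simp
  then show "n' b = a" using backwardD(1)[OF assms(2) L] by simp
next
  assume "L \<noteq> []"
  then show "n' (hd L) = last L" using assms(1)[of "hd L"] backwardD(2)[OF assms(2)] by simp
qed

lemma backward_rotate1:
  assumes "backward n (a # xs)"
  shows "backward n (xs @ [a])"
proof (cases "xs = []")
  case False
  show ?thesis
    unfolding backward_def
  proof (intro conjI allI impI)
    fix us x y vs assume *: "xs @ [a] = us @ x # y # vs"
    show "n y = x"
    proof (cases vs rule: rev_cases)
      case Nil
      then have "xs = us @ [x]" "a = y" using * by auto
      then show ?thesis using backwardD(2)[OF assms] by simp
    next
      case (snoc vs' z)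
      then have "a # xs = (a # us) @ x # y # vs'" using * by auto
      then show ?thesis by (rule backwardD(1)[OF assms])
    qed
  next
    obtain b xs' where "xs = b # xs'" using False by (cases xs) auto
    then show "n (hd (xs @ [a])) = last (xs @ [a])" using backwardD(1)[OF assms, of "[]" a b xs'] by simp
  qed
qed (use assms in simp)

lemma backward_rotate: "backward n (us @ vs) \<Longrightarrow> backward n (vs @ us)"
proof (induction us arbitrary: vs)
  case (Cons a us)
  then have "backward n (us @ (vs @ [a]))" using backward_rotate1[of n a "us @ vs"] by simp
  from Cons.IH[OF this] show ?case by simp
qed simp

lemma backward_in: "backward n L \<Longrightarrow> x \<in> set L \<Longrightarrow> n x \<in> set L"
proof -
  assume L: "backward n L" "x \<in> set L"
  then obtain us vs where xs: "L = us @ x # vs" by (auto dest: split_list)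
  show ?thesis
  proof (cases us rule: rev_cases)
    case Nil
    then show ?thesis using backwardD(2)[OF L(1)] xs by (metis append_Nil last_in_set list.distinct(1) list.sel(1))
  next
    case (snoc us' a)
    then show ?thesis using backwardD(1)[OF L(1), of us' a x vs] xs by simp
  qed
qed

lemma backward_closed:
  assumes "backward n L" "a \<in> set L" "a \<in> S" "\<And>x. x \<in> set L \<Longrightarrow> x \<in> S \<Longrightarrow> n x \<in> S"
  shows "set L \<subseteq> S"
proof -
  have pre: "set us \<subseteq> S" if "L = us @ x # vs" "x \<in> S" for us x vs
    using that
  proof (induction us arbitrary: x vs rule: rev_induct)
    case (snoc u us)
    then have "n x = u" "x \<in> set L" using backwardD(1)[OF assms(1), of us u x vs] by auto
    then have "u \<in> S" using assms(4) snoc.prems(2) by auto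
    then show ?case using snoc.IH[of u "x # vs"] snoc.prems by auto
  qed simp
  obtain us vs where L: "L = us @ a # vs" using assms(2) by (auto dest: split_list)
  have "hd L \<in> S" using pre[OF L assms(3)] L assms(3) by (cases us) auto
  then have "last L \<in> S" using assms(4)[of "hd L"] backwardD(2)[OF assms(1)] L by (metis append_is_Nil_conv hd_in_set list.distinct(1))
  moreover have "L = butlast L @ last L # []"
    using L append_butlast_last_id[of L] by (metis append_is_Nil_conv list.distinct(1))
  ultimately have "set (butlast L) \<subseteq> S" "last L \<in> S" using pre by blast+
  then show ?thesis using \<open>L = butlast L @ last L # []\<close> by (metis Un_subset_iff empty_subsetI insert_subset list.simps(15) list.set(1) set_append)
qed

lemma backward_nth:
  assumes "backward n L" "i < length L"
  shows "L ! (length L - 1 - i) = (n ^^ Suc i) (hd L)"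
  using assms(2)
proof (induction i)
  case 0
  then show ?case using backwardD(2)[OF assms(1)] by (auto simp: last_conv_nth)
next
  case (Suc i)
  let ?j = "length L - 1 - Suc i"
  have j: "Suc ?j = length L - 1 - i" "Suc ?j < length L" using Suc.prems by auto
  have "L = take ?j L @ L ! ?j # L ! Suc ?j # drop (Suc (Suc ?j)) L"
    using j(2) by (metis Cons_nth_drop_Suc Suc_lessD append_take_drop_id)
  then have "n (L ! Suc ?j) = L ! ?j" by (rule backwardD(1)[OF assms(1)])
  then show ?case using Suc j by simp
qed

lemma backward_unique:
  assumes "backward n L" "backward n L'" "hd L = hd L'" "length L = length L'"
  shows "L = L'"
proof (rule nth_equalityI[OF assms(4)])
  fix i assume i: "i < length L"
  then have "length L - 1 - (length L - 1 - i) = i" "length L - 1 - i < length L" by auto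
  then show "L ! i = L' ! i"
    using backward_nth[OF assms(1), of "length L - 1 - i"] backward_nth[OF assms(2), of "length L - 1 - i"] assms(3,4)
    by simp
qed

lemma backward_rotation:
  assumes "backward n L" "backward n L'" "set L = set L'" "distinct L" "distinct L'" "L \<noteq> []"
  obtains us vs where "L = us @ vs" "L' = vs @ us"
proof -
  have "L' \<noteq> []" using assms by auto
  then have "hd L' \<in> set L" using assms by simp
  then obtain us vs where L: "L = us @ hd L' # vs" by (auto dest: split_list)
  have "(hd L' # vs) @ us = L'"
  proof (rule backward_unique[OF _ assms(2)])
    show "backward n ((hd L' # vs) @ us)" by (rule backward_rotate) (use assms L in simp)
    have "length L = length L'" using assms by (metis distinct_card)
    then show "length ((hd L' # vs) @ us) = length L'" using arg_cong[OF L, of length] by simp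
  qed simp
  then show thesis using that[of us "hd L' # vs"] L by simp
qed

section \<open>Reducing a planar diagram arc by arc\<close>

lemma tensor_assoc: "tensor (tensor P Q) R = tensor P (tensor Q R)"
proof (rule push_eqI[where P = P])
  fix \<sigma> c
  show "tensor (tensor (single \<sigma> (lookup P \<sigma>)) Q) R = tensor (single \<sigma> (lookup P \<sigma>)) (tensor Q R)"
  proof (rule push_eqI[where P = Q])
    fix \<tau>
    show "tensor (tensor (single \<sigma> (lookup P \<sigma>)) (single \<tau> (lookup Q \<tau>))) R =
        tensor (single \<sigma> (lookup P \<sigma>)) (tensor (single \<tau> (lookup Q \<tau>)) R)"
      by (rule push_eqI[where P = R])
        (simp_all add: tensor_single_single tensor_sum_right o_assoc mult.assoc)
  qed (simp_all add: tensor_sum_left tensor_sum_right)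
qed (simp_all add: tensor_sum_left)

definition tensors :: "'e elem list \<Rightarrow> 'e elem" where
  "tensors Ps = foldr tensor Ps (single id 1)"

lemma tensors_simps [simp]: "tensors [] = single id 1" "tensors (P # Ps) = tensor P (tensors Ps)"
  by (simp_all add: tensors_def)

lemma tensor_unit: "tensor P (single id 1) = P"
  by (simp add: tensor_def join_matching_def push_ident)

lemma keys_tensors:
  "list_all2 (\<lambda>L P. keys P \<subseteq> mts (set L)) LL Ps \<Longrightarrow> distinct (concat LL) \<Longrightarrow>
   keys (tensors Ps) \<subseteq> mts (set (concat LL))"
proof (induction LL Ps rule: list_all2_induct)
  case Nil
  then show ?case by (auto simp: mts_def)
next
  case (Cons L LL P Ps)
  then show ?case using keys_tensor[of P "set L" "tensors Ps" "set (concat LL)"] by auto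
qed

lemma tensors_move_front:
  assumes "list_all2 (\<lambda>L P. keys P \<subseteq> mts (set L)) LA PA" "keys P \<subseteq> mts X"
    "distinct (concat LA)" "set (concat LA) \<inter> X = {}"
  shows "tensors (PA @ P # PB) = tensor P (tensors (PA @ PB))"
  using assms
proof (induction LA PA rule: list_all2_induct)
  case (Cons L LA Q PA)
  have d: "distinct (concat LA)" "set (concat LA) \<inter> X = {}" "set L \<inter> X = {}"
    using Cons.prems by auto
  have "tensors ((Q # PA) @ P # PB) = tensor Q (tensor P (tensors (PA @ PB)))"
    using Cons.IH[OF Cons.prems(1) d(1,2)] by simp
  also have "\<dots> = tensor (tensor P Q) (tensors (PA @ PB))"
    using tensor_commute[OF Cons.hyps(1) Cons.prems(1) d(3)] by (simp add: tensor_assoc[symmetric])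
  finally show ?case by (simp add: tensor_assoc)
qed simp

text \<open>A connected planar map given by its permutations: the orbits of \<open>n\<close> on the
  circles are the vertices, those of \<open>p\<close> the arcs, and those of
  \<open>n \<circ> p\<close> the faces. The last clause is twice Euler's formula, as
  \<open>A\<close> counts every arc twice. The clause on \<open>S\<close> expresses that the input
  discs are connected by arcs among themselves. Free of the numbering of a diagram, the notion
  survives the merging of circles.\<close>

definition planar_state :: "'e list list \<Rightarrow> 'e list \<Rightarrow> ('e \<Rightarrow> 'e) \<Rightarrow> ('e \<Rightarrow> 'e) \<Rightarrow> bool" where
  "planar_state LL X0 n p \<longleftrightarrow>
    (let I = set (concat LL); A = I \<union> set X0 in
     distinct (concat LL @ X0) \<and> (\<forall>L\<in>set LL. backward n L \<and> 2 \<le> length L) \<and>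
     backward n X0 \<and> 2 \<le> length X0 \<and>
     (\<forall>x\<in>A. p x \<in> A \<and> p x \<noteq> x \<and> p (p x) = x) \<and> (\<forall>x\<in>set X0. p x \<in> I) \<and>
     (\<forall>S. S \<subseteq> I \<longrightarrow> (\<forall>L\<in>set LL. set L \<subseteq> S \<or> set L \<inter> S = {}) \<longrightarrow> (\<forall>x\<in>S. p x \<in> I \<longrightarrow> p x \<in> S) \<longrightarrow>
       S = {} \<or> S = I) \<and>
     2 * (length LL + 1 + card (orbits A (n \<circ> p))) = card A + 4)"

lemma planar_stateD:
  assumes "planar_state LL X0 n p"
  defines "I \<equiv> set (concat LL)"
  defines "A \<equiv> I \<union> set X0"
  shows "distinct (concat LL @ X0)" "\<And>L. L \<in> set LL \<Longrightarrow> backward n L" "\<And>L. L \<in> set LL \<Longrightarrow> 2 \<le> length L"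
    "backward n X0" "2 \<le> length X0" "\<And>x. x \<in> A \<Longrightarrow> p x \<in> A" "\<And>x. x \<in> A \<Longrightarrow> p x \<noteq> x" "\<And>x. x \<in> A \<Longrightarrow> p (p x) = x"
    "\<And>x. x \<in> set X0 \<Longrightarrow> p x \<in> I"
    "\<And>S. S \<subseteq> I \<Longrightarrow> (\<And>L. L \<in> set LL \<Longrightarrow> set L \<subseteq> S \<or> set L \<inter> S = {}) \<Longrightarrow> (\<And>x. x \<in> S \<Longrightarrow> p x \<in> I \<Longrightarrow> p x \<in> S) \<Longrightarrow>
       S = {} \<or> S = I"
    "2 * (length LL + 1 + card (orbits A (n \<circ> p))) = card A + 4"
proof -
  note 1 = assms(1)[unfolded planar_state_def Let_def, folded I_def, folded A_def]
  note 2 = 1[THEN conjunct2] note 3 = 2[THEN conjunct2] note 4 = 3[THEN conjunct2]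
  note 5 = 4[THEN conjunct2] note 6 = 5[THEN conjunct2] note 7 = 6[THEN conjunct2]
  note * = 1[THEN conjunct1] 2[THEN conjunct1] 3[THEN conjunct1] 4[THEN conjunct1]
    5[THEN conjunct1] 6[THEN conjunct1] 7[THEN conjunct1] 7[THEN conjunct2]
  show "distinct (concat LL @ X0)" "backward n X0" "2 \<le> length X0"
    "2 * (length LL + 1 + card (orbits A (n \<circ> p))) = card A + 4"
    by (fact *)+
  show "\<And>L. L \<in> set LL \<Longrightarrow> backward n L" "\<And>L. L \<in> set LL \<Longrightarrow> 2 \<le> length L" using *(2) by blast+
  show "\<And>x. x \<in> A \<Longrightarrow> p x \<in> A" "\<And>x. x \<in> A \<Longrightarrow> p x \<noteq> x" "\<And>x. x \<in> A \<Longrightarrow> p (p x) = x" using *(5) by blast+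
  show "\<And>x. x \<in> set X0 \<Longrightarrow> p x \<in> I" using *(6) by blast
  fix S assume "S \<subseteq> I" "\<And>L. L \<in> set LL \<Longrightarrow> set L \<subseteq> S \<or> set L \<inter> S = {}"
    "\<And>x. x \<in> S \<Longrightarrow> p x \<in> I \<Longrightarrow> p x \<in> S"
  then show "S = {} \<or> S = I" using *(7) by simp
qed

lemma planar_stateI:
  assumes "distinct (concat LL @ X0)" "\<And>L. L \<in> set LL \<Longrightarrow> backward n L" "\<And>L. L \<in> set LL \<Longrightarrow> 2 \<le> length L"
    "backward n X0" "2 \<le> length X0"
    "\<And>x. x \<in> set (concat LL) \<union> set X0 \<Longrightarrow> p x \<in> set (concat LL) \<union> set X0 \<and> p x \<noteq> x \<and> p (p x) = x"
    "\<And>x. x \<in> set X0 \<Longrightarrow> p x \<in> set (concat LL)"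
    "\<And>S. S \<subseteq> set (concat LL) \<Longrightarrow> (\<And>L. L \<in> set LL \<Longrightarrow> set L \<subseteq> S \<or> set L \<inter> S = {}) \<Longrightarrow>
       (\<And>x. x \<in> S \<Longrightarrow> p x \<in> set (concat LL) \<Longrightarrow> p x \<in> S) \<Longrightarrow> S = {} \<or> S = set (concat LL)"
    "2 * (length LL + 1 + card (orbits (set (concat LL) \<union> set X0) (n \<circ> p))) = card (set (concat LL) \<union> set X0) + 4"
  shows "planar_state LL X0 n p"
  unfolding planar_state_def Let_def
proof (intro conjI allI impI ballI)
  fix S assume "S \<subseteq> set (concat LL)" "\<forall>L\<in>set LL. set L \<subseteq> S \<or> set L \<inter> S = {}"
    "\<forall>x\<in>S. p x \<in> set (concat LL) \<longrightarrow> p x \<in> S"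
  then show "S = {} \<or> S = set (concat LL)" by (intro assms(8)) auto
qed (use assms in \<open>simp_all only:\<close>, (use assms(6) in blast)+)

lemma backward_surj: "backward n L \<Longrightarrow> set L \<subseteq> n ` set L"
proof
  fix a assume L: "backward n L" "a \<in> set L"
  then obtain us vs where xs: "L = us @ a # vs" by (auto dest: split_list)
  show "a \<in> n ` set L"
  proof (cases vs)
    case Nil
    then have "L \<noteq> []" "last L = a" using xs by auto
    then have "n (hd L) = a" "hd L \<in> set L" using backwardD(2)[OF L(1)] by auto
    then show ?thesis by blast
  next
    case (Cons b vs')
    then have "n b = a" "b \<in> set L" using backwardD(1)[OF L(1), of us a b vs'] xs by auto
    then show ?thesis by blast
  qed
qed

lemma bij_of_surj: "finite A \<Longrightarrow> A \<subseteq> f ` A \<Longrightarrow> bij_betw f A A"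
  unfolding bij_betw_def using finite_surj_inj[of A f] by (metis card_image card_subset_eq finite_imageI)

lemma planar_state_bij:
  assumes "planar_state LL X0 n p"
  shows "bij_betw n (set (concat LL) \<union> set X0) (set (concat LL) \<union> set X0)"
    "bij_betw (n \<circ> p) (set (concat LL) \<union> set X0) (set (concat LL) \<union> set X0)"
proof -
  note D = planar_stateD[OF assms]
  let ?A = "set (concat LL) \<union> set X0"
  have "?A \<subseteq> n ` ?A" using backward_surj[OF D(2)] backward_surj[OF D(4)] by fastforce
  then show n: "bij_betw n ?A ?A" by (intro bij_of_surj) auto
  have "x \<in> p ` ?A" if "x \<in> ?A" for x using D(6,8)[OF that] by (metis imageI)
  then have "bij_betw p ?A ?A" by (intro bij_of_surj) auto
  then show "bij_betw (n \<circ> p) ?A ?A" using n by (rule bij_betw_trans)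
qed

lemma orbits_cong: "(\<And>x. x \<in> A \<Longrightarrow> \<phi> x = \<psi> x) \<Longrightarrow> orbits A \<phi> = orbits A \<psi>"
proof -
  assume "\<And>x. x \<in> A \<Longrightarrow> \<phi> x = \<psi> x"
  then have "graph_of A \<phi> = graph_of A \<psi>" by (auto simp: graph_of_def)
  then show ?thesis by (simp add: orbits_def)
qed

lemma backward_hd: "backward n (x # U) \<Longrightarrow> U \<noteq> [] \<Longrightarrow> n x = last U"
  "backward n (x # U) \<Longrightarrow> U \<noteq> [] \<Longrightarrow> n (hd U) = x"
proof -
  assume 1: "backward n (x # U)" and 2: "U \<noteq> []"
  show "n x = last U" using backwardD(2)[OF 1] 2 by simp
  obtain b U' where "U = b # U'" using 2 by (cases U) auto
  then show "n (hd U) = x" using backwardD(1)[OF 1, of "[]" x b U'] by simp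
qed

lemma backward_tl: "backward n (x # U) \<Longrightarrow> U = us @ a # b # vs \<Longrightarrow> n b = a"
  using backwardD(1)[of n "x # U" "x # us" a b vs] by simp

text \<open>Contracting an arc between two discs removes one vertex and one arc and keeps all faces:
  neither \<open>x\<close> nor \<open>y\<close> is alone on its face. The new predecessor map
  bypasses the two removed ends, each being replaced by the predecessor of the other.\<close>

lemma planar_state_merge:
  assumes S: "planar_state (L1 # LA @ L2 # LB) X0 n p"
    and U: "backward n (x # U)" "mset (x # U) = mset L1" and V: "backward n (y # V)" "mset (y # V) = mset L2"
    and pxy: "p x = y"
  shows "planar_state ((U @ V) # LA @ LB) X0 (\<lambda>z. if n z = x then last V else if n z = y then last U else n z) p"
    (is "planar_state ?LL X0 ?n p")
proof -
  note D = planar_stateD[OF S] and bij = planar_state_bij[OF S]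
  define I where "I = set (concat (L1 # LA @ L2 # LB))"
  define A where "A = I \<union> set X0"
  define I' where "I' = set (concat ?LL)"
  define A' where "A' = I' \<union> set X0"
  note D = D[folded I_def, folded A_def] and bij = bij[folded I_def, folded A_def]
  have sets: "set L1 = insert x (set U)" "set L2 = insert y (set V)" "length L1 = Suc (length U)" "length L2 = Suc (length V)"
    "distinct L1 \<longleftrightarrow> distinct (x # U)" "distinct L2 \<longleftrightarrow> distinct (y # V)"
    using mset_eq_setD[OF U(2)] mset_eq_setD[OF V(2)] mset_eq_length[OF U(2)] mset_eq_length[OF V(2)]
      mset_eq_imp_distinct_iff[OF U(2)] mset_eq_imp_distinct_iff[OF V(2)] by auto
  have "mset (x # y # U @ V @ concat LA @ concat LB @ X0) = mset (concat (L1 # LA @ L2 # LB) @ X0)"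
    using U(2)[symmetric] V(2)[symmetric] by simp
  from mset_eq_imp_distinct_iff[OF this]
  have dist: "distinct (x # y # U @ V @ concat LA @ concat LB @ X0)" using D(1) by simp
  have UV: "U \<noteq> []" "V \<noteq> []" using D(3)[of L1] D(3)[of L2] sets by auto
  have xA: "x \<in> A" "y \<in> A" "x \<in> I" "y \<in> I" and pyx: "p y = x"
    using sets D(8)[of x] pxy by (auto simp: A_def I_def)
  have I': "I' = I - {x, y}" and A': "A' = A - {x, y}"
    using dist sets by (auto simp: I'_def A'_def I_def A_def)
  note nU = backward_hd[OF U(1) UV(1)] and nV = backward_hd[OF V(1) UV(2)]
  have last: "last U \<in> set U" "last V \<in> set V" "hd U \<in> set U" "hd V \<in> set V" using UV by auto
  have ninj: "n a = n b \<longleftrightarrow> a = b" if "a \<in> A" "b \<in> A" for a b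
    using bij(1) that by (auto simp: bij_betw_def inj_on_def)
  have nxy: "n z = x \<longleftrightarrow> z = hd U" "n z = y \<longleftrightarrow> z = hd V" if "z \<in> A" for z
    using ninj[of z "hd U"] ninj[of z "hd V"] nU nV last that sets by (auto simp: A_def I_def)
  have same: "?n z = n z" if "z \<in> A" "z \<noteq> hd U" "z \<noteq> hd V" for z
    using nxy[of z] that by auto
  have bUV: "backward ?n (U @ V)"
    unfolding backward_def
  proof (intro conjI allI impI)
    fix us a b vs assume *: "U @ V = us @ a # b # vs"
    have "b \<in> set (U @ V)" unfolding * by simp
    then have bA: "b \<in> A" using sets unfolding A_def I_def by auto
    have d: "distinct (us @ a # b # vs)" using dist unfolding *[symmetric] by auto
    from * consider w where "us = U @ w" "w @ a # b # vs = V" | w where "U = us @ w" "a # b # vs = w @ V"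
      unfolding append_eq_append_conv2 by metis
    then show "?n b = a"
    proof cases
      case (1 w)
      have "n b = a" using backward_tl[OF V(1) 1(2)[symmetric]] .
      moreover have "b \<noteq> hd U" using 1(2) dist last(3) by auto
      moreover have "b \<noteq> hd V" unfolding 1(2)[symmetric] using d unfolding 1(1) by (cases w) auto
      ultimately show ?thesis using same[OF bA] by simp
    next
      case (2 w)
      note o2 = 2
      from 2 consider "w = []" | "w = [a]" "V = b # vs" | w' where "w = a # b # w'"
        by (cases w; cases "tl w") auto
      then show ?thesis
      proof cases
        case 1
        then have V': "V = [] @ a # b # vs" using o2 by simp
        have "n b = a" using backward_tl[OF V(1) V'] .
        moreover have "b \<noteq> hd V" "b \<noteq> hd U" using V' dist last(3) by auto
        ultimately have "n b = a" "b \<noteq> hd V" "b \<noteq> hd U" by auto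
        then show ?thesis using same[OF bA] by simp
      next
        case 2
        then have "b = hd V" "a = last U" using o2 by auto
        then show ?thesis using nxy[OF bA] nV dist last by auto
      next
        case (3 w')
        then have U': "U = us @ a # b # w'" using o2 by simp
        have "n b = a" using backward_tl[OF U(1) U'] .
        moreover have "b \<noteq> hd U" unfolding U' using d by (cases us) auto
        moreover have "b \<noteq> hd V" using U' dist last(4) by auto
        ultimately show ?thesis using same[OF bA] by simp
      qed
    qed
  next
    show "?n (hd (U @ V)) = last (U @ V)" using UV nU by simp
  qed
  have bother: "backward ?n L" if "L \<in> set LA \<or> L \<in> set LB \<or> L = X0" for L
  proof (rule backward_cong)
    show "backward n L" using that D(2,4) by auto
    fix z assume "z \<in> set L"
    then have "z \<in> A" "z \<notin> set U \<union> set V" using that dist by (auto simp: A_def I_def)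
    then have "z \<in> A" "z \<noteq> hd U" "z \<noteq> hd V" using last by auto
    then show "n z = ?n z" by (rule same[symmetric])
  qed
  have orb: "card (orbits A' (?n \<circ> p)) = card (orbits A (n \<circ> p))"
  proof -
    have fin: "finite A" by (simp add: A_def I_def)
    have lx: "last V \<noteq> x" "last V \<noteq> y" "last U \<noteq> x" "last U \<noteq> y" "x \<noteq> y" using last dist by auto
    have 1: "card (orbits A (n \<circ> p)) = card (orbits (A - {x}) (skip x (n \<circ> p)))"
      using orbits_skip[OF bij(2) fin xA(1)] pxy nV(1) lx by simp
    have "skip x (n \<circ> p) y = last U" using lx nU pyx by (simp add: skip_def)
    then have "card (orbits (A - {x}) (skip x (n \<circ> p))) = card (orbits (A - {x} - {y}) (skip y (skip x (n \<circ> p))))"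
      using orbits_skip[OF skip_bij[OF bij(2) xA(1)], of y] fin xA(2) lx by simp
    moreover have "orbits (A - {x} - {y}) (skip y (skip x (n \<circ> p))) = orbits A' (?n \<circ> p)"
    proof -
      have "A - {x} - {y} = A'" using A' by auto
      moreover have "orbits A' (skip y (skip x (n \<circ> p))) = orbits A' (?n \<circ> p)"
        by (rule orbits_cong) (use lx nU nV pxy pyx in \<open>auto simp: skip_def\<close>)
      ultimately show ?thesis by simp
    qed
    ultimately show ?thesis using 1 by simp
  qed
  have cardA: "card A = card A' + 2"
  proof -
    have "A = insert x (insert y A')" using A' xA by auto
    moreover have "finite A'" by (simp add: A'_def I'_def)
    moreover have "x \<notin> insert y A'" "y \<notin> A'" unfolding A' using dist by auto
    ultimately show ?thesis by simp
  qed
  have pA': "p z \<in> A' \<and> p z \<noteq> z \<and> p (p z) = z" if "z \<in> A'" for z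
  proof -
    have z: "z \<in> A" "z \<noteq> x" "z \<noteq> y" using that A' by auto
    have "p z \<noteq> x" "p z \<noteq> y" using z D(8)[OF z(1)] pxy pyx by metis+
    then show ?thesis using D(6-8)[OF z(1)] A' by auto
  qed
  have pX0: "p z \<in> I'" if "z \<in> set X0" for z
  proof -
    have z: "z \<in> A" "z \<noteq> x" "z \<noteq> y" using that dist by (auto simp: A_def)
    have "p z \<noteq> x" "p z \<noteq> y" using z D(8)[OF z(1)] pxy pyx by metis+
    then show ?thesis using D(9)[OF that] I' by auto
  qed
  have conn: "S = {} \<or> S = I'" if S: "S \<subseteq> I'" "\<And>L. L \<in> set ?LL \<Longrightarrow> set L \<subseteq> S \<or> set L \<inter> S = {}"
      "\<And>z. z \<in> S \<Longrightarrow> p z \<in> I' \<Longrightarrow> p z \<in> S" for S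
  proof -
    \<comment> \<open>A union of discs after the contraction is lifted to one before it: if it
      contains the merged disc, the ends of the contracted arc are restored.\<close>
    define S0 where "S0 = (if set (U @ V) \<subseteq> S then insert x (insert y S) else S)"
    have UVS: "set (U @ V) \<subseteq> S \<or> set (U @ V) \<inter> S = {}" using S(2)[of "U @ V"] by simp
    have xyS: "x \<notin> S" "y \<notin> S" using S(1) I' by auto
    have "S0 = {} \<or> S0 = I"
    proof (rule D(10))
      show "S0 \<subseteq> I" using S(1) I' xA by (auto simp: S0_def)
      fix L assume "L \<in> set (L1 # LA @ L2 # LB)"
      then consider "L = L1" | "L = L2" | "L \<in> set (LA @ LB)" by auto
      then show "set L \<subseteq> S0 \<or> set L \<inter> S0 = {}"
      proof cases
        case 1
        then show ?thesis using UVS sets xyS UV by (auto simp: S0_def)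
      next
        case 2
        then show ?thesis using UVS sets xyS UV by (auto simp: S0_def)
      next
        case 3
        then have "x \<notin> set L" "y \<notin> set L" using dist by auto
        then show ?thesis using S(2)[of L] 3 by (auto simp: S0_def)
      qed
    next
      fix z assume z: "z \<in> S0" "p z \<in> I"
      show "p z \<in> S0"
      proof (cases "z = x \<or> z = y")
        case True
        then show ?thesis using z(1) pxy pyx xyS by (auto simp: S0_def split: if_splits)
      next
        case False
        then have zS: "z \<in> S" using z(1) by (auto simp: S0_def split: if_splits)
        then have "z \<in> A'" using S(1) by (auto simp: A'_def)
        then have "p z \<in> A'" using pA' by auto
        then have "p z \<in> I'" using z(2) I' A' by auto
        then show ?thesis using S(3)[OF zS] by (auto simp: S0_def)
      qed
    qed
    moreover have "S0 = {} \<Longrightarrow> S = {}" by (auto simp: S0_def split: if_splits)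
    moreover have "S0 = I \<Longrightarrow> S = I'" using xyS xA I' by (auto simp: S0_def split: if_splits)
    ultimately show ?thesis by auto
  qed
  have lens: "2 \<le> length L" if "L \<in> set ?LL" for L
    using that UV D(3) by (cases U; cases V) auto
  have len: "2 * (length ?LL + 1 + card (orbits A' (?n \<circ> p))) = card A' + 4"
    using D(11) unfolding orb cardA by simp
  show ?thesis
  proof (rule planar_stateI, unfold I'_def[symmetric], unfold A'_def[symmetric])
    show "distinct (concat ?LL @ X0)" using dist by simp
    show "backward ?n L" if "L \<in> set ?LL" for L using that bUV bother by auto
    show "backward ?n X0" by (rule bother) simp
    show "S = {} \<or> S = I'" if "S \<subseteq> I'" "\<And>L. L \<in> set ?LL \<Longrightarrow> set L \<subseteq> S \<or> set L \<inter> S = {}"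
      "\<And>x. x \<in> S \<Longrightarrow> p x \<in> I' \<Longrightarrow> p x \<in> S" for S
      by (rule conn[OF that])
  qed (fact lens D(5) pA' pX0 len)+
qed

text \<open>A curl at neighbouring ends bounds a monogon, namely the fixed point \<open>x\<close> of
  \<open>n \<circ> p\<close>. Its removal lowers the numbers of arcs and of faces by one. The disc
  keeps at least two ends, because \<open>p\<close> maps the external ends injectively into the
  remaining ones.\<close>

lemma planar_state_close:
  assumes S: "planar_state [L] X0 n p"
    and L: "backward n (x # y # vs)" "mset (x # y # vs) = mset L" and pxy: "p x = y"
  shows "planar_state [vs] X0 (\<lambda>z. if n z = y then n x else n z) p" (is "planar_state _ _ ?n _")
proof -
  note D = planar_stateD[OF S] and bij = planar_state_bij[OF S]
  define A where "A = set (concat [L]) \<union> set X0"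
  define A' where "A' = set vs \<union> set X0"
  note D = D[folded A_def] and bij = bij[folded A_def]
  have sets: "set L = insert x (insert y (set vs))" "length L = Suc (Suc (length vs))" "distinct L \<longleftrightarrow> distinct (x # y # vs)"
    using mset_eq_setD[OF L(2)] mset_eq_length[OF L(2)] mset_eq_imp_distinct_iff[OF L(2)] by auto
  have dist: "distinct (x # y # vs @ X0)" using D(1) sets by auto
  have xA: "x \<in> A" "y \<in> A" and pyx: "p y = x"
    using sets D(8)[of x] pxy by (auto simp: A_def)
  have A': "A' = A - {x, y}" using dist sets by (auto simp: A'_def A_def)
  have pA': "p z \<in> A' \<and> p z \<noteq> z \<and> p (p z) = z" if "z \<in> A'" for z
  proof -
    have z: "z \<in> A" "z \<noteq> x" "z \<noteq> y" using that A' by auto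
    have "p z \<noteq> x" "p z \<noteq> y" using z D(8)[OF z(1)] pxy pyx by metis+
    then show ?thesis using D(6-8)[OF z(1)] A' by auto
  qed
  have pX0: "p z \<in> set vs" if "z \<in> set X0" for z
  proof -
    have "z \<in> A'" using that by (simp add: A'_def)
    then have "p z \<in> A'" using pA' by auto
    then show ?thesis using D(9)[OF that] A' sets by auto
  qed
  have "inj_on p (set X0)" using pA' unfolding A'_def inj_on_def by (metis UnCI)
  then have "card (set X0) \<le> card (set vs)" using pX0 by (intro card_inj_on_le[of p]) auto
  then have len: "2 \<le> length vs" using D(5) dist distinct_card[of X0] distinct_card[of vs] by auto
  then have ne: "vs \<noteq> []" by auto
  have nyx: "n y = x" using backwardD(1)[OF L(1), of "[]" x y vs] by simp
  have nx: "n x = last vs" using backwardD(2)[OF L(1)] ne by simp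
  have nh: "n (hd vs) = y" using backwardD(1)[OF L(1), of "[x]" y "hd vs" "tl vs"] ne by simp
  have last: "last vs \<in> set vs" "hd vs \<in> set vs" using ne by auto
  have ninj: "n a = n b \<longleftrightarrow> a = b" if "a \<in> A" "b \<in> A" for a b
    using bij(1) that by (auto simp: bij_betw_def inj_on_def)
  have ny: "n z = y \<longleftrightarrow> z = hd vs" if "z \<in> A" for z
    using ninj[of z "hd vs"] nh last that sets by (auto simp: A_def)
  have bvs: "backward ?n vs"
    unfolding backward_def
  proof (intro conjI allI impI)
    fix us a b ws assume *: "vs = us @ a # b # ws"
    have "b \<in> A" using * sets by (auto simp: A_def)
    moreover have "b \<noteq> hd vs" using * dist by (cases us) auto
    moreover have "n b = a" using backwardD(1)[OF L(1), of "x # y # us" a b ws] * by simp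
    ultimately show "?n b = a" using ny by auto
  qed (use nh nx in auto)
  have bX0: "backward ?n X0"
  proof (rule backward_cong[OF _ D(4)])
    fix z assume "z \<in> set X0"
    then have "z \<in> A" "z \<noteq> hd vs" using dist last by (auto simp: A_def)
    then show "n z = ?n z" using ny by auto
  qed
  have fin: "finite A" by (simp add: A_def)
  have orb: "card (orbits A (n \<circ> p)) = card (orbits A' (?n \<circ> p)) + 1"
  proof -
    have lx: "last vs \<noteq> x" "last vs \<noteq> y" "x \<noteq> y" using last dist by auto
    have 1: "card (orbits A (n \<circ> p)) = card (orbits (A - {x}) (skip x (n \<circ> p))) + 1"
      using orbits_skip[OF bij(2) fin xA(1)] pxy nyx by simp
    have "skip x (n \<circ> p) y = last vs" using lx nx pyx by (simp add: skip_def)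
    then have "card (orbits (A - {x}) (skip x (n \<circ> p))) = card (orbits (A - {x} - {y}) (skip y (skip x (n \<circ> p))))"
      using orbits_skip[OF skip_bij[OF bij(2) xA(1)], of y] fin xA(2) lx by simp
    moreover have "orbits (A - {x} - {y}) (skip y (skip x (n \<circ> p))) = orbits A' (?n \<circ> p)"
    proof -
      have "A - {x} - {y} = A'" using A' by auto
      moreover have "orbits A' (skip y (skip x (n \<circ> p))) = orbits A' (?n \<circ> p)"
        by (rule orbits_cong) (use lx nx nyx pxy pyx in \<open>auto simp: skip_def\<close>)
      ultimately show ?thesis by simp
    qed
    ultimately show ?thesis using 1 by simp
  qed
  have cardA: "card A = card A' + 2"
  proof -
    have "A = insert x (insert y A')" using A' xA by auto
    from arg_cong[OF this, of card] show ?thesis using dist by (simp add: A'_def)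
  qed
  have euler: "2 * (length [vs] + 1 + card (orbits A' (?n \<circ> p))) = card A' + 4"
    using D(11) unfolding orb cardA by simp
  have c: "set (concat [vs]) = set vs" by simp
  show ?thesis
  proof (rule planar_stateI, unfold c, unfold A'_def[symmetric])
    show "distinct (concat [vs] @ X0)" using dist by simp
    show "backward ?n L" "2 \<le> length L" if "L \<in> set [vs]" for L using that bvs len by auto
    show "S = {} \<or> S = set vs" if "\<And>L. L \<in> set [vs] \<Longrightarrow> set L \<subseteq> S \<or> set L \<inter> S = {}" "S \<subseteq> set vs" for S
      using that(1)[of vs] that(2) by auto
  qed (fact bX0 D(5) pA' pX0 euler)+
qed

text \<open>Without a monogon all faces are bigons, by Euler's formula.\<close>

lemma planar_state_monogon:
  assumes S: "planar_state [L] X0 n p" and arc: "a \<in> set L" "p a \<in> set L"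
  obtains x where "x \<in> set L" "p x \<in> set L" "n (p x) = x"
proof (rule ccontr)
  assume no: "\<not> thesis"
  note monogon = that
  note D = planar_stateD[OF S] and bij = planar_state_bij[OF S]
  define A where "A = set (concat [L]) \<union> set X0"
  note D = D[folded A_def] and bij = bij[folded A_def]
  have disj: "set L \<inter> set X0 = {}" using D(1) by auto
  have nofix: "(n \<circ> p) x \<noteq> x" if "x \<in> A" for x
  proof
    assume *: "(n \<circ> p) x = x"
    have px: "p x \<in> set L \<union> set X0" using D(6)[OF that] by (simp add: A_def)
    have "x \<in> set L" "p x \<in> set L"
    proof -
      have nL: "n z \<in> set L" if "z \<in> set L" for z using backward_in[OF D(2)] that by simp
      have nX: "n z \<in> set X0" if "z \<in> set X0" for z using backward_in[OF D(4)] that by simp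
      show "p x \<in> set L"
      proof (rule ccontr)
        assume "p x \<notin> set L"
        then have "p x \<in> set X0" using px by auto
        then have "x \<in> set X0" using nX[of "p x"] * by simp
        then show False using D(9)[of x] \<open>p x \<notin> set L\<close> by simp
      qed
      then show "x \<in> set L" using nL[of "p x"] * by simp
    qed
    then show False using no monogon[of x] * by simp
  qed
  have fin: "finite A" by (simp add: A_def)
  have "card A \<le> 2 * card (orbits A (n \<circ> p))" using D(11) by simp
  then have bigon: "n (p (n (p x))) = x" if "x \<in> A" for x
    using orbits_bigons[OF bij(2) fin \<open>card A \<le> _\<close> nofix that] by simp
  obtain z where z: "z \<in> set X0" using D(5) by (cases X0) auto
  \<comment> \<open>Two arcs that bound a bigon have their ends on the same circles. So the property
    of leading to the outside passes from an end of \<open>L\<close> to its predecessor and spreads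
    over the whole circle, contradicting \<open>arc\<close>.\<close>
  have "set L \<subseteq> {x. p x \<in> set X0}"
  proof (rule backward_closed)
    show "backward n L" using D(2) by simp
    show "p z \<in> set L" using D(9)[OF z] by simp
    show "p z \<in> {x. p x \<in> set X0}" using z D(8)[of z] by (simp add: A_def)
    fix x assume x: "x \<in> set L" "x \<in> {x. p x \<in> set X0}"
    have nx: "n x \<in> set L" using backward_in[OF D(2)] x by simp
    have px: "p x \<in> A" "p (p x) = x" using x D(8)[of x] by (auto simp: A_def)
    have "n (p (n x)) = p x" using bigon[OF px(1)] px(2) by simp
    then have "n (p (n x)) \<in> set X0" using x by simp
    moreover have "p (n x) \<in> A" using D(6)[of "n x"] nx by (simp add: A_def)
    ultimately have "p (n x) \<in> set X0"
      using backward_in[OF D(2), of L "p (n x)"] disj by (auto simp: A_def)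
    then show "n x \<in> {x. p x \<in> set X0}" by simp
  qed
  then show False using arc disj by auto
qed

text \<open>Every arc changes the circle, so there are no monogons and all faces are bigons. Hence
  neighbours on the external circle are joined to neighbours on \<open>L\<close> in the opposite
  direction, and a cyclic order is unique up to rotation.\<close>

lemma planar_state_trivial:
  assumes S: "planar_state [L] X0 n p" and triv: "\<And>x. x \<in> set L \<Longrightarrow> p x \<in> set X0"
  obtains us vs where "L = us @ vs" "map p (rev X0) = vs @ us"
proof -
  note D = planar_stateD[OF S] and bij = planar_state_bij[OF S]
  define A where "A = set (concat [L]) \<union> set X0"
  note D = D[folded A_def] and bij = bij[folded A_def]
  have disj: "set L \<inter> set X0 = {}" using D(1) by auto
  have nofix: "(n \<circ> p) x \<noteq> x" if "x \<in> A" for x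
  proof
    assume *: "(n \<circ> p) x = x"
    show False
    proof (cases "x \<in> set L")
      case True
      then have "(n \<circ> p) x \<in> set X0" using triv backward_in[OF D(4)] by simp
      then show False using * True disj by auto
    next
      case False
      then have "x \<in> set X0" using that by (simp add: A_def)
      then have "(n \<circ> p) x \<in> set L" using D(9)[of x] backward_in[OF D(2)] by simp
      then show False using * False by simp
    qed
  qed
  have fin: "finite A" by (simp add: A_def)
  have "card A \<le> 2 * card (orbits A (n \<circ> p))" using D(11) by simp
  then have bigon: "n (p (n (p x))) = x" if "x \<in> A" for x
    using orbits_bigons[OF bij(2) fin \<open>card A \<le> _\<close> nofix that] by simp
  have X0n: "n (p (n z)) = p z" if z: "z \<in> set X0" for z
  proof -
    have "p z \<in> A" "p (p z) = z" using D(6)[of z] D(8)[of z] z by (auto simp: A_def)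
    then show ?thesis using bigon[of "p z"] by simp
  qed
  have b: "backward n (map p (rev X0))"
    unfolding backward_def
  proof (intro conjI allI impI)
    fix us a b vs assume "map p (rev X0) = us @ a # b # vs"
    then obtain us' a' b' vs' where *: "rev X0 = us' @ a' # b' # vs'" "a = p a'" "b = p b'"
      by (auto simp: map_eq_append_conv map_eq_Cons_conv)
    have X0: "X0 = rev vs' @ b' # a' # rev us'" using arg_cong[OF *(1), of rev] by simp
    then have "n a' = b'" by (rule backwardD(1)[OF D(4)])
    then show "n b = a" using X0n[of a'] X0 * by simp
  next
    assume "map p (rev X0) \<noteq> []"
    then have X0: "X0 \<noteq> []" by simp
    then have "n (hd X0) = last X0" by (rule backwardD(2)[OF D(4)])
    then show "n (hd (map p (rev X0))) = last (map p (rev X0))"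
      using X0n[of "hd X0"] X0 by (simp add: hd_map hd_rev last_map last_rev)
  qed
  have inj: "inj_on p A" using D(8) by (metis inj_onI)
  have "set L = p ` set X0"
  proof (intro equalityI subsetI)
    fix x assume "x \<in> set L"
    then show "x \<in> p ` set X0" using triv[of x] D(8)[of x] by (metis A_def UnCI concat.simps append_Nil2 image_eqI)
  qed (use D(9) in auto)
  then have s: "set L = set (map p (rev X0))" by simp
  have "distinct (map p (rev X0))" using D(1) inj by (auto simp: distinct_map A_def intro: inj_on_subset)
  moreover have "distinct L" "L \<noteq> []" using D(1) D(3)[of L] by auto
  ultimately show thesis using backward_rotation[OF _ b s] D(2) that by auto
qed

lemma scoh_rotation:
  assumes "scoh inp (us @ vs) \<kappa> P"
  obtains \<kappa>' where "scoh inp (vs @ us) \<kappa>' P"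
  using scoh_rotates[OF assms] by blast

lemma rotate_to_front:
  assumes "backward n L" "scoh inp L \<kappa> P" "x \<in> set L"
  obtains U \<kappa>' where "backward n (x # U)" "mset (x # U) = mset L" "scoh inp (x # U) \<kappa>' P"
proof -
  obtain us vs where L: "L = us @ x # vs" using assms(3) by (auto dest: split_list)
  have "backward n ((x # vs) @ us)" by (rule backward_rotate) (use assms L in simp)
  moreover obtain \<kappa>' where "scoh inp ((x # vs) @ us) \<kappa>' P" using scoh_rotation[of inp us "x # vs"] assms L by blast
  moreover have "mset ((x # vs) @ us) = mset L" using L by simp
  ultimately show thesis using that[of "vs @ us"] by simp
qed

text \<open>Otherwise the first disc would be separated from the other input discs.\<close>

lemma planar_state_arc:
  assumes S: "planar_state (L1 # L2 # LL) X0 n p"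
  obtains x where "x \<in> set L1" "p x \<in> set (concat (L2 # LL))"
proof (rule ccontr)
  note D = planar_stateD[OF S]
  assume no: "\<not> thesis"
  have "set L1 = {} \<or> set L1 = set (concat (L1 # L2 # LL))"
  proof (rule D(10))
    fix L assume "L \<in> set (L1 # L2 # LL)"
    then show "set L \<subseteq> set L1 \<or> set L \<inter> set L1 = {}" using D(1) by auto
  next
    fix x assume "x \<in> set L1" "p x \<in> set (concat (L1 # L2 # LL))"
    then show "p x \<in> set L1" using no that by auto
  qed auto
  moreover have "set L1 \<noteq> {}" "set L2 \<noteq> {}" using D(3)[of L1] D(3)[of L2] by auto
  ultimately have eq: "set L1 = set (concat (L1 # L2 # LL))" and "set L2 \<noteq> {}" by auto
  then obtain z where z: "z \<in> set L2" by (meson ex_in_conv)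
  then have "z \<in> set (concat (L1 # L2 # LL))" by simp
  then have "z \<in> set L1" by (simp only: eq[symmetric])
  then show False using z D(1) by auto
qed

text \<open>Closures at disjoint pairs commute, so the arc chosen by the geometry may be closed
  first wherever it stands in \<open>M\<close>.\<close>

lemma cls_pull_pair:
  assumes keys: "keys P \<subseteq> mts X" "set (pair_ends M) \<subseteq> X" "distinct (pair_ends M)"
    and x: "x \<in> set (pair_ends M)" and p: "\<And>a b. (a, b) \<in> set M \<Longrightarrow> p a = b \<and> p b = a"
  obtains M' where "cls M P = cls M' (cl x (p x) P)" "set (pair_ends M') = set (pair_ends M) - {x, p x}"
    "distinct (pair_ends M')" "set M' \<subseteq> set M" "length M' < length M"
proof -
  from x obtain a b where ab: "(a, b) \<in> set M" "x = a \<or> x = b" by (auto simp: set_pair_ends)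
  then obtain M1 M2 where M: "M = M1 @ (a, b) # M2" by (auto dest: split_list)
  have e: "{a, b} = {x, p x}" using ab p by auto
  have "cls M P = cls (M1 @ M2) (cl a b P)"
    unfolding M by (rule cls_front[OF keys(1)]) (use keys M in auto)
  also have "cl a b P = cl x (p x) P"
    using ab p[OF ab(1)] cl_sym[OF keys(1), of a b] by auto
  finally have 1: "cls M P = cls (M1 @ M2) (cl x (p x) P)" .
  have "set (pair_ends M) - {a, b} = set (pair_ends (M1 @ M2))"
    using keys(3) unfolding M by auto
  then have 2: "set (pair_ends (M1 @ M2)) = set (pair_ends M) - {x, p x}" using e by simp
  show thesis by (rule that[OF 1 2]) (use keys(3) M in auto)
qed

text \<open>\<open>M\<close> lists each arc between input ends once. Contracting an arc and removing
  a curl both use up one entry, hence the induction on its length. The result is read on the input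
  ends that face the external circle, in the counterclockwise order of the latter.\<close>

theorem scoh_planar:
  assumes "planar_state LL X0 n p" "LL \<noteq> []" "list_all2 (\<lambda>L P. \<exists>\<kappa>. scoh inp L \<kappa> P) LL Ps"
    and "set (pair_ends M) = {x \<in> set (concat LL). p x \<in> set (concat LL)}" "distinct (pair_ends M)"
    and "\<And>x y. (x, y) \<in> set M \<Longrightarrow> p x = y"
    and "\<And>x. x \<in> set (concat LL) \<Longrightarrow> p x \<in> set (concat LL) \<Longrightarrow> inp (p x) \<noteq> inp x"
  shows "\<exists>\<kappa>. scoh inp (map p (rev X0)) \<kappa> (cls M (tensors Ps))"
  using assms
proof (induction "length M" arbitrary: LL n Ps M rule: less_induct)
  case less
  note S = less.prems(1) and sc = less.prems(3) and M = less.prems(4,5,6) and opp = less.prems(7)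
  note D = planar_stateD[OF S]
  define I where "I = set (concat LL)"
  note D = D[folded I_def] and M = M[folded I_def] and opp = opp[folded I_def]
  have kLP: "list_all2 (\<lambda>L P. keys P \<subseteq> mts (set L)) LL Ps"
    using sc by (rule list_all2_mono) (auto dest: scoh_keys)
  have dLL: "distinct (concat LL)" using D(1) by auto
  have kT: "keys (tensors Ps) \<subseteq> mts I" using keys_tensors[OF kLP dLL] by (simp add: I_def)
  have sM: "set (pair_ends M) \<subseteq> I" using M(1) by auto
  have pM: "p a = b \<and> p b = a" if "(a, b) \<in> set M" for a b
  proof -
    have "a \<in> I" using that sM by (force simp: set_pair_ends)
    then show ?thesis using M(3)[OF that] D(8)[of a] by auto
  qed
  obtain L1 LL1 where LL: "LL = L1 # LL1" using less.prems(2) by (cases LL) auto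
  obtain P1 Ps1 where Ps: "Ps = P1 # Ps1" using sc LL by (auto simp: list_all2_Cons1)
  obtain \<kappa>1 where sc1: "scoh inp L1 \<kappa>1 P1" using sc LL Ps by auto
  show ?case
  proof (cases "LL1 = []")
    case False
    then obtain L2' LL2' where LL1: "LL1 = L2' # LL2'" by (cases LL1) auto
    obtain x where x: "x \<in> set L1" "p x \<in> set (concat LL1)"
      using planar_state_arc[of L1 L2' LL2' X0 n p] S LL LL1 by auto
    define y where "y = p x"
    obtain L2 where L2: "L2 \<in> set LL1" "y \<in> set L2" using x(2) by (auto simp: y_def)
    then obtain LA LB where AB: "LL1 = LA @ L2 # LB" by (auto dest: split_list)
    obtain PA P2 PB where Ps1: "Ps1 = PA @ P2 # PB" "list_all2 (\<lambda>L P. \<exists>\<kappa>. scoh inp L \<kappa> P) LA PA"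
      "list_all2 (\<lambda>L P. \<exists>\<kappa>. scoh inp L \<kappa> P) LB PB" "\<exists>\<kappa>. scoh inp L2 \<kappa> P2"
      using sc LL Ps AB by (auto simp: list_all2_append1 list_all2_Cons1)
    obtain \<kappa>2 where sc2: "scoh inp L2 \<kappa>2 P2" using Ps1(4) by auto
    have inL: "L1 \<in> set LL" "L2 \<in> set LL" using LL AB by auto
    obtain U \<kappa>1' where U: "backward n (x # U)" "mset (x # U) = mset L1" "scoh inp (x # U) \<kappa>1' P1"
      using rotate_to_front[OF D(2)[OF inL(1)] sc1 x(1)] .
    obtain V \<kappa>2' where V: "backward n (y # V)" "mset (y # V) = mset L2" "scoh inp (y # V) \<kappa>2' P2"
      using rotate_to_front[OF D(2)[OF inL(2)] sc2 L2(2)] .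
    define n' where "n' = (\<lambda>z. if n z = x then last V else if n z = y then last U else n z)"
    have S': "planar_state ((U @ V) # LA @ LB) X0 n' p"
      unfolding n'_def by (rule planar_state_merge) (use S LL AB U V y_def in auto)
    have sets: "set L1 = insert x (set U)" "set L2 = insert y (set V)" "length L1 = Suc (length U)"
      "distinct L1 \<longleftrightarrow> distinct (x # U)" "distinct L2 \<longleftrightarrow> distinct (y # V)"
      using mset_eq_setD[OF U(2)] mset_eq_setD[OF V(2)] mset_eq_length[OF U(2)]
        mset_eq_imp_distinct_iff[OF U(2)] mset_eq_imp_distinct_iff[OF V(2)] by auto
    have "mset (x # y # U @ V @ concat LA @ concat LB) = mset (concat LL)"
      using U(2)[symmetric] V(2)[symmetric] LL AB by simp
    from mset_eq_imp_distinct_iff[OF this]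
    have dist: "distinct (x # y # U @ V @ concat LA @ concat LB)" using dLL by simp
    have xI: "x \<in> I" "y \<in> I" using sets LL AB by (auto simp: I_def)
    have oxy: "inp x \<noteq> inp y" using opp[of x] xI by (auto simp: y_def)
    have U0: "U \<noteq> []" using D(3)[OF inL(1)] sets by auto
    define Q where "Q = cl x y (tensor P1 P2)"
    \<comment> \<open>A band of one arc suffices: any further arc between these two discs becomes a
      curl of the merged disc and is removed later.\<close>
    have "scoh inp (U @ V) (\<kappa>1' + \<kappa>2' + outs inp (map fst [(x, y)])) (cls [(x, y)] (tensor P1 P2))"
      by (rule scoh_join) (use U(3) V(3) U0 dist oxy in auto)
    then have scQ: "\<exists>\<kappa>. scoh inp (U @ V) \<kappa> Q" by (auto simp: Q_def)
    have "x \<in> set (pair_ends M)" using M(1) xI by (simp add: y_def)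
    then obtain M' where M': "cls M (tensors Ps) = cls M' (cl x y (tensors Ps))"
      "set (pair_ends M') = set (pair_ends M) - {x, y}" "distinct (pair_ends M')" "set M' \<subseteq> set M" "length M' < length M"
      using cls_pull_pair[OF kT sM M(2) _ pM, of x] unfolding y_def by metis
    have k1: "keys P1 \<subseteq> mts (set L1)" and k2: "keys P2 \<subseteq> mts (set L2)" using scoh_keys[OF sc1] scoh_keys[OF sc2] .
    have kA: "list_all2 (\<lambda>L P. keys P \<subseteq> mts (set L)) LA PA"
      using Ps1(2) by (rule list_all2_mono) (auto dest: scoh_keys)
    have kB: "list_all2 (\<lambda>L P. keys P \<subseteq> mts (set L)) LB PB"
      using Ps1(3) by (rule list_all2_mono) (auto dest: scoh_keys)
    have disj12: "set L1 \<inter> set L2 = {}" using dist sets by auto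
    have k12: "keys (tensor P1 P2) \<subseteq> mts (set L1 \<union> set L2)" by (rule keys_tensor[OF k1 k2 disj12])
    have kR: "keys (tensors (PA @ PB)) \<subseteq> mts (set (concat (LA @ LB)))"
      by (rule keys_tensors) (use kA kB dist in \<open>auto intro: list_all2_appendI\<close>)
    have dA: "distinct (concat LA)" "set (concat LA) \<inter> set L2 = {}" using dist unfolding sets(2) by auto
    have "tensors Ps = tensor P1 (tensor P2 (tensors (PA @ PB)))"
      unfolding Ps Ps1(1) tensors_simps tensors_move_front[OF kA k2 dA] ..
    also have "\<dots> = tensor (tensor P1 P2) (tensors (PA @ PB))" by (simp add: tensor_assoc)
    finally have "cl x y (tensors Ps) = cl x y (tensor (tensor P1 P2) (tensors (PA @ PB)))" by simp
    also have "\<dots> = tensors (Q # PA @ PB)"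
      unfolding Q_def tensors_simps
    proof (rule cl_tensor_left[OF k12 kR])
      show "(set L1 \<union> set L2) \<inter> set (concat (LA @ LB)) = {}" using dist unfolding sets(1,2) by auto
      show "x \<noteq> y" using dist by simp
    qed (simp_all add: sets)
    finally have eq: "cls M (tensors Ps) = cls M' (tensors (Q # PA @ PB))" using M'(1) by simp
    define I' where "I' = set (concat ((U @ V) # LA @ LB))"
    have I': "I' = I - {x, y}" using dist sets LL AB by (auto simp: I'_def I_def)
    have "\<exists>\<kappa>. scoh inp (map p (rev X0)) \<kappa> (cls M' (tensors (Q # PA @ PB)))"
    proof (rule less.hyps[OF M'(5) S'])
      show "list_all2 (\<lambda>L P. \<exists>\<kappa>. scoh inp L \<kappa> P) ((U @ V) # LA @ LB) (Q # PA @ PB)"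
        using scQ Ps1 by (auto intro: list_all2_appendI)
      show "set (pair_ends M') = {z \<in> set (concat ((U @ V) # LA @ LB)). p z \<in> set (concat ((U @ V) # LA @ LB))}"
        unfolding I'_def[symmetric]
      proof -
        have "p z \<noteq> x \<and> p z \<noteq> y" if "z \<in> I" "z \<noteq> x" "z \<noteq> y" for z
          using D(8)[of z] D(8)[of x] that xI unfolding y_def by (metis UnCI)
        then show "set (pair_ends M') = {z \<in> I'. p z \<in> I'}" unfolding M'(2) M(1) I' by auto
      qed
    next
      fix a b assume "(a, b) \<in> set M'"
      then show "p a = b" using M'(4) M(3) by auto
    next
      fix z assume "z \<in> set (concat ((U @ V) # LA @ LB))" "p z \<in> set (concat ((U @ V) # LA @ LB))"
      then have "z \<in> I" "p z \<in> I" unfolding I'_def[symmetric] I' by auto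
      then show "inp (p z) \<noteq> inp z" by (rule opp)
    qed (use M'(3) in auto)
    then show ?thesis using eq by simp
  next
    case True
    then have LL: "LL = [L1]" and Ps: "Ps = [P1]" using LL Ps sc by auto
    have I: "I = set L1" by (simp add: I_def LL)
    have S1: "planar_state [L1] X0 n p" using S LL by simp
    have T: "tensors Ps = P1" using Ps by (simp add: tensor_unit)
    show ?thesis
    proof (cases M)
      case Nil
      have triv: "p x \<in> set X0" if "x \<in> set L1" for x
        using D(6)[of x] M(1) Nil that I by auto
      obtain us vs where "L1 = us @ vs" "map p (rev X0) = vs @ us"
        using planar_state_trivial[OF S1 triv] by blast
      then show ?thesis using scoh_rotates sc1 Nil T by (metis cls.simps(1))
    next
      case (Cons m M1)
      then obtain a where "a \<in> set (pair_ends M)" by (cases m) auto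
      then have "a \<in> set L1" "p a \<in> set L1" using M(1) I by auto
      then obtain x where x: "x \<in> set L1" "p x \<in> set L1" "n (p x) = x" using planar_state_monogon[OF S1] by blast
      define y where "y = p x"
      have bL: "backward n L1" using D(2) LL by simp
      obtain W \<kappa>' where W: "backward n (x # W)" "mset (x # W) = mset L1" "scoh inp (x # W) \<kappa>' P1"
        using rotate_to_front[OF bL sc1 x(1)] .
      have sW: "set L1 = insert x (set W)" "distinct (x # W)"
        using mset_eq_setD[OF W(2)] mset_eq_imp_distinct_iff[OF W(2)] D(1) LL by auto
      have yx: "y \<noteq> x" using D(7)[of x] x I by (auto simp: y_def)
      then have "W \<noteq> []" using x sW by (auto simp: y_def)
      \<comment> \<open>\<open>n\<close> is injective and takes the value \<open>x\<close> both at
        \<open>hd W\<close> and at the other end of the monogon. So this end directly follows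
        \<open>x\<close>.\<close>
      then have "n (hd W) = x" "hd W \<in> set W" using backward_hd(2)[OF W(1)] by auto
      moreover have "inj_on n (I \<union> set X0)" using planar_state_bij(1)[OF S] by (simp add: bij_betw_def I_def)
      ultimately have "hd W = y" using x sW I by (auto simp: inj_on_def y_def)
      then obtain vs where vs: "W = y # vs" using \<open>W \<noteq> []\<close> by (cases W) auto
      note W = W[unfolded vs]
      define n' where "n' = (\<lambda>z. if n z = y then n x else n z)"
      have S': "planar_state [vs] X0 n' p"
        unfolding n'_def by (rule planar_state_close[OF S1 W(1,2)]) (simp add: y_def)
      have vs0: "vs \<noteq> []" using planar_stateD(3)[OF S', of vs] by auto
      have oxy: "inp x \<noteq> inp y" using opp[of x] x I by (auto simp: y_def)
      have "scoh inp ([] @ vs) (\<kappa>' + of_bool (inp x)) (cl x y P1)"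
        by (rule scoh_close[OF W(3)]) (use vs0 oxy in auto)
      then have scQ: "\<exists>\<kappa>. scoh inp vs \<kappa> (cl x y P1)" by auto
      have "x \<in> set (pair_ends M)" using M(1) x I by simp
      then obtain M' where M': "cls M (tensors Ps) = cls M' (cl x y (tensors Ps))"
        "set (pair_ends M') = set (pair_ends M) - {x, y}" "distinct (pair_ends M')" "set M' \<subseteq> set M" "length M' < length M"
        using cls_pull_pair[OF kT sM M(2) _ pM, of x] unfolding y_def by metis
      have eq: "cls M (tensors Ps) = cls M' (tensors [cl x y P1])" using M'(1) T by (simp add: tensor_unit)
      have I': "set vs = I - {x, y}" using sW vs I by auto
      have "\<exists>\<kappa>. scoh inp (map p (rev X0)) \<kappa> (cls M' (tensors [cl x y P1]))"
      proof (rule less.hyps[OF M'(5) S'])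
        show "set (pair_ends M') = {z \<in> set (concat [vs]). p z \<in> set (concat [vs])}"
        proof -
          have "p z \<noteq> x \<and> p z \<noteq> y" if "z \<in> I" "z \<noteq> x" "z \<noteq> y" for z
            using D(8)[of z] D(8)[of x] that x(1) I unfolding y_def by (metis UnCI)
          then show ?thesis unfolding M'(2) M(1) by (auto simp: I')
        qed
      next
        fix a b assume "(a, b) \<in> set M'"
        then show "p a = b" using M'(4) M(3) by auto
      next
        fix z assume "z \<in> set (concat [vs])" "p z \<in> set (concat [vs])"
        then have "z \<in> I" "p z \<in> I" using I' by auto
        then show "inp (p z) \<noteq> inp z" by (rule opp)
      qed (use M'(3) scQ in auto)
      then show ?thesis using eq by simp
    qed
  qed
qed

section \<open>Components of glued matchings\<close>

fun close_pairs :: "('e \<times> 'e) list \<Rightarrow> ('e \<Rightarrow> 'e) \<Rightarrow> 'e \<Rightarrow> 'e" where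
  "close_pairs [] \<sigma> = \<sigma>"
| "close_pairs ((x, y) # M) \<sigma> = close_pairs M (close_matching x y \<sigma>)"

fun loops :: "('e \<times> 'e) list \<Rightarrow> ('e \<Rightarrow> 'e) \<Rightarrow> nat" where
  "loops [] \<sigma> = 0"
| "loops ((x, y) # M) \<sigma> = of_bool (\<sigma> x = y) + loops M (close_matching x y \<sigma>)"

lemma cls_single: "cls M (single \<sigma> c) = single (close_pairs M \<sigma>) (c * loop_value ^ loops M \<sigma>)"
  by (induction M \<sigma> arbitrary: c rule: close_pairs.induct) (simp_all add: cl_single mult.assoc)

lemma close_pairs_mts:
  "\<sigma> \<in> mts X \<Longrightarrow> set (pair_ends M) \<subseteq> X \<Longrightarrow> distinct (pair_ends M) \<Longrightarrow>
   close_pairs M \<sigma> \<in> mts (X - set (pair_ends M))"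
proof (induction M \<sigma> arbitrary: X rule: close_pairs.induct)
  case (2 x y M \<sigma>)
  have "close_matching x y \<sigma> \<in> mts (X - {x, y})"
    by (rule close_matching_mts) (use "2.prems" in auto)
  then have "close_pairs M (close_matching x y \<sigma>) \<in> mts (X - {x, y} - set (pair_ends M))"
    by (rule "2.IH") (use "2.prems" in auto)
  moreover have "X - {x, y} - set (pair_ends M) = X - set (pair_ends ((x, y) # M))" by auto
  ultimately show ?case by simp
qed simp

text \<open>The curve as a graph on the ends: its edges are the strands of \<sigma> and the glued
  pairs, the latter in both directions. The strands are symmetric because \<sigma> is an
  involution.\<close>

definition links :: "'e set \<Rightarrow> ('e \<Rightarrow> 'e) \<Rightarrow> ('e \<times> 'e) list \<Rightarrow> 'e rel" where
  "links X \<sigma> M = graph_of X \<sigma> \<union> set M \<union> (set M)\<inverse>"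

lemma sym_links: "\<sigma> \<in> mts X \<Longrightarrow> sym (links X \<sigma> M)"
  by (auto simp: links_def graph_of_def sym_def mtsD)

lemma sym_rtrancl_equiv: "sym r \<Longrightarrow> equiv A (r\<^sup>* \<inter> A \<times> A)"
  using sym_rtrancl[of r] by (intro equivI) (auto simp: refl_on_def sym_def intro!: transI)

lemma quotient_rtrancl:
  assumes "r \<subseteq> A \<times> A"
  shows "A // r\<^sup>* = A // (r\<^sup>* \<inter> A \<times> A)"
proof -
  have "r\<^sup>* `` {x} = (r\<^sup>* \<inter> A \<times> A) `` {x}" if "x \<in> A" for x
    using that rtrancl_stays[OF _ that assms] by auto
  then show ?thesis unfolding quotient_def by auto
qed

text \<open>A path entering \<open>x\<close> or \<open>y\<close> along a strand crosses the glued
  pair and leaves along the other strand. The strand of the closed matching is precisely this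
  shortcut.\<close>

lemma links_close:
  assumes s: "\<sigma> \<in> mts X" and M: "set (pair_ends ((x, y) # M)) \<subseteq> X" "distinct (pair_ends ((x, y) # M))"
  defines "X' \<equiv> X - {x, y}"
  shows "(links X' (close_matching x y \<sigma>) M)\<^sup>* \<inter> X' \<times> X' = (links X \<sigma> ((x, y) # M))\<^sup>* \<inter> X' \<times> X'"
proof -
  let ?r = "links X \<sigma> ((x, y) # M)" and ?r' = "links X' (close_matching x y \<sigma>) M"
  note m = mtsD[OF s]
  have xy: "x \<in> X" "y \<in> X" "x \<noteq> y" using M by auto
  have ends: "a \<in> X'" "b \<in> X'" if "(a, b) \<in> set M \<union> (set M)\<inverse>" for a b
  proof -
    have "a \<in> set (pair_ends M)" "b \<in> set (pair_ends M)"
      using that by (auto simp: set_pair_ends intro: rev_image_eqI)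
    then show "a \<in> X'" "b \<in> X'" using M by (auto simp: X'_def)
  qed
  have 1: "?r' \<subseteq> ?r\<^sup>*"
  proof
    fix e assume "e \<in> ?r'"
    then consider z where "z \<in> X'" "e = (z, close_matching x y \<sigma> z)" | "e \<in> set M \<union> (set M)\<inverse>"
      by (auto simp: links_def graph_of_def)
    then show "e \<in> ?r\<^sup>*"
    proof cases
      case (1 z)
      have st: "(u, \<sigma> u) \<in> ?r" if "u \<in> X" for u using that by (auto simp: links_def graph_of_def)
      have z: "z \<in> X" "z \<noteq> x" "z \<noteq> y" using 1 by (auto simp: X'_def)
      have xyr: "(x, y) \<in> ?r" "(y, x) \<in> ?r" by (auto simp: links_def)
      show ?thesis
      proof (cases "\<sigma> z = x \<or> \<sigma> z = y")
        case True
        then show ?thesis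
        proof
          assume "\<sigma> z = x"
          then have "e = (z, \<sigma> y)" "(z, x) \<in> ?r" using 1 z st[OF z(1)] by (auto simp: close_matching_def)
          then show ?thesis using xyr st[OF xy(2)] by (meson r_into_rtrancl rtrancl.rtrancl_into_rtrancl)
        next
          assume *: "\<sigma> z = y"
          then have "e = (z, \<sigma> x)" "(z, y) \<in> ?r" using 1 z xy st[OF z(1)] by (auto simp: close_matching_def)
          then show ?thesis using xyr st[OF xy(1)] by (meson r_into_rtrancl rtrancl.rtrancl_into_rtrancl)
        qed
      next
        case False
        then show ?thesis using 1 z st[OF z(1)] by (auto simp: close_matching_def)
      qed
    qed (auto simp: links_def)
  qed
  \<comment> \<open>Being at \<open>x\<close> or \<open>y\<close> is remembered as the possibility
    of leaving along either strand. A path that starts elsewhere gets there only if \<open>x\<close>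
    and \<open>y\<close> do not form a loop of their own, whence \<sigma> x \<noteq> y.\<close>
  have 2: "(v \<in> X' \<longrightarrow> (u, v) \<in> ?r'\<^sup>*) \<and>
      (v \<in> {x, y} \<longrightarrow> \<sigma> x \<noteq> y \<and> (u, \<sigma> x) \<in> ?r'\<^sup>* \<and> (u, \<sigma> y) \<in> ?r'\<^sup>*)"
    if "(u, v) \<in> ?r\<^sup>*" "u \<in> X'" for u v
    using that
  proof (induction rule: rtrancl_induct)
    case base
    then show ?case by (auto simp: X'_def)
  next
    case (step v w)
    note IH = step.IH[OF step.prems]
    have join: "\<sigma> x \<in> X'" "\<sigma> y \<in> X'" "(\<sigma> x, \<sigma> y) \<in> ?r'" "(\<sigma> y, \<sigma> x) \<in> ?r'" if "\<sigma> x \<noteq> y"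
    proof -
      have "\<sigma> y \<noteq> x" using that m(3) by metis
      then show x: "\<sigma> x \<in> X'" and y: "\<sigma> y \<in> X'" using that m(1,2) xy by (auto simp: X'_def)
      have "close_matching x y \<sigma> (\<sigma> x) = \<sigma> y" "close_matching x y \<sigma> (\<sigma> y) = \<sigma> x"
        using x y xy m(3) by (auto simp: close_matching_def X'_def)
      then show "(\<sigma> x, \<sigma> y) \<in> ?r'" "(\<sigma> y, \<sigma> x) \<in> ?r'" using x y unfolding links_def graph_of_def by force+
    qed
    from step.hyps(2) consider "v \<in> X" "w = \<sigma> v" | "(v, w) \<in> set M \<union> (set M)\<inverse>" | "v \<in> {x, y}" "w \<in> {x, y}"
      by (auto simp: links_def graph_of_def)
    then show ?case
    proof cases
      case 1
      show ?thesis
      proof (cases "v \<in> {x, y}")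
        case True
        then have "\<sigma> x \<noteq> y" "(u, w) \<in> ?r'\<^sup>*" using IH 1 by auto
        moreover have "w \<in> X'" using join(1,2)[OF \<open>\<sigma> x \<noteq> y\<close>] True 1 by auto
        ultimately show ?thesis by (auto simp: X'_def)
      next
        case False
        then have vX: "v \<in> X'" using 1 by (auto simp: X'_def)
        then have uv: "(u, v) \<in> ?r'\<^sup>*" using IH by simp
        show ?thesis
        proof (cases "w \<in> {x, y}")
          case True
          have "v = \<sigma> w" using 1 m(3) by simp
          then have "v = \<sigma> x \<or> v = \<sigma> y" using True by auto
          moreover have ne: "\<sigma> x \<noteq> y"
            using True 1 False m(3) by (metis insertCI insertE singletonD)
          ultimately have "(u, \<sigma> x) \<in> ?r'\<^sup>*" "(u, \<sigma> y) \<in> ?r'\<^sup>*"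
            using uv join(3,4)[OF ne] by (meson rtrancl.rtrancl_into_rtrancl)+
          then show ?thesis using ne True by (auto simp: X'_def)
        next
          case wn: False
          then have "close_matching x y \<sigma> v = w" using 1 False by (auto simp: close_matching_def)
          then have "(v, w) \<in> ?r'" using vX by (auto simp: links_def graph_of_def)
          then show ?thesis using uv wn by (auto intro: rtrancl_into_rtrancl)
        qed
      qed
    next
      case 2
      then have "v \<in> X'" "w \<in> X'" using ends by auto
      moreover have "(v, w) \<in> ?r'" using 2 by (auto simp: links_def)
      ultimately show ?thesis using IH by (auto intro: rtrancl_into_rtrancl simp: X'_def)
    next
      case 3
      then show ?thesis using IH by (auto simp: X'_def)
    qed
  qed
  show ?thesis using rtrancl_subset_rtrancl[OF 1] 2 by blast
qed

text \<open>By induction over the glued pairs. A closure preserves the components on the remaining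
  ends, and it loses a component exactly when \<open>x\<close> and \<open>y\<close> are the ends of
  one strand, which is when \<open>loops\<close> counts one.\<close>

lemma links_components:
  assumes "\<sigma> \<in> mts X" "set (pair_ends M) \<subseteq> X" "distinct (pair_ends M)" "finite X"
  defines "Y \<equiv> X - set (pair_ends M)"
  shows "z \<in> Y \<Longrightarrow> w \<in> Y \<Longrightarrow> (z, w) \<in> (links X \<sigma> M)\<^sup>* \<longleftrightarrow> w = z \<or> w = close_pairs M \<sigma> z"
    and "card {C \<in> X // ((links X \<sigma> M)\<^sup>* \<inter> X \<times> X). C \<inter> Y = {}} = loops M \<sigma>"
proof -
  have "(\<forall>z\<in>Y. \<forall>w\<in>Y. (z, w) \<in> (links X \<sigma> M)\<^sup>* \<longleftrightarrow> w = z \<or> w = close_pairs M \<sigma> z) \<and>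
    card {C \<in> X // ((links X \<sigma> M)\<^sup>* \<inter> X \<times> X). C \<inter> Y = {}} = loops M \<sigma>"
    using assms(1-4) unfolding Y_def
  proof (induction M \<sigma> arbitrary: X rule: close_pairs.induct)
    case (1 \<sigma>)
    note m = mtsD[OF "1.prems"(1)]
    have "(z, w) \<in> (links X \<sigma> [])\<^sup>* \<Longrightarrow> w = z \<or> w = \<sigma> z" for z w
      by (induction rule: rtrancl_induct) (auto simp: links_def graph_of_def m(3))
    moreover have "(z, \<sigma> z) \<in> links X \<sigma> []" if "z \<in> X" for z
      using that by (auto simp: links_def graph_of_def)
    ultimately have first: "(z, w) \<in> (links X \<sigma> [])\<^sup>* \<longleftrightarrow> w = z \<or> w = \<sigma> z" if "z \<in> X" for z w
      using that by blast
    have E: "equiv X ((links X \<sigma> [])\<^sup>* \<inter> X \<times> X)"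
      by (rule sym_rtrancl_equiv[OF sym_links[OF "1.prems"(1)]])
    have "C \<inter> X \<noteq> {}" if "C \<in> X // ((links X \<sigma> [])\<^sup>* \<inter> X \<times> X)" for C
      using in_quotient_imp_non_empty[OF E that] in_quotient_imp_subset[OF E that] by blast
    then have none: "{C \<in> X // ((links X \<sigma> [])\<^sup>* \<inter> X \<times> X). C \<inter> X = {}} = {}" by blast
    show ?case
      unfolding pair_ends.simps list.set Diff_empty none close_pairs.simps loops.simps card.empty
      using first by blast
  next
    case (2 x y M \<sigma>)
    let ?X = "X - {x, y}" and ?s = "close_matching x y \<sigma>" and ?Y = "X - set (pair_ends ((x, y) # M))"
    let ?r = "links X \<sigma> ((x, y) # M)" and ?r' = "links ?X ?s M"
    note m = mtsD[OF "2.prems"(1)]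
    have xy: "x \<in> X" "y \<in> X" "x \<noteq> y" using "2.prems" by auto
    have s': "?s \<in> mts ?X" by (rule close_matching_mts) (use "2.prems" xy in auto)
    have Y: "?X - set (pair_ends M) = ?Y" by auto
    have eq: "?r'\<^sup>* \<inter> ?X \<times> ?X = ?r\<^sup>* \<inter> ?X \<times> ?X" by (rule links_close[OF "2.prems"(1-3)])
    have IH: "(\<forall>z\<in>?Y. \<forall>w\<in>?Y. (z, w) \<in> ?r'\<^sup>* \<longleftrightarrow> w = z \<or> w = close_pairs M ?s z) \<and>
        card {C \<in> ?X // (?r'\<^sup>* \<inter> ?X \<times> ?X). C \<inter> ?Y = {}} = loops M ?s"
      unfolding Y[symmetric] by (rule "2.IH"[OF s']) (use "2.prems" in auto)
    have first: "\<forall>z\<in>?Y. \<forall>w\<in>?Y. (z, w) \<in> ?r\<^sup>* \<longleftrightarrow> w = z \<or> w = close_pairs ((x, y) # M) \<sigma> z"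
    proof (intro ballI)
      fix z w assume zw: "z \<in> ?Y" "w \<in> ?Y"
      then have "(z, w) \<in> ?X \<times> ?X" by auto
      then have "(z, w) \<in> ?r\<^sup>* \<longleftrightarrow> (z, w) \<in> ?r'\<^sup>*" using eq by blast
      then show "(z, w) \<in> ?r\<^sup>* \<longleftrightarrow> w = z \<or> w = close_pairs ((x, y) # M) \<sigma> z" using IH zw by simp
    qed
    let ?R = "?r\<^sup>* \<inter> X \<times> X"
    have E: "equiv X ?R" by (rule sym_rtrancl_equiv[OF sym_links[OF "2.prems"(1)]])
    have "?R \<inter> ?X \<times> ?X = ?r'\<^sup>* \<inter> ?X \<times> ?X" unfolding eq by auto
    moreover have "?X \<subseteq> X" "?Y \<subseteq> ?X" by auto
    ultimately have c: "card {C \<in> X // ?R. C \<inter> ?X \<noteq> {} \<and> C \<inter> ?Y = {}} = loops M ?s"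
      using card_quotient_restrict[OF E "2.prems"(4), of ?X ?Y] IH by simp
    have fin: "finite (X // ?R)" using "2.prems"(4) by (simp add: finite_quotient)
    have st: "(u, \<sigma> u) \<in> ?r" if "u \<in> X" for u using that by (auto simp: links_def graph_of_def)
    have inR: "C = ?R `` {a}" if "C \<in> X // ?R" "a \<in> C" for C a by (rule quotient_class[OF E that])
    have sx: "\<sigma> x \<in> C" if "C \<in> X // ?R" "x \<in> C" for C
      using inR[OF that] st[OF xy(1)] xy m(1) by auto
    have sy: "\<sigma> y \<in> C" if "C \<in> X // ?R" "y \<in> C" for C
      using inR[OF that] st[OF xy(2)] xy m(1) by auto
    have "card {C \<in> X // ?R. C \<inter> ?Y = {}} = of_bool (\<sigma> x = y) + card {C \<in> X // ?R. C \<inter> ?X \<noteq> {} \<and> C \<inter> ?Y = {}}"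
    proof (cases "\<sigma> x = y")
      case True
      then have yx: "\<sigma> y = x" using m(3) by metis
      have only: "v \<in> {x, y}" if "(u, v) \<in> ?r\<^sup>*" "u \<in> {x, y}" for u v
        using that
      proof (induction rule: rtrancl_induct)
        case (step v w)
        have "x \<notin> fst ` set M" "x \<notin> snd ` set M" "y \<notin> fst ` set M" "y \<notin> snd ` set M"
          using "2.prems"(3) by (auto simp: set_pair_ends)
        then show ?case using step True yx by (force simp: links_def graph_of_def)
      qed simp
      have "?R `` {x} = {x, y}"
        using only[of x] xy by (auto simp: links_def)
      then have C0: "{x, y} \<in> X // ?R" using quotientI[OF xy(1), of ?R] by simp
      have "{C \<in> X // ?R. C \<inter> ?Y = {}} = insert {x, y} {C \<in> X // ?R. C \<inter> ?X \<noteq> {} \<and> C \<inter> ?Y = {}}"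
      proof (intro equalityI subsetI)
        fix C assume C: "C \<in> {C \<in> X // ?R. C \<inter> ?Y = {}}"
        then have C': "C \<in> X // ?R" by simp
        have ne: "C \<noteq> {}" "C \<subseteq> X" using in_quotient_imp_non_empty[OF E C'] in_quotient_imp_subset[OF E C'] .
        show "C \<in> insert {x, y} {C \<in> X // ?R. C \<inter> ?X \<noteq> {} \<and> C \<inter> ?Y = {}}"
        proof (cases "C \<inter> ?X = {}")
          case cx: True
          then have "x \<in> C \<or> y \<in> C" using ne by auto
          then have "x \<in> C" using sy[OF C'] yx by auto
          then have "y \<in> C" using sx[OF C'] True by auto
          then have "C = {x, y}" using \<open>x \<in> C\<close> cx ne by auto
          then show ?thesis by simp
        qed (use C in auto)
      qed (use C0 in auto)
      moreover have "{x, y} \<notin> {C \<in> X // ?R. C \<inter> ?X \<noteq> {} \<and> C \<inter> ?Y = {}}" by auto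
      ultimately show ?thesis using True fin by simp
    next
      case False
      then have "\<sigma> y \<noteq> x" using m(3) by metis
      then have "\<sigma> x \<in> ?X" "\<sigma> y \<in> ?X" using False m(1,2) xy by auto
      then have "C \<inter> ?X \<noteq> {}" if "C \<in> X // ?R" for C
        using in_quotient_imp_non_empty[OF E that] in_quotient_imp_subset[OF E that] sx[OF that] sy[OF that]
        by blast
      then have "{C \<in> X // ?R. C \<inter> ?Y = {}} = {C \<in> X // ?R. C \<inter> ?X \<noteq> {} \<and> C \<inter> ?Y = {}}" by blast
      then show ?thesis using False by simp
    qed
    then show ?case using first c by simp
  qed
  then show "z \<in> Y \<Longrightarrow> w \<in> Y \<Longrightarrow> (z, w) \<in> (links X \<sigma> M)\<^sup>* \<longleftrightarrow> w = z \<or> w = close_pairs M \<sigma> z"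
    and "card {C \<in> X // ((links X \<sigma> M)\<^sup>* \<inter> X \<times> X). C \<inter> Y = {}} = loops M \<sigma>" by auto
qed

section \<open>The action as an iterated closure\<close>

lemma smoothings_finite: "finite (smoothings k b)"
proof -
  have "smoothings k b \<subseteq> {\<sigma>. \<sigma> permutes {..<2 * k}}" by (auto simp: smoothings_def)
  then show ?thesis using finite_permutations[of "{..<2 * k}"] finite_subset by auto
qed

lemma smoothing_mts: "\<sigma> \<in> smoothings k b \<Longrightarrow> \<sigma> \<in> mts {..<2 * k}"
proof -
  assume "\<sigma> \<in> smoothings k b"
  then have s: "\<sigma> permutes {..<2 * k}" "\<And>i. i < 2 * k \<Longrightarrow> \<sigma> (\<sigma> i) = i \<and> (in_point b (\<sigma> i) \<longleftrightarrow> \<not> in_point b i)"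
    by (auto simp: smoothings_def)
  show ?thesis
    unfolding mts_def mem_Collect_eq
    using permutes_in_image[OF s(1)] permutes_not_in[OF s(1)] s(2) by (metis lessThan_iff)
qed

text \<open>All inserted smoothings as one matching of arc ends. The factors have disjoint supports;
  the order of composition is the one that \<open>tensors\<close> produces.\<close>

definition total_matching :: "(nat \<Rightarrow> nat) \<Rightarrow> nat list \<Rightarrow> (nat \<Rightarrow> nat \<Rightarrow> nat) \<Rightarrow> arc_end \<Rightarrow> arc_end" where
  "total_matching m js s = foldr (\<lambda>j f. relabel_matching {..<m j} (Pair j) (s j) \<circ> f) js id"

lemma total_matching_Cons:
  "total_matching m (j # js) s = relabel_matching {..<m j} (Pair j) (s j) \<circ> total_matching m js s"
  by (simp add: total_matching_def)

lemma total_matching_cong: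
  "(\<And>j. j \<in> set js \<Longrightarrow> s j = s' j) \<Longrightarrow> total_matching m js s = total_matching m js s'"
  by (induction js) (auto simp: total_matching_def)

lemma total_matching_apply:
  assumes "distinct js" "\<And>j. j \<in> set js \<Longrightarrow> s j \<in> mts {..<m j}"
  shows "total_matching m js s (j, i) = (if j \<in> set js \<and> i < m j then (j, s j i) else (j, i))"
  using assms
proof (induction js)
  case Nil
  then show ?case by (simp add: total_matching_def)
next
  case (Cons l js)
  have r: "relabel_matching {..<m l} (Pair l) (s l) (j', i') = (if j' = l \<and> i' < m l then (l, s l i') else (j', i'))" for j' i'
  proof (cases "j' = l \<and> i' < m l")
    case True
    then show ?thesis using relabel_matching_image[of "Pair l" "{..<m l}" i' "s l"] by (simp add: inj_on_def)
  next
    case False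
    then have "(j', i') \<notin> Pair l ` {..<m l}" by auto
    then show ?thesis using False by auto
  qed
  have "total_matching m js s (j, i) = (if j \<in> set js \<and> i < m j then (j, s j i) else (j, i))"
    using Cons by auto
  then show ?case using Cons.prems by (auto simp: total_matching_Cons r)
qed

lemma total_matching_mts:
  assumes "distinct js" "\<And>j. j \<in> set js \<Longrightarrow> s j \<in> mts {..<m j}"
  shows "total_matching m js s \<in> mts {(j, i). j \<in> set js \<and> i < m j}"
  unfolding mts_def
proof (rule CollectI, intro conjI ballI allI impI)
  fix z assume "z \<in> {(j, i). j \<in> set js \<and> i < m j}"
  then obtain j i where z: "z = (j, i)" "j \<in> set js" "i < m j" by auto
  note s = mtsD[OF assms(2)[OF z(2)]]
  show "total_matching m js s z \<in> {(j, i). j \<in> set js \<and> i < m j}" "total_matching m js s z \<noteq> z"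
    "total_matching m js s (total_matching m js s z) = z"
    using z s(1)[of i] s(2)[of i] s(3)[of i] by (auto simp: total_matching_apply[OF assms])
next
  fix z assume "z \<notin> {(j, i). j \<in> set js \<and> i < m j}"
  then show "total_matching m js s z = z"
    by (cases z) (auto simp: total_matching_apply[OF assms])
qed

text \<open>Multiplying out means choosing one smoothing for each disc, which is how the sum in
  \<open>action\<close> is indexed.\<close>

lemma tensors_expand:
  assumes "distinct js" "\<And>j. j \<in> set js \<Longrightarrow> finite (S j) \<and> keys (P j) \<subseteq> S j"
  shows "tensors (map (\<lambda>j. relabel {..<m j} (Pair j) (P j)) js) =
    (\<Sum>s \<in> PiE (set js) S. single (total_matching m js s) (\<Prod>j\<in>set js. lookup (P j) (s j)))"
  using assms
proof (induction js)
  case Nil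
  then show ?case by (simp add: total_matching_def id_def)
next
  case (Cons j js)
  let ?h = "relabel_matching {..<m j} (Pair j)"
  have j: "j \<notin> set js" using Cons.prems by simp
  have IH: "tensors (map (\<lambda>j. relabel {..<m j} (Pair j) (P j)) js) =
    (\<Sum>s \<in> PiE (set js) S. single (total_matching m js s) (\<Prod>j\<in>set js. lookup (P j) (s j)))"
    using Cons by simp
  have rel: "relabel {..<m j} (Pair j) (P j) = (\<Sum>\<sigma>\<in>S j. single (?h \<sigma>) (lookup (P j) \<sigma>))"
    unfolding relabel_def using Cons.prems(2)[of j] push_superset[of "S j" "P j" ?h "\<lambda>_. 1"] by simp
  have "(\<Sum>s \<in> PiE (set (j # js)) S. single (total_matching m (j # js) s) (\<Prod>j\<in>set (j # js). lookup (P j) (s j)))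
    = (\<Sum>(\<sigma>, s) \<in> S j \<times> PiE (set js) S. single (total_matching m (j # js) (s(j := \<sigma>)))
        (\<Prod>l\<in>set (j # js). lookup (P l) ((s(j := \<sigma>)) l)))"
    unfolding list.set PiE_insert_eq
    by (subst sum.reindex[OF inj_combinator[OF j]]) (simp add: case_prod_unfold o_def)
  also have "\<dots> = (\<Sum>(\<sigma>, s) \<in> S j \<times> PiE (set js) S. single (?h \<sigma> \<circ> total_matching m js s)
        (lookup (P j) \<sigma> * (\<Prod>l\<in>set js. lookup (P l) (s l))))"
  proof (intro sum.cong refl, clarify)
    fix \<sigma> s
    have "total_matching m js (s(j := \<sigma>)) = total_matching m js s"
      by (rule total_matching_cong) (use j in auto)
    moreover have "(\<Prod>l\<in>set js. lookup (P l) ((s(j := \<sigma>)) l)) = (\<Prod>l\<in>set js. lookup (P l) (s l))"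
      by (rule prod.cong) (use j in auto)
    ultimately show "single (total_matching m (j # js) (s(j := \<sigma>))) (\<Prod>l\<in>set (j # js). lookup (P l) ((s(j := \<sigma>)) l))
      = single (?h \<sigma> \<circ> total_matching m js s) (lookup (P j) \<sigma> * (\<Prod>l\<in>set js. lookup (P l) (s l)))"
      using j by (simp add: total_matching_Cons)
  qed
  also have "\<dots> = (\<Sum>\<sigma>\<in>S j. \<Sum>s\<in>PiE (set js) S. single (?h \<sigma> \<circ> total_matching m js s)
        (lookup (P j) \<sigma> * (\<Prod>l\<in>set js. lookup (P l) (s l))))"
    by (rule sum.cartesian_product[symmetric])
  also have "\<dots> = tensors (map (\<lambda>j. relabel {..<m j} (Pair j) (P j)) (j # js))"
    unfolding list.map tensors_simps IH rel tensor_sum_left tensor_sum_right tensor_single_single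
    by (rule sum.swap)
  finally show ?case ..
qed

section \<open>Type-A diagrams\<close>

lemma involution_pairs:
  assumes "finite Z" "\<And>z. z \<in> Z \<Longrightarrow> p z \<in> Z \<and> p z \<noteq> z \<and> p (p z) = z"
  obtains M where "distinct (pair_ends M)" "set (pair_ends M) = Z" "\<And>x y. (x, y) \<in> set M \<Longrightarrow> p x = y"
proof -
  have "\<exists>M. distinct (pair_ends M) \<and> set (pair_ends M) = Z \<and> (\<forall>x y. (x, y) \<in> set M \<longrightarrow> p x = y)"
    using assms
  proof (induction Z rule: finite_psubset_induct)
    case (psubset Z)
    show ?case
    proof (cases "Z = {}")
      case True
      then show ?thesis by (intro exI[of _ "[]"]) simp
    next
      case False
      then obtain z where z: "z \<in> Z" by auto
      note pz = psubset.prems[OF z]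
      have "\<exists>M. distinct (pair_ends M) \<and> set (pair_ends M) = Z - {z, p z} \<and> (\<forall>x y. (x, y) \<in> set M \<longrightarrow> p x = y)"
      proof (rule psubset.IH)
        show "Z - {z, p z} \<subset> Z" using z by auto
        fix w assume w: "w \<in> Z - {z, p z}"
        then have "p w \<noteq> z" "p w \<noteq> p z" using psubset.prems[of w] pz by (metis DiffE insert_iff)+
        then show "p w \<in> Z - {z, p z} \<and> p w \<noteq> w \<and> p (p w) = w" using psubset.prems[of w] w by auto
      qed
      then obtain M where "distinct (pair_ends M)" "set (pair_ends M) = Z - {z, p z}" "\<forall>x y. (x, y) \<in> set M \<longrightarrow> p x = y"
        by blast
      then show ?thesis using z pz by (intro exI[of _ "(z, p z) # M"]) auto
    qed
  qed
  then show thesis using that by blast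
qed

lemma card_arc_ends:
  assumes "well_formed D" and fin: "finite (arc_ends D)"
  shows "card (arc_ends D) = 2 * card (arcs D)"
proof -
  let ?p = "partner D"
  have p: "?p x \<in> arc_ends D" "?p x \<noteq> x" "?p (?p x) = x" if "x \<in> arc_ends D" for x
    using assms(1) that unfolding well_formed_def by blast+
  have U: "\<Union> (arcs D) = arc_ends D"
    unfolding arcs_def using p(1) by blast
  have "2 * card (arcs D) = card (\<Union> (arcs D))"
  proof (rule card_partition)
    show "finite (arcs D)" using fin by (simp add: arcs_def)
    show "finite (\<Union> (arcs D))" using fin U by simp
    fix c assume "c \<in> arcs D"
    then obtain x where "c = {x, ?p x}" "x \<in> arc_ends D" unfolding arcs_def by blast
    then show "card c = 2" using p(2)[of x] by (metis card_2_iff)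
  next
    fix c1 c2 assume c: "c1 \<in> arcs D" "c2 \<in> arcs D" "c1 \<noteq> c2"
    have c_eq: "c = {z, ?p z}" if "c \<in> arcs D" "z \<in> c" for c z
    proof -
      obtain x where x: "c = {x, ?p x}" "x \<in> arc_ends D" using \<open>c \<in> arcs D\<close> unfolding arcs_def by blast
      have "z = x \<or> z = ?p x" using x(1) \<open>z \<in> c\<close> by blast
      then show ?thesis using x(1) p(3)[OF x(2)] by (elim disjE) (simp_all add: insert_commute)
    qed
    show "c1 \<inter> c2 = {}"
    proof (rule ccontr)
      assume "c1 \<inter> c2 \<noteq> {}"
      then obtain z where "z \<in> c1" "z \<in> c2" by blast
      then show False using c_eq[OF c(1)] c_eq[OF c(2)] c(3) by metis
    qed
  qed
  then show ?thesis using U by simp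
qed

locale input_diagram =
  fixes D :: diagram and k :: "nat \<Rightarrow> nat" and K :: nat
  assumes A: "type_A D" and inputs: "1 \<le> num_inputs D"
    and num_ends: "\<And>j. 1 \<le> j \<Longrightarrow> j \<le> num_inputs D \<Longrightarrow> num_ends D j = 2 * k j \<and> 1 \<le> k j"
    and num_ends_0: "num_ends D 0 = 2 * K"
begin

abbreviation "js \<equiv> [1..<Suc (num_inputs D)]"
abbreviation "circle j \<equiv> map (Pair j) [0..<num_ends D j]"
abbreviation "LL \<equiv> map circle js"
abbreviation "X0 \<equiv> rev (circle 0)"
definition "I = {(j, i). j \<in> set js \<and> i < num_ends D j}"
definition "E = Pair (0 :: nat) ` {..<2 * K}"
abbreviation "p \<equiv> partner D"
abbreviation "inp \<equiv> (\<lambda>x. \<not> tail D x)"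

lemma I_iff [simp]: "(j, i) \<in> I \<longleftrightarrow> 1 \<le> j \<and> j \<le> num_inputs D \<and> i < num_ends D j"
  by (auto simp: I_def)

lemma E_iff [simp]: "(j, i) \<in> E \<longleftrightarrow> j = 0 \<and> i < 2 * K"
  by (auto simp: E_def)

lemma set_LL: "set (concat LL) = I"
  by (auto simp: I_def)

lemma set_X0: "set X0 = E"
  using num_ends_0 by (auto simp: E_def lessThan_atLeast0)

lemma arc_ends_eq: "arc_ends D = I \<union> E"
proof (intro equalityI subsetI)
  fix x assume "x \<in> arc_ends D"
  then show "x \<in> I \<union> E" using num_ends_0 by (cases x; cases "fst x = 0") (auto simp: arc_ends_def)
next
  fix x assume "x \<in> I \<union> E"
  then show "x \<in> arc_ends D" using num_ends_0 by (cases x) (auto simp: arc_ends_def)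
qed

lemma finite_I: "finite I"
  using set_LL by (metis List.finite_set)

lemma finite_E: "finite E"
  by (simp add: E_def)

lemma disj: "I \<inter> E = {}"
  by (auto simp: E_def)

lemma well_formed: "x \<in> I \<union> E \<Longrightarrow> p x \<in> I \<union> E" "x \<in> I \<union> E \<Longrightarrow> p x \<noteq> x" "x \<in> I \<union> E \<Longrightarrow> p (p x) = x"
  using A unfolding type_A_def well_formed_def arc_ends_eq by blast+

lemma K_pos: "1 \<le> K"
  using A num_ends_0 unfolding type_A_def by auto

lemma card_arcs: "card (arc_ends D) = 2 * card (arcs D)"
  by (rule card_arc_ends) (use A finite_I finite_E in \<open>auto simp: type_A_def arc_ends_eq\<close>)

text \<open>The external circle is not among the pieces of the connectedness condition. An arc from
  it to itself would therefore meet no other piece and be cut off from the circle of the first input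
  disc.\<close>

lemma ext_partner:
  assumes "x \<in> E"
  shows "p x \<in> I"
proof (rule ccontr)
  assume "p x \<notin> I"
  then have px: "p x \<in> E" using well_formed(1)[of x] assms by auto
  define F where "F = arcs D \<union> input_circles D"
  define T where "T = {x, p x}"
  have T: "T \<in> F" using assms by (auto simp: F_def T_def arcs_def arc_ends_eq)
  define C where "C = {1 :: nat} \<times> {..<num_ends D 1}"
  have C: "C \<in> F" using inputs by (auto simp: F_def C_def input_circles_def)
  have "(T, C) \<in> {(X, Y). X \<in> F \<and> Y \<in> F \<and> X \<inter> Y \<noteq> {}}\<^sup>*"
    using A T C unfolding type_A_def connected_pieces_def F_def by blast
  moreover have "B = T" if "(T, B) \<in> {(X, Y). X \<in> F \<and> Y \<in> F \<and> X \<inter> Y \<noteq> {}}\<^sup>*" for B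
    using that
  proof (induction rule: rtrancl_induct)
    case (step B B')
    then have B': "B' \<in> F" "T \<inter> B' \<noteq> {}" by auto
    have "B' \<notin> input_circles D" using B'(2) assms px by (auto simp: T_def input_circles_def E_def)
    then obtain y where y: "B' = {y, p y}" "y \<in> I \<union> E" using B'(1) by (auto simp: F_def arcs_def arc_ends_eq)
    have "p (p x) = x" "p (p y) = y" using well_formed(3) y(2) assms by blast+
    moreover have "y = x \<or> y = p x \<or> p y = x \<or> p y = p x" using B'(2) y(1) by (auto simp: T_def)
    ultimately have "y = x \<or> y = p x" by metis
    then show "B' = T"
    proof
      assume "y = p x"
      then show ?thesis unfolding y(1) T_def using \<open>p (p x) = x\<close> by (simp add: insert_commute)
    qed (simp add: y(1) T_def)
  qed simp
  ultimately have "C = T" by blast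
  then have "x \<in> C" by (simp add: T_def)
  then have "fst x = 1" by (auto simp: C_def)
  then show False using assms by (auto simp: E_def)
qed

lemma backward_circle:
  assumes "0 < m" "\<And>i. Suc i < m \<Longrightarrow> n (j, Suc i) = (j, i)" "n (j, 0) = (j, m - 1)"
  shows "backward n (map (Pair j) [0..<m])"
  unfolding backward_def
proof (intro conjI allI impI)
  fix us a b vs assume *: "map (Pair j) [0..<m] = us @ a # b # vs"
  have l: "length us + 2 \<le> m" using arg_cong[OF *, of length] by simp
  have "(us @ a # b # vs) ! length us = (j, length us)" unfolding *[symmetric] using l by simp
  moreover have "(us @ a # b # vs) ! Suc (length us) = (j, Suc (length us))" unfolding *[symmetric] using l by simp
  ultimately have "a = (j, length us)" "b = (j, Suc (length us))" by (simp_all add: nth_append)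
  then show "n b = a" using assms(2) l by simp
next
  show "n (hd (map (Pair j) [0..<m])) = last (map (Pair j) [0..<m])"
    using assms(1,3) by (simp add: hd_map last_map)
qed

lemma backward_rev_circle:
  assumes "0 < m" "\<And>i. Suc i < m \<Longrightarrow> n (j, i) = (j, Suc i)" "n (j, m - 1) = (j, 0)"
  shows "backward n (rev (map (Pair j) [0..<m]))"
  unfolding backward_def
proof (intro conjI allI impI)
  fix us a b vs assume "rev (map (Pair j) [0..<m]) = us @ a # b # vs"
  from arg_cong[OF this, of rev] have *: "map (Pair j) [0..<m] = rev vs @ b # a # rev us" by simp
  have l: "length vs + 2 \<le> m" using arg_cong[OF *, of length] by simp
  have "(rev vs @ b # a # rev us) ! length vs = (j, length vs)" unfolding *[symmetric] using l by simp
  moreover have "(rev vs @ b # a # rev us) ! Suc (length vs) = (j, Suc (length vs))" unfolding *[symmetric] using l by simp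
  ultimately have "b = (j, length vs)" "a = (j, Suc (length vs))" by (simp_all add: nth_append)
  then show "n b = a" using assms(2) l by simp
next
  show "n (hd (rev (map (Pair j) [0..<m]))) = last (rev (map (Pair j) [0..<m]))"
    using assms(1,3) by (simp add: hd_rev last_rev hd_map last_map)
qed

lemma state: "planar_state LL X0 (next_end D) p"
proof (rule planar_stateI, unfold set_LL set_X0)
  show "distinct (concat LL @ X0)"
  proof -
    have "distinct (concat (map circle xs))" if "distinct xs" for xs
      using that by (induction xs) (auto simp: distinct_map inj_on_def)
    then have "distinct (concat LL)" by simp
    moreover have "distinct X0" by (simp add: distinct_map inj_on_def)
    ultimately show ?thesis using disj set_LL set_X0 by (simp only: distinct_append)
  qed
next
  fix L assume "L \<in> set LL"
  then obtain j where j: "L = circle j" "1 \<le> j" "j \<le> num_inputs D" by auto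
  have m: "2 \<le> num_ends D j" using num_ends[OF j(2,3)] by auto
  then show "2 \<le> length L" using j by simp
  show "backward (next_end D) L"
    unfolding j(1) by (rule backward_circle) (use m j(2) in auto)
next
  show "backward (next_end D) X0"
    by (rule backward_rev_circle) (use num_ends_0 K_pos in auto)
  show "2 \<le> length X0" using num_ends_0 K_pos by simp
next
  show "2 * (length LL + 1 + card (orbits (I \<union> E) (next_end D \<circ> p))) = card (I \<union> E) + 4"
  proof -
    have "faces D = orbits (I \<union> E) (next_end D \<circ> p)"
      by (simp add: faces_def orbits_def graph_of_def arc_ends_eq)
    moreover have "planar D" using A by (simp add: type_A_def)
    ultimately show ?thesis using card_arcs by (simp add: planar_def arc_ends_eq)
  qed
next
  fix S assume S: "S \<subseteq> I" "\<And>L. L \<in> set LL \<Longrightarrow> set L \<subseteq> S \<or> set L \<inter> S = {}" "\<And>x. x \<in> S \<Longrightarrow> p x \<in> I \<Longrightarrow> p x \<in> S"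
  define F where "F = arcs D \<union> input_circles D"
  \<comment> \<open>Connectedness of the diagram is about arcs and circles, not about ends. Adding
    to \<open>S\<close> the external ends joined to it makes every arc and every input circle lie
    inside or outside.\<close>
  define T where "T = S \<union> {z \<in> E. p z \<in> S}"
  show "S = {} \<or> S = I"
  proof (cases "S = {}")
    case False
    have circ: "{j} \<times> {..<num_ends D j} \<subseteq> S \<or> ({j} \<times> {..<num_ends D j}) \<inter> S = {}" if "j \<in> {1..num_inputs D}" for j
    proof -
      have "set (circle j) = {j} \<times> {..<num_ends D j}" by auto
      moreover have "circle j \<in> set LL" using that unfolding set_map by (intro imageI, simp, linarith)
      ultimately show ?thesis using S(2)[of "circle j"] by (simp only:)
    qed
    have piece: "B \<subseteq> T \<or> B \<inter> T = {}" if "B \<in> F" for B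
    proof (cases "B \<in> input_circles D")
      case True
      then obtain j where j: "j \<in> {1..num_inputs D}" "B = {j} \<times> {..<num_ends D j}" by (auto simp: input_circles_def)
      have "B \<inter> E = {}" using j by (auto simp: E_def)
      moreover have "B \<subseteq> S \<or> B \<inter> S = {}" using circ[OF j(1)] j(2) by simp
      ultimately show ?thesis unfolding T_def by blast
    next
      case False
      then have "B \<in> arcs D" using that unfolding F_def by blast
      then obtain y where y: "B = {y, p y}" "y \<in> I \<union> E" unfolding arcs_def arc_ends_eq by blast
      have "p z \<in> T" if "z \<in> T" for z
      proof (cases "z \<in> S")
        case True
        then have z: "z \<in> I \<union> E" using S(1) by auto
        show ?thesis
        proof (cases "p z \<in> I")
          case True
          then show ?thesis using S(3) \<open>z \<in> S\<close> by (auto simp: T_def)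
        next
          case False
          then have "p z \<in> E" using well_formed(1)[OF z] by auto
          then show ?thesis using well_formed(3)[OF z] \<open>z \<in> S\<close> by (simp add: T_def)
        qed
      next
        case False
        then show ?thesis using that by (auto simp: T_def)
      qed
      then have "y \<in> T \<longleftrightarrow> p y \<in> T" using well_formed(3)[OF y(2)] by metis
      then show ?thesis using y by auto
    qed
    obtain j0 i0 where ji: "(j0, i0) \<in> S" using False by auto
    define C0 where "C0 = {j0} \<times> {..<num_ends D j0}"
    have "(j0, i0) \<in> I" using ji S(1) by blast
    then have j0: "j0 \<in> {1..num_inputs D}" "(j0, i0) \<in> C0" by (auto simp: C0_def)
    have C0: "C0 \<in> F" "C0 \<subseteq> T"
      using j0 circ[OF j0(1)] ji by (auto simp: F_def input_circles_def C0_def T_def)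
    have reach: "B \<subseteq> T" if "(C0, B) \<in> {(X, Y). X \<in> F \<and> Y \<in> F \<and> X \<inter> Y \<noteq> {}}\<^sup>*" for B
      using that
    proof (induction rule: rtrancl_induct)
      case (step B B')
      then show ?case using piece[of B'] by auto
    qed (rule C0(2))
    have "I \<subseteq> S"
    proof
      fix x assume x: "x \<in> I"
      then obtain j i where ji: "x = (j, i)" "j \<in> {1..num_inputs D}" "i < num_ends D j" by (cases x) auto
      define C where "C = {j} \<times> {..<num_ends D j}"
      have "C \<in> F" using ji by (auto simp: F_def input_circles_def C_def)
      then have "(C0, C) \<in> {(X, Y). X \<in> F \<and> Y \<in> F \<and> X \<inter> Y \<noteq> {}}\<^sup>*"
        using A C0(1) unfolding type_A_def connected_pieces_def F_def by blast
      then have "C \<subseteq> T" by (rule reach)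
      then have "x \<in> T" using ji by (auto simp: C_def)
      then show "x \<in> S" using x disj by (auto simp: T_def)
    qed
    then show ?thesis using S(1) by auto
  qed simp
next
  fix x assume "x \<in> I \<union> E"
  then show "p x \<in> I \<union> E \<and> p x \<noteq> x \<and> p (p x) = x" using well_formed by blast
next
  fix x assume "x \<in> E"
  then show "p x \<in> I" by (rule ext_partner)
qed

lemma tail_partner: "x \<in> I \<union> E \<Longrightarrow> tail D (p x) \<longleftrightarrow> \<not> tail D x"
  using A unfolding type_A_def arc_ends_eq by blast

lemma tail_alternates:
  assumes "j \<le> num_inputs D" "i < num_ends D j"
  shows "tail D (j, i) \<longleftrightarrow> (even i \<longleftrightarrow> tail D (j, 0))"
  using assms(2)
proof (induction i)
  case (Suc i)
  then have "tail D (j, (i + 1) mod num_ends D j) \<longleftrightarrow> \<not> tail D (j, i)"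
    using A assms(1) unfolding type_A_def by (meson Suc_lessD)
  then show ?case using Suc by (auto simp: mod_less)
qed simp

lemma inp_input: "1 \<le> j \<Longrightarrow> j \<le> num_inputs D \<Longrightarrow> i < num_ends D j \<Longrightarrow> inp (j, i) \<longleftrightarrow> in_point (pattern D j) i"
  using tail_alternates[of j i] by (auto simp: pattern_def in_point_def)

lemma inp_external: "i < 2 * K \<Longrightarrow> inp (p (0, i)) \<longleftrightarrow> in_point (pattern D 0) i"
  using tail_alternates[of 0 i] tail_partner[of "(0, i)"] num_ends_0 by (auto simp: pattern_def in_point_def)

text \<open>The input ends that are connected to the outside. The result of all closures is a
  matching of these ends; \<open>external\<close> renumbers them by the external circle.\<close>

definition "Y = p ` E"

definition external :: "arc_end \<Rightarrow> nat" where
  "external y = snd (p y)"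

lemma external_partner [simp]: "i < 2 * K \<Longrightarrow> external (p (0, i)) = i"
  using well_formed(3)[of "(0, i)"] by (simp add: external_def)

lemma Y_mem: "i < 2 * K \<Longrightarrow> p (0, i) \<in> Y"
  by (simp add: Y_def)

lemma Y_cases:
  assumes "y \<in> Y"
  obtains i where "i < 2 * K" "y = p (0, i)"
  using assms by (auto simp: Y_def E_def)

lemma inj_external: "inj_on external Y"
  by (rule inj_onI) (metis Y_cases external_partner)

lemma Y_eq: "Y = {x \<in> I. p x \<notin> I}"
proof (intro equalityI subsetI)
  fix y assume "y \<in> Y"
  then obtain e where e: "y = p e" "e \<in> E" by (auto simp: Y_def)
  then have "y \<in> I" "p y = e" using ext_partner well_formed(3)[of e] by auto
  then show "y \<in> {x \<in> I. p x \<notin> I}" using e(2) disj by blast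
next
  fix y assume y: "y \<in> {x \<in> I. p x \<notin> I}"
  then have "p y \<in> E" "p (p y) = y" using well_formed(1)[of y] well_formed(3)[of y] by blast+
  then show "y \<in> Y" unfolding Y_def by (metis image_eqI)
qed

section \<open>Components of the inserted curve, expressed by closures\<close>

context
  fixes M :: "(arc_end \<times> arc_end) list" and s :: "nat \<Rightarrow> nat \<Rightarrow> nat"
  assumes M: "distinct (pair_ends M)" "set (pair_ends M) = {x \<in> I. p x \<in> I}" "\<And>x y. (x, y) \<in> set M \<Longrightarrow> p x = y"
    and s: "\<And>j. j \<in> set js \<Longrightarrow> s j \<in> mts {..<num_ends D j}"
begin

abbreviation "tot \<equiv> total_matching (num_ends D) js s"

lemma tot: "tot \<in> mts I"
  unfolding I_def by (rule total_matching_mts) (use s in auto)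

lemma pair_partner:
  assumes "(a, b) \<in> set M"
  shows "a \<in> I" "b \<in> I" "p a = b" "p b = a"
proof -
  have "a \<in> set (pair_ends M)" "b \<in> set (pair_ends M)"
    unfolding set_pair_ends using assms by (auto intro: rev_image_eqI)
  then show "a \<in> I" "b \<in> I" unfolding M(2) by auto
  show pa: "p a = b" by (rule M(3)[OF assms])
  show "p b = a" using well_formed(3)[of a] \<open>a \<in> I\<close> unfolding pa by simp
qed

lemma set_pairs: "set M \<union> (set M)\<inverse> = {(x, p x) | x. x \<in> I \<and> p x \<in> I}"
proof (intro equalityI subsetI)
  fix e assume "e \<in> set M \<union> (set M)\<inverse>"
  then obtain a b where ab: "(a, b) \<in> set M" "e = (a, b) \<or> e = (b, a)" by (cases e) blast
  have "e = (a, p a) \<or> e = (b, p b)" using ab(2) pair_partner(3,4)[OF ab(1)] by simp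
  moreover have "p a \<in> I" "p b \<in> I" using pair_partner[OF ab(1)] by simp_all
  ultimately show "e \<in> {(x, p x) | x. x \<in> I \<and> p x \<in> I}" using pair_partner(1,2)[OF ab(1)] by blast
next
  fix e assume "e \<in> {(x, p x) | x. x \<in> I \<and> p x \<in> I}"
  then obtain x where x: "e = (x, p x)" "x \<in> I" "p x \<in> I" by blast
  then have "x \<in> set (pair_ends M)" unfolding M(2) by simp
  then obtain a b where ab: "(a, b) \<in> set M" "x = a \<or> x = b" by (auto simp: set_pair_ends)
  then show "e \<in> set M \<union> (set M)\<inverse>" using x(1) pair_partner[OF ab(1)] by auto
qed

abbreviation "glued \<equiv> {(x, p x) | x. x \<in> arc_ends D} \<union> graph_of I tot"

lemma same_component_eq: "same_component D s = glued\<^sup>*"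
proof -
  have "{((j, i), (j, s j i)) | j i. j \<in> {1..num_inputs D} \<and> i < num_ends D j} = graph_of I tot"
  proof -
    have "tot (j, i) = (j, s j i)" if "j \<in> {1..num_inputs D}" "i < num_ends D j" for j i
      using that total_matching_apply[of js s "num_ends D" j i] s by auto
    then show ?thesis by (auto simp: graph_of_def intro!: exI)
  qed
  then show ?thesis unfolding same_component_def by simp
qed

text \<open>An external end is incident with one arc only, so a path through it turns back at once.
  In the induction such an end is represented by its partner.\<close>

lemma glued_links: "glued\<^sup>* \<inter> I \<times> I = (links I tot M)\<^sup>* \<inter> I \<times> I"
proof -
  let ?L = "links I tot M"
  have L: "?L = graph_of I tot \<union> {(x, p x) | x. x \<in> I \<and> p x \<in> I}"
    unfolding links_def set_pairs[symmetric] by (simp add: Un_assoc)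
  have "?L \<subseteq> glued" unfolding L arc_ends_eq by blast
  then have 1: "?L\<^sup>* \<subseteq> glued\<^sup>*" by (rule rtrancl_mono)
  have "(v \<in> I \<longrightarrow> (u, v) \<in> ?L\<^sup>*) \<and> (v \<in> E \<longrightarrow> (u, p v) \<in> ?L\<^sup>*)" if "(u, v) \<in> glued\<^sup>*" "u \<in> I" for u v
    using that
  proof (induction rule: rtrancl_induct)
    case base
    then show ?case using disj by blast
  next
    case (step v w)
    note IH = step.IH[OF step.prems]
    from step.hyps(2) consider "v \<in> I" "w = p v" | "v \<in> E" "w = p v" | "v \<in> I" "w = tot v"
      unfolding arc_ends_eq graph_of_def by blast
    then show ?case
    proof cases
      case 1
      have pw: "p w = v" using well_formed(3)[of v] 1 by blast
      show ?thesis
      proof (cases "w \<in> I")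
        case True
        then have "(v, w) \<in> ?L" using 1 unfolding L by blast
        then show ?thesis using IH 1 True disj by (blast intro: rtrancl_into_rtrancl)
      next
        case False
        then show ?thesis using IH 1 pw by simp
      qed
    next
      case 2
      then have "w \<in> I" using ext_partner by blast
      then show ?thesis using IH 2 disj by blast
    next
      case 3
      then have "w \<in> I" "(v, w) \<in> ?L" using mtsD(1)[OF tot] unfolding L graph_of_def by blast+
      then show ?thesis using IH 3 disj by (blast intro: rtrancl_into_rtrancl)
    qed
  qed
  then show ?thesis using 1 by blast
qed

lemma Y_pairs: "I - set (pair_ends M) = Y"
  unfolding M(2) Y_eq by blast

lemma pairs_sub: "set (pair_ends M) \<subseteq> I"
  unfolding M(2) by blast

lemma result_mts: "close_pairs M tot \<in> mts Y"
  using close_pairs_mts[OF tot pairs_sub M(1)] unfolding Y_pairs .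

lemma insertion_eq: "insertion D s = relabel_matching Y external (close_pairs M tot)"
proof
  fix i
  let ?\<rho> = "close_pairs M tot"
  note r = mtsD[OF result_mts]
  have img: "external ` Y = {..<2 * K}"
  proof (intro equalityI subsetI)
    fix i assume "i \<in> {..<2 * K}"
    then have "i = external (p (0, i))" "p (0, i) \<in> Y" using Y_mem by simp_all
    then show "i \<in> external ` Y" by blast
  next
    fix i assume "i \<in> external ` Y"
    then obtain y where "y \<in> Y" "i = external y" by blast
    then show "i \<in> {..<2 * K}" by (metis Y_cases external_partner lessThan_iff)
  qed
  show "insertion D s i = relabel_matching Y external ?\<rho> i"
  proof (cases "i < 2 * K")
    case True
    define y where "y = p (0, i)"
    have yY: "y \<in> Y" using Y_mem[OF True] by (simp add: y_def)
    obtain i' where i': "i' < 2 * K" "?\<rho> y = p (0, i')" using r(1)[OF yY] by (rule Y_cases)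
    have comp: "((0, i), (0, l)) \<in> same_component D s \<longleftrightarrow> l = i \<or> l = i'" if l: "l < 2 * K" for l
    proof -
      have lY: "p (0, l) \<in> Y" by (rule Y_mem[OF l])
      have I: "y \<in> I" "p (0, l) \<in> I" using yY lY Y_eq by blast+
      have e: "(0, i) \<in> I \<union> E" "(0, l) \<in> I \<union> E" using True l by auto
      have gp: "(x, p x) \<in> glued" if "x \<in> I \<union> E" for x
        using that unfolding arc_ends_eq by blast
      have g: "((0, i), y) \<in> glued" "(y, (0, i)) \<in> glued" "((0, l), p (0, l)) \<in> glued" "(p (0, l), (0, l)) \<in> glued"
        using gp[OF e(1)] gp[OF e(2)] gp[of y] gp[of "p (0, l)"] I well_formed(3)[OF e(1)] well_formed(3)[OF e(2)]
        by (simp_all only: y_def UnI1)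
      have "((0, i), (0, l)) \<in> glued\<^sup>* \<longleftrightarrow> (y, p (0, l)) \<in> glued\<^sup>*"
        using g by (meson converse_rtrancl_into_rtrancl rtrancl_into_rtrancl)
      also have "\<dots> \<longleftrightarrow> (y, p (0, l)) \<in> (links I tot M)\<^sup>*" using glued_links I by blast
      also have "\<dots> \<longleftrightarrow> p (0, l) = y \<or> p (0, l) = ?\<rho> y"
        using links_components(1)[OF tot pairs_sub M(1) finite_I] yY lY unfolding Y_pairs by blast
      also have "\<dots> \<longleftrightarrow> l = i \<or> l = i'"
        unfolding i'(2) unfolding y_def using external_partner[OF l] external_partner[OF True] external_partner[OF i'(1)] by metis
      finally show ?thesis unfolding same_component_eq .
    qed
    have ne: "i' \<noteq> i" using r(2)[OF yY] i'(2) by (auto simp: y_def)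
    have "insertion D s i = (THE l. l < 2 * K \<and> l \<noteq> i \<and> ((0, i), (0, l)) \<in> same_component D s)"
      using True num_ends_0 by (simp add: insertion_def)
    also have "\<dots> = i'" by (rule the_equality) (use comp i' ne in auto)
    also have "\<dots> = external (?\<rho> y)" using i' by simp
    also have "\<dots> = relabel_matching Y external ?\<rho> (external y)"
      using relabel_matching_image[OF inj_external yY] by simp
    finally show ?thesis using True by (simp add: y_def)
  next
    case False
    then have "i \<notin> external ` Y" unfolding img by simp
    then show ?thesis using False num_ends_0 by (simp add: insertion_def)
  qed
qed

lemma num_loops_eq: "num_loops D s = loops M tot"
proof -
  let ?A = "I \<union> E"
  let ?R = "glued\<^sup>* \<inter> ?A \<times> ?A"
  have sub: "glued \<subseteq> ?A \<times> ?A"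
    unfolding arc_ends_eq graph_of_def using well_formed(1) mtsD(1)[OF tot] by blast
  have sym: "sym glued"
    unfolding sym_def arc_ends_eq graph_of_def using well_formed(1,3) mtsD(1,3)[OF tot] by fastforce
  have E: "equiv ?A ?R" by (rule sym_rtrancl_equiv[OF sym])
  have q: "?A // glued\<^sup>* = ?A // ?R" by (rule quotient_rtrancl[OF sub])
  have fin: "finite ?A" using finite_I finite_E by simp
  have YI: "Y \<subseteq> I" unfolding Y_eq by blast
  have RI: "?R \<inter> I \<times> I = (links I tot M)\<^sup>* \<inter> I \<times> I" using glued_links by blast
  have closed: "p x \<in> C" if "C \<in> ?A // ?R" "x \<in> C" for C x
  proof -
    have x: "x \<in> ?A" using in_quotient_imp_subset[OF E that(1)] that(2) by blast
    then have "(x, p x) \<in> ?R" using well_formed(1)[OF x] unfolding arc_ends_eq by blast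
    moreover have "C = ?R `` {x}" by (rule quotient_class[OF E that])
    ultimately show ?thesis by blast
  qed
  \<comment> \<open>Components are closed under \<open>p\<close>. So a component has an external end
    iff it contains an end in \<open>Y\<close>, and a component without external ends lies entirely
    in \<open>I\<close>.\<close>
  have "{C \<in> ?A // ?R. \<forall>x\<in>C. fst x \<noteq> 0} = {C \<in> ?A // ?R. C \<inter> I \<noteq> {} \<and> C \<inter> Y = {}}"
  proof (intro equalityI subsetI)
    fix C assume C: "C \<in> {C \<in> ?A // ?R. \<forall>x\<in>C. fst x \<noteq> 0}"
    then have C': "C \<in> ?A // ?R" by blast
    have sub: "C \<subseteq> ?A" "C \<noteq> {}" using in_quotient_imp_subset[OF E C'] in_quotient_imp_non_empty[OF E C'] .
    have noE: "C \<inter> E = {}" using C by (force simp: E_def)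
    have "C \<inter> Y = {}"
    proof (rule ccontr)
      assume "C \<inter> Y \<noteq> {}"
      then obtain y where y: "y \<in> C" "y \<in> Y" by blast
      then have "p y \<in> C" using closed[OF C'] by blast
      moreover have "p y \<in> E" using y(2) well_formed(1)[of y] unfolding Y_eq by blast
      ultimately show False using noE by blast
    qed
    then show "C \<in> {C \<in> ?A // ?R. C \<inter> I \<noteq> {} \<and> C \<inter> Y = {}}" using C' sub noE by blast
  next
    fix C assume C: "C \<in> {C \<in> ?A // ?R. C \<inter> I \<noteq> {} \<and> C \<inter> Y = {}}"
    then have C': "C \<in> ?A // ?R" by blast
    have "x \<notin> E" if "x \<in> C" for x
      using closed[OF C' that] C unfolding Y_def by blast
    then have "C \<subseteq> I" using in_quotient_imp_subset[OF E C'] by blast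
    then have "\<forall>x\<in>C. fst x \<noteq> 0" by (auto simp: I_def)
    then show "C \<in> {C \<in> ?A // ?R. \<forall>x\<in>C. fst x \<noteq> 0}" using C' by blast
  qed
  then have "num_loops D s = card {C \<in> ?A // ?R. C \<inter> I \<noteq> {} \<and> C \<inter> Y = {}}"
    unfolding num_loops_def same_component_eq unfolding arc_ends_eq unfolding q[unfolded arc_ends_eq] by (rule arg_cong)
  also have "\<dots> = card {C \<in> I // (?R \<inter> I \<times> I). C \<inter> Y = {}}"
    by (rule card_quotient_restrict[OF E fin _ YI, symmetric]) blast
  also have "\<dots> = loops M tot"
    unfolding RI using links_components(2)[OF tot pairs_sub M(1) finite_I] unfolding Y_pairs .
  finally show ?thesis .
qed

end

text \<open>The action is a state sum over smoothings of all discs. Expanding the product of the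
  inputs term by term gives the same sum, since closures compute both the induced matching and the
  number of loops.\<close>

lemma action_eq:
  assumes M: "distinct (pair_ends M)" "set (pair_ends M) = {x \<in> I. p x \<in> I}" "\<And>x y. (x, y) \<in> set M \<Longrightarrow> p x = y"
    and P: "\<And>j. j \<in> set js \<Longrightarrow> keys (P j) \<subseteq> smoothings (num_ends D j div 2) (pattern D j)"
  shows "action D P = relabel Y external (cls M (tensors (map (\<lambda>j. relabel {..<num_ends D j} (Pair j) (P j)) js)))"
proof -
  let ?S = "\<lambda>j. smoothings (num_ends D j div 2) (pattern D j)"
  have S: "\<sigma> \<in> mts {..<num_ends D j}" if "\<sigma> \<in> ?S j" "j \<in> set js" for \<sigma> j
    using smoothing_mts[OF that(1)] num_ends[of j] that(2) by auto
  have js: "set js = {1..num_inputs D}" by auto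
  have T: "tensors (map (\<lambda>j. relabel {..<num_ends D j} (Pair j) (P j)) js) =
    (\<Sum>s \<in> PiE (set js) ?S. single (total_matching (num_ends D) js s) (\<Prod>j\<in>set js. lookup (P j) (s j)))"
    by (rule tensors_expand) (use P smoothings_finite in auto)
  have "relabel Y external (cls M (tensors (map (\<lambda>j. relabel {..<num_ends D j} (Pair j) (P j)) js))) =
    (\<Sum>s \<in> PiE (set js) ?S. single (relabel_matching Y external (close_pairs M (total_matching (num_ends D) js s)))
      ((\<Prod>j\<in>set js. lookup (P j) (s j)) * loop_value ^ loops M (total_matching (num_ends D) js s)))"
    unfolding T cls_sum cls_single unfolding relabel_def push_sum push_single mult_1_right ..
  also have "\<dots> = (\<Sum>s \<in> PiE (set js) ?S. single (insertion D s)
      ((\<Prod>j\<in>set js. lookup (P j) (s j)) * loop_value ^ num_loops D s))"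
  proof (rule sum.cong[OF refl])
    fix s assume "s \<in> PiE (set js) ?S"
    then have s: "s j \<in> mts {..<num_ends D j}" if "j \<in> set js" for j using S that by blast
    show "single (relabel_matching Y external (close_pairs M (total_matching (num_ends D) js s)))
      ((\<Prod>j\<in>set js. lookup (P j) (s j)) * loop_value ^ loops M (total_matching (num_ends D) js s)) =
      single (insertion D s) ((\<Prod>j\<in>set js. lookup (P j) (s j)) * loop_value ^ num_loops D s)"
      using insertion_eq[OF M s] num_loops_eq[OF M s] by simp
  qed
  also have "\<dots> = action D P" unfolding action_def js ..
  finally show ?thesis ..
qed

lemma scoh_action:
  assumes P: "\<And>j. j \<in> set js \<Longrightarrow> keys (P j) \<subseteq> smoothings (num_ends D j div 2) (pattern D j)"
    and sc: "\<And>j. j \<in> set js \<Longrightarrow> \<exists>\<kappa>. scoh (in_point (pattern D j)) [0..<num_ends D j] \<kappa> (P j)"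
  shows "\<exists>\<kappa>. scoh (in_point (pattern D 0)) [0..<2 * K] \<kappa> (action D P)"
proof -
  let ?Ps = "map (\<lambda>j. relabel {..<num_ends D j} (Pair j) (P j)) js"
  have "p z \<in> {x \<in> I. p x \<in> I} \<and> p z \<noteq> z \<and> p (p z) = z" if "z \<in> {x \<in> I. p x \<in> I}" for z
    using that well_formed(2)[of z] well_formed(3)[of z] by auto
  moreover have "finite {x \<in> I. p x \<in> I}" using finite_I by simp
  ultimately obtain M where M: "distinct (pair_ends M)" "set (pair_ends M) = {x \<in> I. p x \<in> I}"
    "\<And>x y. (x, y) \<in> set M \<Longrightarrow> p x = y"
    using involution_pairs[of "{x \<in> I. p x \<in> I}" p] by blast
  have "\<exists>\<kappa>. scoh inp (map p (rev X0)) \<kappa> (cls M (tensors ?Ps))"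
  proof (rule scoh_planar[OF state])
    show "LL \<noteq> []" using inputs by simp
    show "list_all2 (\<lambda>L P. \<exists>\<kappa>. scoh inp L \<kappa> P) LL ?Ps"
      unfolding list_all2_map1 list_all2_map2 list_all2_same
    proof
      fix j assume j: "j \<in> set js"
      then obtain \<kappa> where "scoh (in_point (pattern D j)) [0..<num_ends D j] \<kappa> (P j)" using sc by blast
      then have "scoh inp (map (Pair j) [0..<num_ends D j]) \<kappa> (relabel {..<num_ends D j} (Pair j) (P j))"
      proof (rule scoh_relabel)
        fix i assume "i \<in> {..<num_ends D j}"
        then show "inp (j, i) = in_point (pattern D j) i" using inp_input[of j i] j by auto
      qed (auto simp: inj_on_def)
      then show "\<exists>\<kappa>. scoh inp (circle j) \<kappa> (relabel {..<num_ends D j} (Pair j) (P j))" by blast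
    qed
    show "set (pair_ends M) = {x \<in> set (concat LL). p x \<in> set (concat LL)}"
      unfolding set_LL by (rule M(2))
    show "inp (p x) \<noteq> inp x" if "x \<in> set (concat LL)" for x
      using tail_partner[of x] that unfolding set_LL by blast
  qed (use M in auto)
  then obtain \<kappa> where k: "scoh inp (map p (circle 0)) \<kappa> (cls M (tensors ?Ps))" by auto
  have "scoh (in_point (pattern D 0)) (map external (map p (circle 0))) \<kappa> (relabel Y external (cls M (tensors ?Ps)))"
  proof (rule scoh_relabel[OF k _ inj_external])
    show "set (map p (circle 0)) \<subseteq> Y" using num_ends_0 Y_mem by auto
    fix x assume "x \<in> Y"
    then obtain i where "i < 2 * K" "x = p (0, i)" by (rule Y_cases)
    then show "in_point (pattern D 0) (external x) = inp x" using inp_external by simp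
  qed
  moreover have "map external (map p (circle 0)) = [0..<2 * K]"
    unfolding num_ends_0 list.map_comp by (rule map_idI) auto
  ultimately show ?thesis using action_eq[OF M P] by auto
qed

end

section \<open>Smoothings as non-crossing matchings\<close>

lemma sorted_between:
  assumes "sorted_wrt (<) (us @ x # y # vs)" "z \<in> set (us @ vs)"
  shows "\<not> (x < z \<and> z < (y :: nat))"
  using assms by (auto simp: sorted_wrt_append)

text \<open>Neighbours in an increasing list have no other listed number between them, so the
  inserted strand cannot be crossed.\<close>

lemma ncw_noncrossing:
  "ncw inp xs n \<sigma> \<Longrightarrow> sorted_wrt (<) xs \<Longrightarrow> \<not> (i < j \<and> j < \<sigma> i \<and> \<sigma> i < \<sigma> (j :: nat))"
proof (induction arbitrary: i j rule: ncw.induct)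
  case (Ins us vs n \<sigma> x y)
  note m = mtsD[OF ncw_mts[OF Ins.hyps(1)]]
  have sorted: "sorted_wrt (<) (us @ vs)" "x < y" using Ins.prems by (auto simp: sorted_wrt_append)
  note IH = Ins.IH[OF sorted(1)]
  let ?s = "\<sigma>(x := y, y := x)"
  have between: "\<not> (x < z \<and> z < y)" if "z \<in> set (us @ vs)" for z
    using sorted_between[OF Ins.prems that] .
  have fixed: "\<sigma> z = z" if "z \<notin> set (us @ vs)" for z using m(4)[OF that] .
  show ?case
  proof
    assume *: "i < j \<and> j < ?s i \<and> ?s i < ?s j"
    show False
    proof (cases "i = x \<or> i = y")
      case True
      then have i: "i = x" using * sorted(2) by auto
      then have j: "x < j" "j < y" using * sorted(2) by auto
      then have "j \<noteq> x" "j \<noteq> y" by auto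
      then have "j \<in> set (us @ vs)" using * fixed[of j] i sorted(2) by (cases "j \<in> set (us @ vs)") auto
      then show False using between j by blast
    next
      case False
      then have si: "?s i = \<sigma> i" by auto
      have st: "i < j \<and> j < \<sigma> i \<and> \<sigma> i < ?s j" using * unfolding si .
      have iL: "i \<in> set (us @ vs)" using st fixed[of i] by (cases "i \<in> set (us @ vs)") auto
      then have sL: "\<sigma> i \<in> set (us @ vs)" using m(1) by blast
      show False
      proof (cases "j = x \<or> j = y")
        case True
        then have "j = x" using st sorted(2) by auto
        then have "x < \<sigma> i" "\<sigma> i < y" using st sorted(2) by auto
        then show False using between[OF sL] by blast
      next
        case False
        then show False using st IH[of i j] by auto
      qed
    qed
  qed
qed auto

text \<open>A strand whose ends have minimal distance encloses no end: a strand starting inside it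
  would have to stay inside and be shorter. So its ends are neighbours in the list, and it can be
  taken as the strand inserted last.\<close>

lemma noncrossing_ncw:
  assumes "sorted_wrt (<) (xs :: nat list)" "\<sigma> \<in> mts (set xs)" "\<And>i. i \<in> set xs \<Longrightarrow> inp (\<sigma> i) \<noteq> inp i"
    "\<And>i j. \<not> (i < j \<and> j < \<sigma> i \<and> \<sigma> i < \<sigma> j)"
  shows "\<exists>n. ncw inp xs n \<sigma>"
  using assms
proof (induction "length xs" arbitrary: xs \<sigma> rule: less_induct)
  case less
  note m = mtsD[OF less.prems(2)]
  show ?case
  proof (cases "xs = []")
    case True
    then have "\<sigma> = id" using m(4) by auto
    then show ?thesis using True ncw.Nil by auto
  next
    case False
    then obtain z where z: "z \<in> set xs" by (meson ex_in_conv set_empty)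
    have "\<exists>i. i \<in> set xs \<and> i < \<sigma> i"
      using z m(1)[OF z] m(2)[OF z] m(3)[of z] by (metis linorder_neqE_nat)
    then obtain i where i: "i \<in> set xs" "i < \<sigma> i"
      and min: "\<And>j. j \<in> set xs \<Longrightarrow> j < \<sigma> j \<Longrightarrow> \<sigma> i - i \<le> \<sigma> j - j"
      using ex_has_least_nat[of "\<lambda>i. i \<in> set xs \<and> i < \<sigma> i" _ "\<lambda>i. \<sigma> i - i"] by blast
    have between: "\<not> (i < j \<and> j < \<sigma> i)" if j: "j \<in> set xs" for j
    proof
      assume *: "i < j \<and> j < \<sigma> i"
      have 1: "\<not> \<sigma> i < \<sigma> j" using less.prems(4)[of i j] * by auto
      have 2: "\<not> \<sigma> j < i" using less.prems(4)[of "\<sigma> j" i] * m(3) by auto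
      have 3: "\<sigma> j \<noteq> \<sigma> i" "\<sigma> j \<noteq> i" using * m(3) by (metis less_irrefl)+
      have sj: "\<sigma> j \<in> set xs" "\<sigma> j \<noteq> j" "\<sigma> (\<sigma> j) = j" using m(1-3) j by auto
      show False
      proof (cases "j < \<sigma> j")
        case True
        then show False using min[OF j True] * 1 3 by linarith
      next
        case False
        then have "\<sigma> j < \<sigma> (\<sigma> j)" using sj by simp
        then show False using min[OF sj(1)] sj * 2 3 by fastforce
      qed
    qed
    obtain us ws where xs: "xs = us @ i # ws" using i(1) by (auto dest: split_list)
    have "\<sigma> i \<in> set ws"
      using m(1)[OF i(1)] i(2) less.prems(1) unfolding xs by (auto simp: sorted_wrt_append)
    then obtain w vs where ws: "ws = w # vs" by (cases ws) auto
    have "i < w" "w \<in> set xs" using less.prems(1) unfolding xs ws by (auto simp: sorted_wrt_append)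
    moreover have "w \<le> \<sigma> i" using \<open>\<sigma> i \<in> set ws\<close> less.prems(1) unfolding xs ws by (auto simp: sorted_wrt_append)
    ultimately have w: "w = \<sigma> i" using between[of w] by auto
    define y where "y = \<sigma> i"
    have xs': "xs = us @ i # y # vs" using xs ws w by (simp add: y_def)
    have dist: "distinct xs" using less.prems(1) by (simp add: strict_sorted_iff)
    define \<tau> where "\<tau> = \<sigma>(i := i, y := y)"
    have sy: "\<sigma> y = i" using m(3) by (simp add: y_def)
    have \<sigma>: "\<sigma> = \<tau>(i := y, y := i)" using sy by (auto simp: \<tau>_def y_def)
    have ne: "\<sigma> z = i \<longleftrightarrow> z = y" "\<sigma> z = y \<longleftrightarrow> z = i" for z using m(6) sy y_def by metis+
    have "\<exists>n. ncw inp (us @ vs) n \<tau>"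
    proof (rule less.hyps)
      show "length (us @ vs) < length xs" using xs' by simp
      show "sorted_wrt (<) (us @ vs)" using less.prems(1) unfolding xs' by (auto simp: sorted_wrt_append)
      show "\<tau> \<in> mts (set (us @ vs))"
        unfolding mts_def
      proof (rule CollectI, intro conjI ballI allI impI)
        fix z assume z: "z \<in> set (us @ vs)"
        then have z': "z \<noteq> i" "z \<noteq> y" "z \<in> set xs" using dist xs' by auto
        have "\<sigma> z \<in> set xs" "\<sigma> z \<noteq> i" "\<sigma> z \<noteq> y" using z' m(1) ne by auto
        then show "\<tau> z \<in> set (us @ vs)" "\<tau> z \<noteq> z" "\<tau> (\<tau> z) = z"
          using z' m(2,3) xs' by (auto simp: \<tau>_def)
      next
        fix z assume "z \<notin> set (us @ vs)"
        then show "\<tau> z = z" using m(4)[of z] xs' by (auto simp: \<tau>_def)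
      qed
      show "inp (\<tau> z) \<noteq> inp z" if "z \<in> set (us @ vs)" for z
      proof -
        have "z \<noteq> i" "z \<noteq> y" "z \<in> set xs" using dist xs' that by auto
        then show ?thesis using less.prems(3) by (simp add: \<tau>_def)
      qed
      show "\<not> (a < b \<and> b < \<tau> a \<and> \<tau> a < \<tau> b)" for a b
        using less.prems(4)[of a b] by (auto simp: \<tau>_def)
    qed
    then obtain n where n: "ncw inp (us @ vs) n \<tau>" ..
    have "ncw inp (us @ i # y # vs) (n + of_bool (inp y)) (\<tau>(i := y, y := i))"
      by (rule ncw.Ins[OF n]) (use dist xs' less.prems(3)[OF i(1)] in \<open>auto simp: y_def\<close>)
    then show ?thesis using xs' \<sigma> by auto
  qed
qed

lemma ncw_in_closers:
  "ncw inp xs n \<sigma> \<Longrightarrow> sorted_wrt (<) (xs :: nat list) \<Longrightarrow> n = int (card {i \<in> set xs. inp i \<and> \<sigma> i < i})"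
proof (induction rule: ncw.induct)
  case (Ins us vs n \<sigma> x y)
  note m = mtsD[OF ncw_mts[OF Ins.hyps(1)]]
  have sorted: "sorted_wrt (<) (us @ vs)" "x < y" using Ins.prems by (auto simp: sorted_wrt_append)
  let ?s = "\<sigma>(x := y, y := x)"
  let ?C = "{i \<in> set (us @ vs). inp i \<and> \<sigma> i < i}"
  have "{i \<in> set (us @ x # y # vs). inp i \<and> ?s i < i} = ?C \<union> (if inp y then {y} else {})"
    using Ins.hyps(2-4) sorted(2) by auto
  moreover have "card (?C \<union> (if inp y then {y} else {})) = card ?C + of_bool (inp y)"
    using Ins.hyps(3) by (subst card_Un_disjoint) auto
  ultimately show ?case using Ins.IH[OF sorted(1)] by simp
qed simp

lemma smoothing_iff: "\<sigma> \<in> smoothings k b \<longleftrightarrow> (\<exists>n. ncw (in_point b) [0..<2 * k] n \<sigma>)"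
proof
  assume s: "\<sigma> \<in> smoothings k b"
  show "\<exists>n. ncw (in_point b) [0..<2 * k] n \<sigma>"
  proof (rule noncrossing_ncw)
    show "\<sigma> \<in> mts (set [0..<2 * k])" using smoothing_mts[OF s] by (simp add: lessThan_atLeast0)
  qed (use s in \<open>auto simp: smoothings_def\<close>)
next
  assume "\<exists>n. ncw (in_point b) [0..<2 * k] n \<sigma>"
  then obtain n where n: "ncw (in_point b) [0..<2 * k] n \<sigma>" ..
  have m: "\<sigma> \<in> mts {..<2 * k}" using ncw_mts[OF n] by (simp add: lessThan_atLeast0)
  note m = mtsD[OF m]
  have "\<sigma> permutes {..<2 * k}"
    by (rule bij_imp_permutes) (use m in \<open>auto intro!: bij_betw_byWitness[where f' = \<sigma>]\<close>)
  then show "\<sigma> \<in> smoothings k b"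
    using ncw_noncrossing[OF n] ncw_opposite[OF n] m(3) unfolding smoothings_def by auto
qed

section \<open>Rotation numbers and alternating elements\<close>

lemma sum_in_out: "(\<Sum>i<2 * k. if in_point b i then - int i else int i) = (if b then int k else - int k)"
  by (induction k) (auto simp: in_point_def)

lemma card_in_points: "card {i. i < 2 * k \<and> in_point b i} = k"
proof (induction k)
  case (Suc k)
  have "{i. i < 2 * Suc k \<and> in_point b i} = insert (if b then 2 * k else Suc (2 * k)) {i. i < 2 * k \<and> in_point b i}"
    by (auto simp: in_point_def less_Suc_eq)
  moreover have "finite {i. i < 2 * k \<and> in_point b i}" by simp
  ultimately show ?case using Suc by (auto simp: card_insert_if)
qed simp

text \<open>The half with its sign is the total displacement of all strands, k or -k, divided by 2k;
  the other term collects -1/2 from each of the k strands.\<close>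

definition rotation_offset :: "nat \<Rightarrow> bool \<Rightarrow> rat" where
  "rotation_offset k b = (if b then 1 / 2 else - 1 / 2) - of_nat k / 2"

text \<open>Reducing the displacement of a strand modulo 2k adds 2k exactly if the in-point comes
  after the out-point, which is what the weight counts. The unreduced displacements have the same
  sum for all smoothings, because \<sigma> maps the in-points bijectively to the out-points.\<close>

lemma rotation_number_eq:
  assumes "ncw (in_point b) [0..<2 * k] n \<sigma>" "1 \<le> k"
  shows "rotation_number k b \<sigma> = of_int n + rotation_offset k b"
proof -
  let ?I = "{i. i < 2 * k \<and> in_point b i}" and ?O = "{i. i < 2 * k \<and> \<not> in_point b i}"
  have m: "\<sigma> \<in> mts {..<2 * k}" using ncw_mts[OF assms(1)] by (simp add: lessThan_atLeast0)
  note m = mtsD[OF m]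
  have fin: "finite ?I" "finite ?O" by simp_all
  have strand: "strand_rotation k i (\<sigma> i) = (of_int (int (\<sigma> i)) - of_int (int i)) / (2 * of_nat k) - 1 / 2 + of_bool (\<sigma> i < i)"
    if "i \<in> ?I" for i
  proof -
    have i: "i < 2 * k" "\<sigma> i < 2 * k" "\<sigma> i \<noteq> i" using that m(1,2)[of i] by auto
    have "(int (\<sigma> i) - int i) mod (2 * int k) = int (\<sigma> i) - int i + (if \<sigma> i < i then 2 * int k else 0)"
    proof (cases "\<sigma> i < i")
      case True
      then have "(int (\<sigma> i) - int i + 2 * int k) mod (2 * int k) = int (\<sigma> i) - int i + 2 * int k"
        using i by (intro mod_pos_pos_trivial) auto
      then show ?thesis using True by simp
    next
      case False
      then show ?thesis using i by (simp add: mod_pos_pos_trivial)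
    qed
    then have "strand_rotation k i (\<sigma> i) =
        (of_int (int (\<sigma> i) - int i + (if \<sigma> i < i then 2 * int k else 0)) - of_nat k) / (2 * of_nat k)"
      unfolding strand_rotation_def by (rule arg_cong)
    then show ?thesis using assms(2) by (cases "\<sigma> i < i") (simp_all add: field_simps)
  qed
  have "(\<Sum>i\<in>?I. int (\<sigma> i)) = (\<Sum>i\<in>?O. int i)"
  proof (rule sum.reindex_bij_witness[where i = \<sigma> and j = \<sigma>])
    fix i assume "i \<in> ?I"
    then show "\<sigma> i \<in> ?O" using m(1)[of i] ncw_opposite[OF assms(1), of i] by auto
  next
    fix i assume "i \<in> ?O"
    then show "\<sigma> i \<in> ?I" using m(1)[of i] ncw_opposite[OF assms(1), of i] by auto
  qed (use m(3) in auto)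
  moreover have "(\<Sum>i<2 * k. if in_point b i then - int i else int i) = (\<Sum>i\<in>?I. - int i) + (\<Sum>i\<in>?O. int i)"
  proof -
    have "{..<2 * k} \<inter> {i. in_point b i} = ?I" "{..<2 * k} \<inter> - {i. in_point b i} = ?O" by auto
    then show ?thesis by (simp add: sum.If_cases)
  qed
  ultimately have diff: "(\<Sum>i\<in>?I. int (\<sigma> i) - int i) = (if b then int k else - int k)"
    using sum_in_out[where k = k and b = b] by (simp add: sum_subtractf sum_negf)
  have sorted: "sorted_wrt (<) [0..<2 * k]" by simp
  have "{i \<in> set [0..<2 * k]. in_point b i \<and> \<sigma> i < i} = ?I \<inter> {i. \<sigma> i < i}" by auto
  then have n: "n = int (card (?I \<inter> {i. \<sigma> i < i}))" using ncw_in_closers[OF assms(1) sorted] by simp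
  have "rotation_number k b \<sigma> = (\<Sum>i\<in>?I. (of_int (int (\<sigma> i)) - of_int (int i)) / (2 * of_nat k) - 1 / 2 + of_bool (\<sigma> i < i))"
    unfolding rotation_number_def by (rule sum.cong[OF refl strand])
  also have "\<dots> = of_int (\<Sum>i\<in>?I. int (\<sigma> i) - int i) / (2 * of_nat k) - of_nat (card ?I) / 2 + of_nat (card (?I \<inter> {i. \<sigma> i < i}))"
    using fin by (simp add: sum.distrib sum_subtractf sum_divide_distrib[symmetric] of_int_sum sum_of_bool_eq)
  also have "\<dots> = of_int n + rotation_offset k b"
    unfolding diff card_in_points n rotation_offset_def using assms(2) by auto
  finally show ?thesis .
qed

text \<open>The exponent t + 2i carries the sign of r + i, which is half of (2r - t) + (t + 2i).
  This is the origin of the index 2r - t.\<close>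

lemma alternating_form_cone: "alternating_form r t p \<Longrightarrow> cone (2 * r - t) p"
proof -
  assume "alternating_form r t p"
  then obtain n a where a: "\<And>i. i \<le> n \<Longrightarrow> 0 \<le> a i"
    and p: "p = (\<Sum>i\<le>n. single (t + 2 * int i) (neg_one_pow (r + int i) * a i))"
    unfolding alternating_form_def by blast
  show ?thesis
    unfolding p
  proof (intro cone_sum cone_single)
    fix i assume "i \<in> {..n}"
    then have "0 \<le> a i" using a by simp
    moreover have "(2 * r - t + (t + 2 * int i)) div 2 = r + int i" by presburger
    moreover have "neg_one_pow s * neg_one_pow s = 1" for s by (simp add: neg_one_pow_def)
    ultimately show "neg_one_pow (r + int i) * a i = 0 \<or>
      even (2 * r - t + (t + 2 * int i)) \<and>
      0 < neg_one_pow ((2 * r - t + (t + 2 * int i)) div 2) * (neg_one_pow (r + int i) * a i)"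
      by (auto simp: mult.assoc[symmetric])
  qed
qed

text \<open>An alternating form occupies a finite window of exponents. The window is widened
  symmetrically about \<open>t\<close> and padded with zero coefficients; moving its start by 2N
  exponents moves the sign by N steps.\<close>

lemma cone_alternating_form:
  assumes "cone (2 * r - t) p" "\<And>e. e \<in> keys p \<Longrightarrow> t - 2 * int N \<le> e \<and> e \<le> t + 2 * int N"
  shows "alternating_form (r - int N) (t - 2 * int N) p"
proof -
  define e where "e = (\<lambda>i. t - 2 * int N + 2 * int i)"
  define a where "a = (\<lambda>i. neg_one_pow (r - int N + int i) * lookup p (e i))"
  have "(2 * r - t + e i) div 2 = r - int N + int i" for i unfolding e_def by presburger
  then have "0 \<le> a i" for i using cone_nonneg[OF assms(1), of "e i"] by (simp add: a_def)
  moreover have "p = (\<Sum>i\<le>2 * N. single (e i) (neg_one_pow (r - int N + int i) * a i))"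
  proof (rule poly_mapping_eqI)
    fix x
    have sq: "neg_one_pow s * (neg_one_pow s * c) = c" for s c by (simp add: neg_one_pow_def)
    have "lookup (\<Sum>i\<le>2 * N. single (e i) (neg_one_pow (r - int N + int i) * a i)) x
        = (\<Sum>i\<le>2 * N. if e i = x then lookup p x else 0)"
      unfolding lookup_sum by (intro sum.cong) (auto simp: lookup_single when_def a_def sq)
    also have "\<dots> = lookup p x"
    proof (cases "x \<in> keys p")
      case True
      then have "even (2 * r - t + x)" using coneD(1)[OF assms(1)] by (simp add: in_keys_iff)
      then obtain l where l: "x - t + 2 * int N = 2 * l" by (metis evenE dvd_diff_right_iff dvd_triv_left even_add even_diff)
      have "0 \<le> l" "l \<le> 2 * int N" using assms(2)[OF True] l by linarith+
      then have i: "nat l \<le> 2 * N" "e i = x \<longleftrightarrow> i = nat l" for i using l by (auto simp: e_def)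
      show ?thesis unfolding i(2) using i(1) by (simp add: sum.delta)
    next
      case False
      then have 0: "lookup p x = 0" by (simp add: in_keys_iff)
      show ?thesis unfolding 0 by simp
    qed
    finally show "lookup p x = lookup (\<Sum>i\<le>2 * N. single (e i) (neg_one_pow (r - int N + int i) * a i)) x" by simp
  qed
  ultimately show ?thesis unfolding alternating_form_def e_def by blast
qed

text \<open>A signed monomial is nonzero, so it determines the cone index modulo 4. Conversely a
  window about \<open>t\<close> that contains all exponents of \<open>p\<close> serves the monomial
  as well.\<close>

lemma same_parity_iff: "same_parity p (single t (neg_one_pow r)) \<longleftrightarrow> cone (2 * r - t) p"
proof
  assume "same_parity p (single t (neg_one_pow r))"
  then obtain r0 t0 where "alternating_form r0 t0 p" "alternating_form r0 t0 (single t (neg_one_pow r))"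
    unfolding same_parity_def by blast
  then have c: "cone (2 * r0 - t0) p" "cone (2 * r0 - t0) (single t (neg_one_pow r))"
    by (simp_all add: alternating_form_cone)
  have "lookup (single t (neg_one_pow r)) t \<noteq> 0" by (simp add: neg_one_pow_def)
  from coneD[OF c(2) this] have 1: "even (2 * r0 - t0 + t)" "0 < neg_one_pow ((2 * r0 - t0 + t) div 2) * neg_one_pow r"
    by simp_all
  then have "even ((2 * r0 - t0 + t) div 2 + r)"
    by (auto simp: neg_one_pow_def split: if_splits)
  with 1(1) have "even (2 * r - t - (2 * r0 - t0))" "even ((2 * r - t - (2 * r0 - t0)) div 2)"
    by presburger+
  then show "cone (2 * r - t) p" using c(1) cone_even_cong by blast
next
  assume c: "cone (2 * r - t) p"
  obtain N :: nat where N: "\<And>e. e \<in> keys p \<Longrightarrow> \<bar>e - t\<bar> \<le> int N"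
  proof -
    have "\<bar>e - t\<bar> \<le> int (nat (\<Sum>e\<in>keys p. \<bar>e - t\<bar>))" if "e \<in> keys p" for e
      using member_le_sum[of e "keys p" "\<lambda>e. \<bar>e - t\<bar>"] that by (simp add: sum_nonneg)
    then show thesis using that by blast
  qed
  have "alternating_form (r - int N) (t - 2 * int N) p"
    by (rule cone_alternating_form[OF c]) (use N in fastforce)
  moreover have "cone (2 * r - t) (single t (neg_one_pow r))"
    by (rule cone_single) (auto simp: neg_one_pow_def)
  then have "alternating_form (r - int N) (t - 2 * int N) (single t (neg_one_pow r))"
    by (rule cone_alternating_form) (auto split: if_splits)
  ultimately show "same_parity p (single t (neg_one_pow r))"
    unfolding same_parity_def by blast
qed

lemma two_rotation_offset: "2 * rotation_offset k b \<in> \<int>"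
proof -
  have "2 * rotation_offset k b = of_int ((if b then 1 else -1) - int k)"
    by (simp add: rotation_offset_def)
  then show ?thesis by (metis Ints_of_int)
qed

text \<open>With r = R + c1 and t = R + c2 the cone index 2r - t equals R + 2 c1 - c2. Since R is
  the weight plus a constant, index minus weight is the same number for all smoothings; it is read
  off from one smoothing that occurs in \<open>P\<close>.\<close>

lemma alternating_alt:
  assumes "P \<in> smoothing_module k b" "1 \<le> k" "alternating k b P"
  shows "\<exists>\<kappa>. alt (in_point b) [0..<2 * k] \<kappa> P"
proof (cases "P = 0")
  case False
  then obtain \<sigma>0 where s0: "\<sigma>0 \<in> keys P" by (metis all_not_in_conv keys_eq_empty)
  from assms(3) obtain c1 c2 where c: "\<And>\<sigma>. \<sigma> \<in> smoothings k b \<Longrightarrow> \<exists>r t :: int.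
      of_int r = rotation_number k b \<sigma> + c1 \<and> of_int t = rotation_number k b \<sigma> + c2 \<and>
      cone (2 * r - t) (lookup P \<sigma>)"
    unfolding alternating_def same_parity_iff by blast
  have each: "\<exists>n m. ncw (in_point b) [0..<2 * k] n \<sigma> \<and> cone m (lookup P \<sigma>) \<and>
      of_int (m - n) = rotation_offset k b + 2 * c1 - c2" if "\<sigma> \<in> keys P" for \<sigma>
  proof -
    have sm: "\<sigma> \<in> smoothings k b" using assms(1) that by (auto simp: smoothing_module_def)
    then obtain n where n: "ncw (in_point b) [0..<2 * k] n \<sigma>" using smoothing_iff by blast
    obtain r t where rt: "of_int r = rotation_number k b \<sigma> + c1" "of_int t = rotation_number k b \<sigma> + c2"
      "cone (2 * r - t) (lookup P \<sigma>)" using c[OF sm] by blast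
    have "of_int (2 * r - t - n) = rotation_offset k b + 2 * c1 - c2"
      using rt rotation_number_eq[OF n assms(2)] by simp
    then show ?thesis using n rt(3) by blast
  qed
  obtain n0 m0 where nm0: "of_int (m0 - n0) = rotation_offset k b + 2 * c1 - c2" using each[OF s0] by blast
  have "alt (in_point b) [0..<2 * k] (m0 - n0) P"
    unfolding alt_def
  proof
    fix \<sigma> assume "\<sigma> \<in> keys P"
    then obtain n m where nm: "ncw (in_point b) [0..<2 * k] n \<sigma>" "cone m (lookup P \<sigma>)"
      "of_int (m - n) = rotation_offset k b + 2 * c1 - c2" using each by blast
    then have "(of_int (m - n) :: rat) = of_int (m0 - n0)" using nm0 by simp
    then have "m - n = m0 - n0" by (simp only: of_int_eq_iff)
    then have "m = m0 - n0 + n" by simp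
    then show "\<exists>n. ncw (in_point b) [0..<2 * k] n \<sigma> \<and> cone (m0 - n0 + n) (lookup P \<sigma>)" using nm by blast
  qed
  then show ?thesis ..
qed auto

lemma alt_alternating:
  assumes "alt (in_point b) [0..<2 * k] \<kappa> P" "1 \<le> k"
  shows "alternating k b P"
proof -
  \<comment> \<open>The same constant serves as \<open>c1\<close> and as \<open>c2\<close>. Then r
    and t both equal n + \<kappa>, and so does the index 2r - t.\<close>
  define c where "c = of_int \<kappa> - rotation_offset k b"
  have "2 * c = of_int (2 * \<kappa>) - 2 * rotation_offset k b" by (simp add: c_def)
  then have c: "2 * c \<in> \<int>" using two_rotation_offset[of k b] by (metis Ints_diff Ints_of_int)
  have each: "\<exists>r t :: int. of_int r = rotation_number k b \<sigma> + c \<and> of_int t = rotation_number k b \<sigma> + c \<and>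
      same_parity (lookup P \<sigma>) (single t (neg_one_pow r))" if "\<sigma> \<in> smoothings k b" for \<sigma>
  proof -
    obtain n where n: "ncw (in_point b) [0..<2 * k] n \<sigma>"
      using \<open>\<sigma> \<in> smoothings k b\<close> smoothing_iff by blast
    have "of_int (n + \<kappa>) = rotation_number k b \<sigma> + c"
      using rotation_number_eq[OF n assms(2)] by (simp add: c_def)
    moreover have "cone (2 * (n + \<kappa>) - (n + \<kappa>)) (lookup P \<sigma>)"
      using alt_cone[OF assms(1) n] by (simp add: algebra_simps)
    ultimately show ?thesis unfolding same_parity_iff by blast
  qed
  moreover have "alternating_poly (lookup P \<sigma>)" if "\<sigma> \<in> smoothings k b" for \<sigma>
    using each[OF that] unfolding same_parity_def alternating_poly_def by blast
  ultimately show ?thesis unfolding alternating_def using c by blast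
qed

lemma alt_module: "alt (in_point b) [0..<2 * k] \<kappa> P \<Longrightarrow> P \<in> smoothing_module k b"
  unfolding alt_def smoothing_module_def using smoothing_iff by blast

text \<open>A unary basic diagram is itself a type-A diagram, so \<open>scoh_action\<close> carries
  coherence, and in particular the signs, along any sequence of closures.\<close>

lemma scoh_coherently_alternating:
  assumes "scoh (in_point b) [0..<2 * k] \<kappa> P" "1 \<le> k"
  shows "P \<in> coherently_alternating k b"
proof -
  have "1 \<le> k' \<and> (\<exists>\<kappa>. scoh (in_point b') [0..<2 * k'] \<kappa> Q)" if "iterated_closure k b P l k' b' Q" for l k' b' Q
    using that
  proof (induction rule: iterated_closure.induct)
    case start
    then show ?case using assms by blast
  next
    case (step l k' b' Q D k'')
    then obtain \<kappa>' where k': "1 \<le> k'" and sc: "scoh (in_point b') [0..<2 * k'] \<kappa>' Q" by blast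
    have D: "type_A D" "num_inputs D = 1" using step.hyps(2) by (auto simp: unary_basic_def)
    interpret input_diagram D "\<lambda>_. k'" k''
      by standard (use D step.hyps k' in \<open>auto simp: le_antisym\<close>)
    have one: "j = 1" if "j \<in> set js" for j using that D by auto
    have "\<exists>\<kappa>. scoh (in_point (pattern D 0)) [0..<2 * k''] \<kappa> (action D (\<lambda>_. Q))"
    proof (rule scoh_action)
      fix j assume j: "j \<in> set js"
      show "keys Q \<subseteq> smoothings (num_ends D j div 2) (pattern D j)"
        using alt_module[OF scoh_alt[OF sc]] step.hyps one[OF j] by (simp add: smoothing_module_def)
      show "\<exists>\<kappa>. scoh (in_point (pattern D j)) [0..<num_ends D j] \<kappa> Q"
        using sc step.hyps one[OF j] by auto
    qed
    then show ?case using K_pos by simp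
  qed
  then have "alternating k' b' Q" if "partial_closure k b P k' b' Q" for k' b' Q
    using that alt_alternating scoh_alt unfolding partial_closure_def by blast
  then show ?thesis
    unfolding coherently_alternating_def
    using alt_module[OF scoh_alt[OF assms(1)]] alt_alternating[OF scoh_alt[OF assms(1)] assms(2)] assms(2) by blast
qed

section \<open>Closing up neighbouring ends by a unary basic diagram\<close>

lemma mts_eqI: "\<sigma> \<in> mts Z \<Longrightarrow> \<tau> \<in> mts Z \<Longrightarrow> (\<And>z. z \<in> Z \<Longrightarrow> \<sigma> z = \<tau> z) \<Longrightarrow> \<sigma> = \<tau>"
  by (rule ext) (metis mtsD(4))

lemma relabel_relabel:
  assumes "keys P \<subseteq> mts Z" "Z \<subseteq> X" "inj_on f X" "f ` Z \<subseteq> X'" "inj_on g X'"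
  shows "relabel X' g (relabel X f P) = relabel Z (g \<circ> f) P"
  unfolding relabel_def push_push
proof (rule push_cong)
  fix \<sigma> assume "\<sigma> \<in> keys P"
  then have s: "\<sigma> \<in> mts Z" using assms by auto
  have f: "inj_on f Z" using assms(2,3) inj_on_subset by blast
  have gf: "inj_on (g \<circ> f) Z" using f assms(4,5) by (auto intro: comp_inj_on inj_on_subset)
  have 1: "relabel_matching X f \<sigma> \<in> mts (f ` Z)" by (rule relabel_matching_mts[OF s assms(2,3)])
  have 2: "relabel_matching X' g (relabel_matching X f \<sigma>) \<in> mts (g ` f ` Z)"
    by (rule relabel_matching_mts[OF 1 assms(4,5)])
  have 3: "relabel_matching Z (g \<circ> f) \<sigma> \<in> mts (g ` f ` Z)"
    using relabel_matching_mts[OF s order_refl gf] by (simp only: image_comp)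
  have "relabel_matching X' g (relabel_matching X f \<sigma>) = relabel_matching Z (g \<circ> f) \<sigma>"
  proof (rule mts_eqI[OF 2 3])
    fix w assume "w \<in> g ` f ` Z"
    then obtain z where z: "z \<in> Z" "w = g (f z)" by blast
    have "relabel_matching X' g (relabel_matching X f \<sigma>) (g (f z)) = g (relabel_matching X f \<sigma> (f z))"
      by (rule relabel_matching_image[OF assms(5)]) (use z(1) assms(4) in blast)
    also have "\<dots> = g (f (\<sigma> z))" using relabel_matching_image[OF assms(3)] z(1) assms(2) by (metis subsetD)
    also have "\<dots> = relabel_matching Z (g \<circ> f) \<sigma> ((g \<circ> f) z)"
      using relabel_matching_image[OF gf z(1)] by simp
    finally show "relabel_matching X' g (relabel_matching X f \<sigma>) w = relabel_matching Z (g \<circ> f) \<sigma> w"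
      using z(2) by simp
  qed
  then show "(relabel_matching X' g \<circ> relabel_matching X f) \<sigma> = relabel_matching Z (g \<circ> f) \<sigma>"
    by (simp only: comp_apply[of "relabel_matching X' g"])
qed simp

lemma relabel_ident:
  assumes "keys P \<subseteq> mts Z" "\<And>z. z \<in> Z \<Longrightarrow> f z = z"
  shows "relabel Z f P = P"
  unfolding relabel_def
proof (rule push_ident)
  fix \<sigma> assume "\<sigma> \<in> keys P"
  then have s: "\<sigma> \<in> mts Z" using assms by auto
  have inj: "inj_on f Z" using assms(2) by (simp add: inj_on_def)
  have "relabel_matching Z f \<sigma> \<in> mts (f ` Z)" by (rule relabel_matching_mts[OF s order_refl inj])
  moreover have "f ` Z = Z" using assms(2) by force
  ultimately have "relabel_matching Z f \<sigma> \<in> mts Z" by simp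
  then show "relabel_matching Z f \<sigma> = \<sigma>"
    by (rule mts_eqI[OF _ s]) (metis relabel_matching_image[OF inj] assms(2) mtsD(1)[OF s])
qed

text \<open>Counts orbits without describing them as sets: the labels are invariant, and every point
  is joined in both directions to the representative of its label.\<close>

lemma card_orbits_by_label:
  assumes A: "\<And>x. x \<in> A \<Longrightarrow> lab (\<phi> x) = lab x" "\<And>x. x \<in> A \<Longrightarrow> lab x \<in> C"
      "\<And>x. x \<in> A \<Longrightarrow> (x, rep (lab x)) \<in> (graph_of A \<phi>)\<^sup>*" "\<And>x. x \<in> A \<Longrightarrow> (rep (lab x), x) \<in> (graph_of A \<phi>)\<^sup>*"
    and C: "\<And>c. c \<in> C \<Longrightarrow> rep c \<in> A" "\<And>c. c \<in> C \<Longrightarrow> lab (rep c) = c"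
  shows "card (orbits A \<phi>) = card C"
proof -
  let ?R = "(graph_of A \<phi>)\<^sup>*"
  have lab: "lab y = lab x" if "(x, y) \<in> ?R" for x y
    using that by (induction rule: rtrancl_induct) (use A(1) in \<open>auto simp: graph_of_def\<close>)
  have cl: "?R `` {x} = ?R `` {rep (lab x)}" if "x \<in> A" for x
    using A(3,4)[OF that] by (auto intro: rtrancl_trans)
  have "orbits A \<phi> = (\<lambda>c. ?R `` {rep c}) ` C"
  proof (intro equalityI subsetI)
    fix B assume "B \<in> orbits A \<phi>"
    then obtain x where "x \<in> A" "B = ?R `` {x}" unfolding orbits_def by (auto elim: quotientE)
    then show "B \<in> (\<lambda>c. ?R `` {rep c}) ` C" using cl A(2) by blast
  next
    fix B assume "B \<in> (\<lambda>c. ?R `` {rep c}) ` C"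
    then show "B \<in> orbits A \<phi>" unfolding orbits_def using C(1) by (auto intro: quotientI)
  qed
  moreover have "inj_on (\<lambda>c. ?R `` {rep c}) C"
  proof (rule inj_onI)
    fix c c' assume c: "c \<in> C" "c' \<in> C" "?R `` {rep c} = ?R `` {rep c'}"
    then have "(rep c, rep c') \<in> ?R" by blast
    then show "c = c'" using lab C(2) c by metis
  qed
  ultimately show ?thesis by (simp add: card_image)
qed

text \<open>The curl is placed at end \<open>i\<close> and the next one. As \<open>i\<close> runs
  through all positions, the pair across the marked point is included; two strands are required so
  that the external circle keeps an end.\<close>

locale curl_position =
  fixes k i :: nat and b :: bool
  assumes k: "2 \<le> k" and i: "i < 2 * k"
begin

abbreviation "N \<equiv> 2 * k"

definition pt :: "nat \<Rightarrow> nat" where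
  "pt l = (if i + l < N then i + l else i + l - N)"

definition off :: "nat \<Rightarrow> nat" where
  "off m = (if i \<le> m then m - i else m + N - i)"

lemma pt_off [simp]: "l < N \<Longrightarrow> pt l < N" "m < N \<Longrightarrow> off m < N" "l < N \<Longrightarrow> off (pt l) = l" "m < N \<Longrightarrow> pt (off m) = m"
  using i by (auto simp: pt_def off_def)

lemma pt_eq_iff [simp]: "l < N \<Longrightarrow> l' < N \<Longrightarrow> pt l = pt l' \<longleftrightarrow> l = l'"
  by (metis pt_off(3))

lemma even_at: "even (pt l) \<longleftrightarrow> even (i + l)"
  by (auto simp: pt_def)

text \<open>Ends are counted from the curl: \<open>pt 0\<close> and \<open>pt 1\<close> are its
  ends, and \<open>pt (m + 2)\<close> is joined to the external end \<open>m\<close>. The external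
  marked point thus lies just behind the curl, and its pattern starts with the type of
  \<open>i\<close>, since skipping two ends preserves types.\<close>

definition closing :: diagram where
  "closing = \<lparr>num_inputs = 1, num_ends = (\<lambda>j. if j = 0 then N - 2 else N),
     partner = (\<lambda>(j, m). if j = 0 then (1, pt (m + 2)) else if off m = 0 then (1, pt 1)
       else if off m = 1 then (1, pt 0) else (0, off m - 2)),
     tail = (\<lambda>(j, m). if j = 0 then in_point b (i + m) else \<not> in_point b m)\<rparr>"

lemma closing_simps [simp]:
  "num_inputs closing = 1" "num_ends closing 0 = N - 2" "num_ends closing (Suc 0) = N"
  "partner closing (0, m) = (1, pt (m + 2))"
  "tail closing (0, m) = in_point b (i + m)" "tail closing (Suc 0, m) = (\<not> in_point b m)"
  by (simp_all add: closing_def)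

lemma partner_at: "l < N \<Longrightarrow> partner closing (Suc 0, pt l) =
    (if l = 0 then (1, pt 1) else if l = 1 then (1, pt 0) else (0, l - 2))"
  by (simp add: closing_def)

lemma next_at:
  assumes "l < N"
  shows "next_end closing (Suc 0, pt l) = (1, pt (if l = 0 then N - 1 else l - 1))"
proof -
  have "(pt l + N - 1) mod N = pt (if l = 0 then N - 1 else l - 1)"
  proof (cases "pt l = 0")
    case True
    then show ?thesis using assms i k by (auto simp: pt_def split: if_splits)
  next
    case False
    then have "(pt l + N - 1) mod N = pt l - 1"
      using pt_off(1)[OF assms] by (metis Nat.add_diff_assoc2 Suc_leI gr0I One_nat_def less_imp_diff_less mod_add_self2 mod_less)
    then show ?thesis using assms i k False by (auto simp: pt_def split: if_splits)
  qed
  then show ?thesis by simp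
qed

lemma arc_end_cases:
  assumes "x \<in> arc_ends closing"
  obtains (external) m where "x = (0, m)" "m < N - 2" | (input) l where "x = (Suc 0, pt l)" "l < N"
proof -
  obtain j m where x: "x = (j, m)" by (cases x)
  then have "j = 0 \<or> j = 1" "m < num_ends closing j" using assms by (auto simp: arc_ends_def)
  then show thesis
    using that(1)[of m] that(2)[of "off m"] pt_off x by auto
qed

lemma arc_ends_closing: "(0, m) \<in> arc_ends closing \<longleftrightarrow> m < N - 2" "(Suc 0, m) \<in> arc_ends closing \<longleftrightarrow> m < N"
  by (auto simp: arc_ends_def)

lemma arc_ends_set: "arc_ends closing = Pair 0 ` {..<N - 2} \<union> Pair 1 ` {..<N}"
  by (auto simp: arc_ends_def le_Suc_eq)

lemma well_formed_closing: "well_formed closing"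
  unfolding well_formed_def
proof
  fix x assume "x \<in> arc_ends closing"
  then show "partner closing x \<in> arc_ends closing \<and> partner closing x \<noteq> x \<and> partner closing (partner closing x) = x"
    by (cases rule: arc_end_cases) (use k in \<open>auto simp: partner_at arc_ends_closing\<close>)
qed

lemma card_arcs_closing: "card (arcs closing) = N - 1"
proof -
  have "finite (arc_ends closing)" by (simp add: arc_ends_set)
  then have "card (arc_ends closing) = 2 * card (arcs closing)" using card_arc_ends well_formed_closing by blast
  moreover have "card (arc_ends closing) = (N - 2) + N"
    unfolding arc_ends_set by (subst card_Un_disjoint) (auto simp: card_image inj_on_def)
  ultimately show ?thesis using k by simp
qed

abbreviation "walk \<equiv> next_end closing \<circ> partner closing"

lemma walk_simps:
  "m < N - 2 \<Longrightarrow> walk (0, m) = (Suc 0, pt (m + 1))"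
  "walk (Suc 0, pt 0) = (Suc 0, pt 0)" "walk (Suc 0, pt 1) = (Suc 0, pt (N - 1))"
  "2 \<le> l \<Longrightarrow> l < N - 1 \<Longrightarrow> walk (Suc 0, pt l) = (0, l - 1)" "walk (Suc 0, pt (N - 1)) = (0, 0)"
proof -
  show "m < N - 2 \<Longrightarrow> walk (0, m) = (Suc 0, pt (m + 1))"
    using next_at[of "m + 2"] by (simp del: next_end.simps)
  show "walk (Suc 0, pt 0) = (Suc 0, pt 0)" "walk (Suc 0, pt 1) = (Suc 0, pt (N - 1))"
    using k next_at[of 1] next_at[of 0] by (simp_all add: partner_at del: next_end.simps)
  show "2 \<le> l \<Longrightarrow> l < N - 1 \<Longrightarrow> walk (Suc 0, pt l) = (0, l - 1)"
    using k by (simp add: partner_at Suc_diff_le)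
  have "Suc (N - 3) = N - 2" "N - 1 - 2 = N - 3" using k by auto
  then show "walk (Suc 0, pt (N - 1)) = (0, 0)"
    using k by (simp add: partner_at)
qed

lemma card_faces_closing: "card (faces closing) = N - 1"
proof -
  let ?A = "arc_ends closing"
  let ?R = "(graph_of ?A walk)\<^sup>*"
  \<comment> \<open>The label \<open>N - 2\<close> is the monogon inside the curl, 0 is the face on
    the other side of the curl, with three arc ends, and any other label \<open>c\<close> is the
    bigon between the arcs to the external ends \<open>c - 1\<close> and \<open>c\<close>.\<close>
  define lab :: "arc_end \<Rightarrow> nat" where "lab = (\<lambda>(j, m). if j = 0 then m else if off m = 0 then N - 2
    else if off m = N - 1 then 0 else off m - 1)"
  define rep :: "nat \<Rightarrow> arc_end" where "rep = (\<lambda>c. if c = N - 2 then (1, pt 0) else (0, c))"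
  have lab: "lab (0, m) = m" "l < N \<Longrightarrow> lab (Suc 0, pt l) = (if l = 0 then N - 2 else if l = N - 1 then 0 else l - 1)" for l m
    by (auto simp: lab_def)
  have st: "(x, walk x) \<in> ?R" if "x \<in> ?A" for x
    unfolding graph_of_def using that by blast
  have in_A: "m < N - 2 \<Longrightarrow> (0, m) \<in> ?A" "l < N \<Longrightarrow> (Suc 0, pt l) \<in> ?A" for m l
    by (simp_all add: arc_ends_closing)
  have cases: "lab (walk x) = lab x \<and> lab x < N - 1 \<and> (x, rep (lab x)) \<in> ?R \<and> (rep (lab x), x) \<in> ?R" if "x \<in> ?A" for x
    using that
  proof (cases rule: arc_end_cases)
    case (external m)
    then have "lab (walk x) = m" using k walk_simps(1)[of m] lab(2)[of "m + 1"] by auto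
    then show ?thesis using external k by (auto simp: lab rep_def)
  next
    case (input l)
    consider "l = 0" | "l = 1" | "2 \<le> l" "l < N - 1" | "l = N - 1" using input(2) by linarith
    then show ?thesis
    proof cases
      case 1
      then show ?thesis using input walk_simps(2) k by (auto simp: lab rep_def)
    next
      case 2
      have "(x, walk x) \<in> ?R" "(walk x, walk (walk x)) \<in> ?R"
        using st[of x] st[of "(Suc 0, pt (N - 1))"] that in_A(2)[of "N - 1"] input 2 walk_simps(3) k by auto
      then have "(x, (0, 0)) \<in> ?R" using input 2 walk_simps(3,5) by (metis rtrancl_trans)
      moreover have "((0, 0), x) \<in> ?R" using st[OF in_A(1)[of 0]] walk_simps(1)[of 0] input 2 k by simp
      ultimately show ?thesis using input 2 walk_simps(3) k lab(2)[of "N - 1"] lab(2)[of 1] by (auto simp: rep_def)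
    next
      case 3
      have "(x, (0, l - 1)) \<in> ?R" using st[OF that] walk_simps(4)[OF 3] input by simp
      moreover have "((0, l - 1), x) \<in> ?R"
        using st[OF in_A(1)[of "l - 1"]] walk_simps(1)[of "l - 1"] input 3 by simp
      ultimately show ?thesis using input 3 walk_simps(4)[OF 3] lab(2)[of l] lab(1)[of "l - 1"] by (auto simp: rep_def)
    next
      case 4
      have "(x, (0, 0)) \<in> ?R" using st[OF that] walk_simps(5) input 4 by simp
      moreover have "((0, 0), (Suc 0, pt 1)) \<in> ?R" using st[OF in_A(1)[of 0]] walk_simps(1)[of 0] k by simp
      moreover have "((Suc 0, pt 1), x) \<in> ?R" using st[OF in_A(2)[of 1]] walk_simps(3) k input 4 by simp
      ultimately show ?thesis using input 4 walk_simps(5) lab(2)[of "N - 1"] lab(1)[of 0] k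
        by (auto simp: rep_def intro: rtrancl_trans)
    qed
  qed
  have "card (orbits ?A walk) = card {..<N - 1}"
  proof (rule card_orbits_by_label[where lab = lab and rep = rep])
    fix c assume "c \<in> {..<N - 1}"
    then show "rep c \<in> ?A" "lab (rep c) = c" using k lab(2)[of 0] in_A(2)[of 0] in_A(1)[of c] by (auto simp: rep_def lab(1))
  qed (use cases in auto)
  moreover have "faces closing = orbits ?A walk"
    by (simp add: faces_def orbits_def graph_of_def)
  ultimately show ?thesis by simp
qed

lemma curls_closing: "card (curls closing) = 1"
proof -
  have "curls closing = {{(1, pt 0), (1, pt 1)}}"
  proof (intro equalityI subsetI)
    fix a assume "a \<in> curls closing"
    then have "a \<in> arcs closing" and f: "fst ` a = {1}" by (auto simp: curls_def)
    then obtain x where x: "x \<in> arc_ends closing" "a = {x, partner closing x}" by (auto simp: arcs_def)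
    from x(1) show "a \<in> {{(1, pt 0), (1, pt 1)}}"
    proof (cases rule: arc_end_cases)
      case external
      then show ?thesis using f x by auto
    next
      case (input l)
      then show ?thesis using f x by (auto simp: partner_at split: if_splits)
    qed
  next
    fix a :: "arc_end set"
    assume "a \<in> {{(1, pt 0), (1, pt 1)}}"
    then have a: "a = {(1, pt 0), (1, pt 1)}" by simp
    have "(1, pt 0) \<in> arc_ends closing" "partner closing (1, pt 0) = (1, pt 1)"
      using k by (simp_all add: arc_ends_closing partner_at)
    then have "a = {(1, pt 0), partner closing (1, pt 0)}" "(1, pt 0) \<in> arc_ends closing" using a by simp_all
    then have "a \<in> arcs closing" unfolding arcs_def by (rule image_eqI)
    moreover have "fst ` a = {1}" by (simp add: a)
    ultimately show "a \<in> curls closing" by (simp add: curls_def)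
  qed
  then show ?thesis by simp
qed

lemma type_A_closing: "type_A closing"
  unfolding type_A_def
proof (intro conjI ballI allI impI)
  show "well_formed closing" by (rule well_formed_closing)
  show "0 < num_ends closing 0" using k by simp
  show "planar closing" using k by (simp add: planar_def card_faces_closing card_arcs_closing)
  show "connected_pieces (arcs closing \<union> input_circles closing)"
    unfolding connected_pieces_def
  proof (intro ballI)
    let ?F = "arcs closing \<union> input_circles closing" and ?C = "{1} \<times> {..<N}"
    let ?r = "{(X, Y). X \<in> ?F \<and> Y \<in> ?F \<and> X \<inter> Y \<noteq> {}}"
    have C: "?C \<in> ?F" by (simp add: input_circles_def)
    have meet: "B \<inter> ?C \<noteq> {}" if "B \<in> ?F" for B
      using that
    proof
      assume "B \<in> arcs closing"
      then obtain x where x: "x \<in> arc_ends closing" "B = {x, partner closing x}" by (auto simp: arcs_def)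
      from x(1) show ?thesis
        by (cases rule: arc_end_cases) (use x(2) k in auto)
    next
      assume "B \<in> input_circles closing"
      then have "B = ?C" by (auto simp: input_circles_def)
      moreover have "(1, 0) \<in> ?C" using k by simp
      ultimately show ?thesis by blast
    qed
    fix B B' assume "B \<in> ?F" "B' \<in> ?F"
    then have "(B, ?C) \<in> ?r" "(?C, B') \<in> ?r" using C meet[of B] meet[of B'] by blast+
    then show "(B, B') \<in> ?r\<^sup>*" by (meson r_into_rtrancl rtrancl_trans)
  qed
next
  fix x assume "x \<in> arc_ends closing"
  then show "tail closing (partner closing x) \<longleftrightarrow> \<not> tail closing x"
    by (cases rule: arc_end_cases) (use k in \<open>auto simp: partner_at in_point_def even_at\<close>)
next
  fix j m assume "j \<le> num_inputs closing" "m < num_ends closing j"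
  then have "j = 0 \<and> m < N - 2 \<or> j = 1 \<and> m < N" by (cases j) auto
  then show "tail closing (j, (m + 1) mod num_ends closing j) \<longleftrightarrow> \<not> tail closing (j, m)"
  proof
    assume *: "j = 0 \<and> m < N - 2"
    have "even ((m + 1) mod (N - 2)) \<longleftrightarrow> even (m + 1)" by (simp add: dvd_mod_iff)
    then show ?thesis using * by (auto simp: in_point_def)
  next
    assume *: "j = 1 \<and> m < N"
    have "even ((m + 1) mod N) \<longleftrightarrow> even (m + 1)" by (simp add: dvd_mod_iff)
    then show ?thesis using * by (auto simp: in_point_def)
  qed
qed

lemma unary_basic_closing: "unary_basic closing"
  by (simp add: unary_basic_def type_A_closing curls_closing)

lemma pattern_closing: "pattern closing 1 = b" "pattern closing 0 = in_point b i"
  by (auto simp: pattern_def in_point_def)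

definition rest :: "nat list" where
  "rest = map (\<lambda>l. pt (l + 2)) [0..<N - 2]"

lemma rotated: "pt 0 # pt 1 # rest = [i..<N] @ [0..<i]"
proof -
  have "[0..<N] = 0 # 1 # map (\<lambda>l. l + 2) [0..<N - 2]"
  proof (rule nth_equalityI)
    fix l assume "l < length [0..<N]"
    then show "[0..<N] ! l = (0 # 1 # map (\<lambda>l. l + 2) [0..<N - 2]) ! l"
      by (cases l; cases "l - 1") auto
  qed (use k in simp)
  then have "map pt [0..<N] = pt 0 # pt 1 # rest" by (simp add: rest_def)
  moreover have "map pt [0..<N] = [i..<N] @ [0..<i]"
    by (rule nth_equalityI) (use i in \<open>auto simp: pt_def nth_append\<close>)
  ultimately show ?thesis by simp
qed

abbreviation "Z \<equiv> {..<N} - {pt 0, pt 1}"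

lemma set_rest: "set rest = Z"
proof -
  have "distinct (pt 0 # pt 1 # rest)" unfolding rotated by auto
  moreover have "set (pt 0 # pt 1 # rest) = {..<N}" unfolding rotated using i by auto
  ultimately show ?thesis by auto
qed

text \<open>The operator closes \<open>pt 0\<close> with \<open>pt 1\<close> and renumbers the other
  ends from there on. Renumbering can be undone, so coherence known for the operator passes to the
  closure on the original ends.\<close>

lemma scoh_closing:
  assumes P: "keys P \<subseteq> smoothings k b"
  defines "Q \<equiv> action closing (\<lambda>_. P)"
  shows "Q \<in> smoothing_module (k - 1) (in_point b i)"
    "scoh (in_point (in_point b i)) [0..<2 * (k - 1)] \<kappa> Q \<Longrightarrow> scoh (in_point b) rest \<kappa> (cl (pt 0) (pt 1) P)"
proof -
  interpret U: input_diagram closing "\<lambda>_. k" "k - 1"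
    by standard (use type_A_closing k in \<open>auto simp: le_Suc_eq algebra_simps\<close>)
  have js: "[1..<Suc (num_inputs closing)] = [1]" by simp
  have kP: "keys P \<subseteq> mts {..<N}" using P smoothing_mts by blast
  have N01: "0 < N" "1 < N" "pt 0 < N" "pt 1 < N" "pt 0 \<noteq> pt 1" using k by auto
  define C where "C = cl (pt 0) (pt 1) P"
  have kC: "keys C \<subseteq> mts Z" unfolding C_def by (rule keys_cl[OF kP]) (use N01 in auto)
  have I: "(j, m) \<in> U.I \<longleftrightarrow> j = 1 \<and> m < N" for j m
    by (auto simp: le_antisym)
  have p01: "partner closing (Suc 0, pt 0) = (1, pt 1)" "partner closing (Suc 0, pt (Suc 0)) = (1, pt 0)"
    using k by (simp_all add: partner_at)
  let ?M = "[((1, pt 0), (1, pt 1))]"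
  have "Q = relabel U.Y U.external (cls ?M (tensors (map (\<lambda>j. relabel {..<num_ends closing j} (Pair j) P) [1..<Suc (num_inputs closing)])))"
    unfolding Q_def
  proof (rule U.action_eq)
    show "distinct (pair_ends ?M)" using N01 by simp
    show "set (pair_ends ?M) = {x \<in> U.I. partner closing x \<in> U.I}"
    proof (intro equalityI subsetI)
      fix x :: arc_end
      assume "x \<in> set (pair_ends ?M)"
      then show "x \<in> {x \<in> U.I. partner closing x \<in> U.I}" using N01 p01 by (auto simp: I)
    next
      fix x :: arc_end
      assume x: "x \<in> {x \<in> U.I. partner closing x \<in> U.I}"
      then obtain m where m: "x = (1, m)" "m < N" using I by (cases x) auto
      then have "x = (Suc 0, pt (off m))" "off m < N" by simp_all
      then show "x \<in> set (pair_ends ?M)" using x by (auto simp: I partner_at split: if_splits)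
    qed
    show "\<And>x y. (x, y) \<in> set ?M \<Longrightarrow> partner closing x = y" using N01 by (auto simp: partner_at)
    show "keys P \<subseteq> smoothings (num_ends closing j div 2) (pattern closing j)"
      if "j \<in> set [1..<Suc (num_inputs closing)]" for j
      using that P pattern_closing by simp
  qed
  then have "Q = relabel U.Y U.external (cl (1, pt 0) (1, pt 1) (relabel {..<N} (Pair 1) P))"
    unfolding js by (simp add: tensor_unit)
  also have "cl (1, pt 0) (1, pt 1) (relabel {..<N} (Pair 1) P) = relabel {..<N} (Pair (1 :: nat)) C"
    unfolding C_def by (rule cl_relabel[OF kP]) (use N01 in \<open>auto simp: inj_on_def\<close>)
  also have "relabel U.Y U.external (relabel {..<N} (Pair (1 :: nat)) C) = relabel Z (U.external \<circ> Pair 1) C"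
  proof (rule relabel_relabel[OF kC])
    show "Pair (1 :: nat) ` Z \<subseteq> U.Y"
    proof
      fix x assume "x \<in> Pair (1 :: nat) ` Z"
      then obtain z where z: "x = (1, z)" "z \<in> set rest" unfolding set_rest by blast
      then obtain l where "l < N - 2" "x = partner closing (0, l)" by (auto simp: rest_def)
      then show "x \<in> U.Y" using U.Y_mem[of l] by (simp add: algebra_simps)
    qed
  next
    show "inj_on (Pair (1 :: nat)) {..<N}" by (simp add: inj_on_def)
    show "inj_on U.external U.Y" by (rule U.inj_external)
  qed auto
  finally have Q: "Q = relabel Z (U.external \<circ> Pair 1) C" .
  define h where "h = U.external \<circ> Pair 1"
  have ext: "h (pt (l + 2)) = l" if "l < N - 2" for l
    using U.external_partner[of l] that by (simp add: h_def algebra_simps)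
  have rest_h: "map h rest = [0..<2 * (k - 1)]"
    unfolding rest_def list.map_comp by (rule nth_equalityI) (use ext in \<open>auto simp: algebra_simps\<close>)
  have Zl: "\<exists>l. l < N - 2 \<and> z = pt (l + 2)" if "z \<in> Z" for z
    using that unfolding set_rest[symmetric] by (auto simp: rest_def)
  have inj_h: "inj_on h Z"
    by (rule inj_onI) (metis Zl ext)
  have inp_h: "in_point (in_point b i) (h z) = in_point b z" if "z \<in> Z" for z
  proof -
    obtain l where "l < N - 2" "z = pt (l + 2)" using Zl[OF \<open>z \<in> Z\<close>] by blast
    then show ?thesis using ext[of l] even_at[of "l + 2"] by (auto simp: in_point_def)
  qed
  show "Q \<in> smoothing_module (k - 1) (in_point b i)"
    unfolding smoothing_module_def
  proof (rule CollectI, rule subsetI)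
    fix \<rho> assume "\<rho> \<in> keys Q"
    then obtain \<sigma>' where "\<sigma>' \<in> keys C" "\<rho> = relabel_matching Z h \<sigma>'"
      unfolding Q relabel_def h_def using keys_push by fast
    then obtain \<sigma> where s: "\<sigma> \<in> keys P" "\<rho> = relabel_matching Z h (close_matching (pt 0) (pt 1) \<sigma>)"
      unfolding C_def cl_def using keys_push by fast
    then obtain n where "ncw (in_point b) [0..<N] n \<sigma>" using P smoothing_iff by blast
    moreover have "[0..<N] = [0..<i] @ [i..<N]" using i upt_add_eq_append[of 0 i "N - i"] by simp
    ultimately have "ncw (in_point b) ([i..<N] @ [0..<i]) (n + (\<Sum>x\<leftarrow>[0..<i]. sign_of (in_point b) x)) \<sigma>"
      using ncw_rotates[of "in_point b" "[0..<i]" "[i..<N]" n \<sigma>] by simp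
    then obtain n' where n': "ncw (in_point b) (pt 0 # pt 1 # rest) n' \<sigma>" unfolding rotated by blast
    have "in_point b (pt 0) \<noteq> in_point b (pt 1)" using even_at[of 0] even_at[of 1] by (auto simp: in_point_def)
    then obtain n'' where n'': "ncw (in_point b) rest n'' (close_matching (pt 0) (pt 1) \<sigma>)"
      using ncw_close[OF n', of "[]" "pt 0" "pt 1" rest] by auto
    have "ncw (in_point (in_point b i)) (map h rest) n'' \<rho>"
      unfolding s(2) by (rule ncw_relabel_matching[OF n'']) (use set_rest inj_h inp_h in auto)
    then show "\<rho> \<in> smoothings (k - 1) (in_point b i)" unfolding rest_h smoothing_iff by blast
  qed
  assume sc: "scoh (in_point (in_point b i)) [0..<2 * (k - 1)] \<kappa> Q"
  \<comment> \<open>The inverse of the renumbering \<open>h\<close>.\<close>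
  define g where "g = (\<lambda>l. pt (l + 2))"
  have hZ: "h ` Z \<subseteq> {..<2 * (k - 1)}" using Zl ext by (fastforce simp: algebra_simps)
  have inj_g: "inj_on g {..<2 * (k - 1)}" by (rule inj_onI) (auto simp: g_def)
  have "relabel {..<2 * (k - 1)} g Q = relabel Z (g \<circ> h) C"
    unfolding Q h_def[symmetric] by (rule relabel_relabel[OF kC order_refl inj_h hZ inj_g])
  also have "\<dots> = C"
  proof (rule relabel_ident[OF kC])
    fix z assume "z \<in> Z"
    then obtain l where "l < N - 2" "z = pt (l + 2)" using Zl by blast
    then show "(g \<circ> h) z = z" using ext by (simp add: g_def)
  qed
  finally have C: "relabel {..<2 * (k - 1)} g Q = C" .
  have "scoh (in_point b) (map g [0..<2 * (k - 1)]) \<kappa> (relabel {..<2 * (k - 1)} g Q)"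
  proof (rule scoh_relabel[OF sc _ inj_g])
    fix l assume "l \<in> {..<2 * (k - 1)}"
    then show "in_point b (g l) = in_point (in_point b i) l"
      using even_at[of "l + 2"] by (auto simp: g_def in_point_def)
  qed (auto simp: lessThan_atLeast0)
  moreover have "map g [0..<2 * (k - 1)] = rest" by (simp add: rest_def g_def diff_mult_distrib2)
  ultimately show "scoh (in_point b) rest \<kappa> (cl (pt 0) (pt 1) P)" using C C_def by simp
qed

end

text \<open>The inductive definition appends operators at the end of a sequence; this puts one at
  its beginning.\<close>

lemma iterated_closure_step:
  assumes "unary_basic D" "num_ends D 1 = 2 * k" "pattern D 1 = b" "num_ends D 0 = 2 * k1"
    "iterated_closure k1 (pattern D 0) (action D (\<lambda>_. P)) l k' b' Q"
  shows "iterated_closure k b P (Suc l) k' b' Q"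
  using assms(5)
proof (induction rule: iterated_closure.induct)
  case start
  show ?case by (rule iterated_closure.step[OF iterated_closure.start assms(1-4)])
next
  case (step l k' b' Q D' k'')
  then show ?case by (intro iterated_closure.step)
qed

text \<open>Fewer than k - 1 operators after this one make fewer than k operators on
  \<open>P\<close>, so the bound in \<open>partial_closure\<close> passes on exactly.\<close>

lemma coherent_closing:
  assumes P: "P \<in> coherently_alternating k b" and k: "2 \<le> k" and i: "i < 2 * k"
  shows "action (curl_position.closing k i b) (\<lambda>_. P) \<in> coherently_alternating (k - 1) (in_point b i)"
proof -
  interpret curl_position k i b by standard (use k i in auto)
  let ?Q = "action closing (\<lambda>_. P)"
  have kP: "keys P \<subseteq> smoothings k b" using P by (auto simp: coherently_alternating_def smoothing_module_def)
  have pc: "alternating k' b' R" if "partial_closure k b P k' b' R" for k' b' R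
    using P that by (auto simp: coherently_alternating_def)
  have step: "iterated_closure k b P (Suc l) k' b' R"
    if "iterated_closure (k - 1) (in_point b i) ?Q l k' b' R" for l k' b' R
    using iterated_closure_step[OF unary_basic_closing, of k b "k - 1" P l k' b' R] that pattern_closing
    by (simp add: diff_mult_distrib2)
  have "alternating k' b' R" if "partial_closure (k - 1) (in_point b i) ?Q k' b' R" for k' b' R
  proof -
    obtain l where "l < k - 1" "iterated_closure (k - 1) (in_point b i) ?Q l k' b' R"
      using \<open>partial_closure (k - 1) (in_point b i) ?Q k' b' R\<close> unfolding partial_closure_def by blast
    then have "Suc l < k" "iterated_closure k b P (Suc l) k' b' R" using step by auto
    then show ?thesis using pc unfolding partial_closure_def by blast
  qed
  moreover have "alternating (k - 1) (in_point b i) ?Q"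
  proof (rule pc)
    have "iterated_closure k b P (Suc 0) (k - 1) (in_point b i) ?Q" by (rule step[OF iterated_closure.start])
    then show "partial_closure k b P (k - 1) (in_point b i) ?Q"
      unfolding partial_closure_def using k by (intro exI[of _ "Suc 0"]) simp
  qed
  ultimately show ?thesis
    using scoh_closing(1)[OF kP] k unfolding coherently_alternating_def by auto
qed

text \<open>The closures of neighbouring ends are coherent by induction, but on a rotated list and
  with an unknown offset. \<open>scoh_rotation\<close> restores the order where necessary;
  \<open>alt_cl_consistent\<close> shows that the offset required by \<open>scohI\<close> is also
  valid, and \<open>scoh_change\<close> installs it.\<close>

lemma coherently_alternating_scoh:
  "P \<in> coherently_alternating k b \<Longrightarrow> \<exists>\<kappa>. scoh (in_point b) [0..<2 * k] \<kappa> P"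
proof (induction k arbitrary: b P rule: less_induct)
  case (less k)
  have k1: "1 \<le> k" and mod: "P \<in> smoothing_module k b" and alt: "alternating k b P"
    using less.prems by (auto simp: coherently_alternating_def)
  have kP: "keys P \<subseteq> smoothings k b" using mod by (simp add: smoothing_module_def)
  obtain \<kappa> where a: "alt (in_point b) [0..<2 * k] \<kappa> P" using alternating_alt[OF mod k1 alt] by blast
  \<comment> \<open>Starting the cyclic list at \<open>i\<close> treats list neighbours and the
    wrap-around pair, where \<open>i\<close> is the last end, in the same way.\<close>
  have closing: "\<exists>\<kappa>'. scoh (in_point b) xs \<kappa>' (cl x y P)"
    if rot: "2 \<le> k" "i < 2 * k" "[i..<2 * k] @ [0..<i] = x # y # xs" for i x y xs
  proof -
    interpret curl_position k i b by standard (use that in auto)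
    have xy: "x = pt 0" "y = pt 1" "xs = rest" using rotated rot(3) by auto
    obtain \<kappa>' where "scoh (in_point (in_point b i)) [0..<2 * (k - 1)] \<kappa>' (action closing (\<lambda>_. P))"
      using less.IH[OF _ coherent_closing[OF less.prems rot(1,2)]] rot(1) by auto
    then show ?thesis using scoh_closing(2)[OF kP] xy by blast
  qed
  have "scoh (in_point b) [0..<2 * k] \<kappa> P"
  proof (rule scohI[OF a])
    fix us x y vs assume *: "[0..<2 * k] = us @ x # y # vs" "us @ vs \<noteq> []" "in_point b x \<noteq> in_point b y"
    let ?i = "length us"
    have len: "2 * k = length us + 2 + length vs" using arg_cong[OF *(1), of length] by simp
    then have k2: "2 \<le> k" "?i < 2 * k" using *(2) by (cases us; cases vs; auto)+
    have "us = take ?i [0..<2 * k]" "x # y # vs = drop ?i [0..<2 * k]" unfolding *(1) by simp_all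
    then have "us = [0..<?i]" "x # y # vs = [?i..<2 * k]" using k2(2) by (simp_all add: take_upt)
    then have "[?i..<2 * k] @ [0..<?i] = x # y # (vs @ us)" by simp
    then obtain \<kappa>' where "scoh (in_point b) (vs @ us) \<kappa>' (cl x y P)" using closing[OF k2] by blast
    then obtain \<kappa>'' where s: "scoh (in_point b) (us @ vs) \<kappa>'' (cl x y P)" using scoh_rotation by blast
    have "alt (in_point b) (us @ vs) (\<kappa> + of_bool (in_point b x)) (cl x y P)"
      by (rule alt_cl_consistent[OF _ *(3) scoh_alt[OF s]]) (use a * in simp)
    then show "scoh (in_point b) (us @ vs) (\<kappa> + of_bool (in_point b x)) (cl x y P)"
      by (rule scoh_change[OF s])
  next
    fix us x y assume *: "[0..<2 * k] = y # us @ [x]" "us \<noteq> []" "in_point b x \<noteq> in_point b y"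
    let ?i = "2 * k - 1"
    have len: "2 * k = length us + 2" using arg_cong[OF *(1), of length] by simp
    then have k2: "2 \<le> k" "?i < 2 * k" using *(2) by (cases us; auto)+
    have "[0..<2 * k] = [0..<?i] @ [?i]" using k2 by (metis Suc_diff_1 k1 le_add_diff_inverse2 less_le_trans nat_0_less_mult_iff upt_Suc_append zero_le zero_less_one zero_less_numeral)
    then have "[0..<?i] = y # us" "x = ?i" using *(1) by (metis append_Cons butlast_snoc, metis append_Cons last_snoc)
    moreover have "[?i..<2 * k] = [?i]" using k2 by (simp add: upt_rec)
    ultimately have "[?i..<2 * k] @ [0..<?i] = x # y # us" by simp
    then obtain \<kappa>' where s: "scoh (in_point b) us \<kappa>' (cl x y P)" using closing[OF k2] by blast
    have "alt (in_point b) us (\<kappa> + sign_of (in_point b) x + of_bool (in_point b x)) (cl x y P)"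
      by (rule alt_cl_consistent_wrap[OF _ *(3) scoh_alt[OF s]]) (use a * in simp)
    then show "scoh (in_point b) us (\<kappa> + sign_of (in_point b) x + of_bool (in_point b x)) (cl x y P)"
      by (rule scoh_change[OF s])
  qed
  then show ?case ..
qed

theorem theorem1:
  fixes D :: diagram and d K :: nat and k :: "nat \<Rightarrow> nat" and P :: "nat \<Rightarrow> element"
  assumes "type_A D"
    and "num_inputs D = d" and "d \<ge> 1"
    and "\<And>i. 1 \<le> i \<Longrightarrow> i \<le> d \<Longrightarrow> num_ends D i = 2 * k i"
    and "num_ends D 0 = 2 * K"
    and "\<And>i. 1 \<le> i \<Longrightarrow> i \<le> d \<Longrightarrow> P i \<in> coherently_alternating (k i) (pattern D i)"
  shows "action D P \<in> coherently_alternating K (pattern D 0)"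
proof -
  interpret input_diagram D k K
    by standard (use assms in \<open>auto simp: coherently_alternating_def\<close>)
  have j: "1 \<le> j" "j \<le> d" if "j \<in> set [1..<Suc (num_inputs D)]" for j using that assms(2) by auto
  have "\<exists>\<kappa>. scoh (in_point (pattern D 0)) [0..<2 * K] \<kappa> (action D P)"
  proof (rule scoh_action)
    fix j assume "j \<in> set [1..<Suc (num_inputs D)]"
    note j = j[OF this]
    show "keys (P j) \<subseteq> smoothings (num_ends D j div 2) (pattern D j)"
      using assms(4)[OF j] assms(6)[OF j] by (simp add: coherently_alternating_def smoothing_module_def)
    show "\<exists>\<kappa>. scoh (in_point (pattern D j)) [0..<num_ends D j] \<kappa> (P j)"
      using coherently_alternating_scoh[OF assms(6)[OF j]] assms(4)[OF j] by simp
  qed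
  then show ?thesis using scoh_coherently_alternating K_pos by blast
qed

end
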